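(* Let $N$ be a positive integer and let $m,p,q$ be real numbers with $1<m<N$, $q>m$, $p\geq 0$. Set $$a_{m,q}=\frac{(N-1)q-N(m-1)}{q+1-m}.$$ Below, "solution" means a positive non-constant radial solution $r\mapsto u(r)$ of $-\Delta_m u=u^{p}|\nabla u|^{q}$ in an interval $(a,b)\subseteq(0,\infty)$. (i) If $u$ is a solution in $(a,b)$ with $a=0$, then $u$ is bounded near $0$, decreasing and singular: there is $u_0$ such that $$\lim_{r\to0}u=u_0>0,\qquad \lim_{r\to0}r|u'|^{q-m+1}=\frac{a_{m,q}}{u_0^{p}} .$$ For given $u_0>0$ there exist infinitely many such solutions. (ii) If $u$ is a solution in $(a,b)$ with $b=\infty$, then $u$ admits a limit $l\geq 0$ at infinity and $$\lim_{r\to\infty}r^{\frac{N-m}{m-1}}|u(r)-l|=k\quad\text{for some }k>0 .$$ Furthermore, for given $l>0$ and $c\neq0$ there exists a unique local solution near $\infty$ such that $$\lim_{r\to\infty}r^{\frac{N-m}{m-1}}(u(r)-l)=c .$$ (iii) For any $u_0>0$ there exist infinitely many solutions in $(0,\infty)$, decreasing, such that $\lim_{r\to0}u=u_0$, but a unique one satisfying $$\lim_{r\to0}u=u_0\quad\text{and}\quad\lim_{r\to\infty}u=0 .$$ There exist infinitely many solutions defined on an interval $(0,\rho)$ (with $0<\rho<\infty$) such that $\lim_{r\to\rho}u=0$, and infinitely many solutions defined on an interval $(0,\rho)$ such that $\lim_{r\to\rho}u'=-\infty$. Finally, there exist infinitely many solutions in an interval $(\rho,\infty)$ (with $0<\rho<\infty$)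 such that $\lim_{r\to\rho}u=0$, and infinitely many solutions in an interval $(\rho,\infty)$ such that $\lim_{r\to\rho}u'=\infty$.
   Context: $\Delta_m u:=\operatorname{div}(|\nabla u|^{m-2}\nabla u)$ is the $m$-Laplacian in $\mathbb{R}^N$. A radial solution $u(x)=u(r)$, $r=|x|$, of $-\Delta_m u=u^p|\nabla u|^q$ on an interval is a $C^1$ function $u$ of $r$ on this interval, with $|u'|^{m-2}u'$ also of class $C^1$, satisfying $$r^{1-N}\left(r^{N-1}|u'|^{m-2}u'\right)'+u^{p}|u'|^{q}=0 .$$ "Local solution near $\infty$" means a solution defined on some interval $(R,\infty)$; uniqueness is understood up to the choice of $R$, i.e. two such solutions coincide for large $r$. *)

theory Defs
  imports "HOL-Analysis.Analysis"
begin

definition a_coeff :: "nat \<Rightarrow> real \<Rightarrow> real \<Rightarrow> real" where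
  "a_coeff N m q = ((real N - 1) * q - real N * (m - 1)) / (q + 1 - m)"

definition flux :: "real \<Rightarrow> (real \<Rightarrow> real) \<Rightarrow> real \<Rightarrow> real" where
  "flux m u r = \<bar>deriv u r\<bar> powr (m - 2) * deriv u r"

text \<open>
  Solutions are total functions of which only the values on the interval matter. The endpoints are
  extended reals, so that \<^term>\<open>einterval a \<infinity>\<close> covers the unbounded intervals. Since
  \<^prop>\<open>(0::real) powr s = 0\<close> for every \<^term>\<open>s\<close>, \<^const>\<open>flux\<close> vanishes at critical
  points of \<^term>\<open>u\<close>, also when \<^prop>\<open>(m::real) < 2\<close>. The real power \<^term>\<open>u r powr p\<close> is
  the intended one because \<^term>\<open>u\<close> is required to be positive in \<open>is_solution\<close> below; in
  particular it is \<open>1\<close> if \<open>p = 0\<close>.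
\<close>

definition radial_solution ::
    "nat \<Rightarrow> real \<Rightarrow> real \<Rightarrow> real \<Rightarrow> ereal \<Rightarrow> ereal \<Rightarrow> (real \<Rightarrow> real) \<Rightarrow> bool" where
  "radial_solution N m p q a b u \<longleftrightarrow>
     u C1_differentiable_on einterval a b \<and>
     flux m u C1_differentiable_on einterval a b \<and>
     (\<forall>r\<in>einterval a b.
        r powr (1 - real N) * deriv (\<lambda>s. s powr (real N - 1) * flux m u s) r
          + u r powr p * \<bar>deriv u r\<bar> powr q = 0)"

definition is_solution ::
    "nat \<Rightarrow> real \<Rightarrow> real \<Rightarrow> real \<Rightarrow> ereal \<Rightarrow> ereal \<Rightarrow> (real \<Rightarrow> real) \<Rightarrow> bool" where
  "is_solution N m p q a b u \<longleftrightarrow>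
     0 \<le> a \<and> a < b \<and> radial_solution N m p q a b u \<and>
     (\<forall>r\<in>einterval a b. 0 < u r) \<and> \<not> u constant_on einterval a b"

text \<open>
  Representatives of the solutions on an interval: being \<^const>\<open>extensional\<close> fixes the irrelevant
  values outside the interval, so that counting these functions counts solutions on the interval.
\<close>

definition solutions ::
    "nat \<Rightarrow> real \<Rightarrow> real \<Rightarrow> real \<Rightarrow> ereal \<Rightarrow> ereal \<Rightarrow> (real \<Rightarrow> real) set" where
  "solutions N m p q a b = {u \<in> extensional (einterval a b). is_solution N m p q a b u}"

text \<open>
  The behaviour at \<open>0\<close> with limit \<open>u\<^sub>0\<close>. The solution is singular in the sense that its
  derivative blows up, although \<^term>\<open>u\<close> itself stays bounded.
\<close>

definition singular_at_0 :: "nat \<Rightarrow> real \<Rightarrow> real \<Rightarrow> real \<Rightarrow> real \<Rightarrow> (real \<Rightarrow> real) \<Rightarrow> bool" where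
  "singular_at_0 N m p q u0 u \<longleftrightarrow>
     (u \<longlongrightarrow> u0) (at_right 0) \<and>
     filterlim (deriv u) at_bot (at_right 0) \<and>
     ((\<lambda>r. r * \<bar>deriv u r\<bar> powr (q - m + 1)) \<longlongrightarrow> a_coeff N m q / u0 powr p) (at_right 0)"

end

theory Submission
  imports Defs
begin

text \<open>
  The flux \<open>r\<^sup>N\<^sup>-\<^sup>1 |u'|\<^sup>m\<^sup>-\<^sup>2 u'\<close> satisfies a linear differential inequality, so \<open>u'\<close> has no zero along a
  non-constant solution. In the variable \<open>s = r powr - nu\<close> with \<open>nu = (N - m) / (m - 1)\<close> the equation
  becomes the pair \<open>v' = e Y powr - alpha\<close>, \<open>Y' = e coef (s powr kappa) (v powr p)\<close> with \<open>e = \<plusminus>1\<close>, whose right-hand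
  sides each depend on one unknown only. Infinity corresponds to \<open>s = 0\<close>, where this system is regular,
  which gives the expansion at infinity and its parametrisation by \<open>(l, c)\<close>; the origin corresponds to
  \<open>s = \<infinity>\<close>, where \<open>v' = O(s powr - (alpha (kappa + 1)))\<close> with \<open>alpha (kappa + 1) > 1\<close> is integrable, so \<open>u\<close> stays
  bounded although \<open>u'\<close> blows up like \<open>r powr - alpha\<close>. Solutions of the
  various types are obtained from the Cauchy data \<open>(v, Y)\<close> at one point, including the degenerate data
  \<open>v = 0\<close> (\<open>u\<close> reaches \<open>0\<close>) and \<open>Y = 0\<close> (\<open>u'\<close> becomes infinite). The system has a one-parameter scaling
  group, which adjusts the limit \<open>u0\<close> at the origin and shows that only one solution vanishes at infinity.
\<close>

text \<open>The function \<open>r powr - nu\<close> is the nonconstant radial m-harmonic function,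
  so in this variable the divergence reduces to the derivative of \<open>|v'| powr (m - 1)\<close>.
  Dividing by \<open>|v'| powr q\<close> then leaves an equation for
  \<open>|v'| powr (m - 1 - q)\<close>, which is \<open>Y\<close>. The obstacle is the degenerate
  data: \<open>v powr p\<close> is not Lipschitz at \<open>v = 0\<close> when
  \<open>0 < p < 1\<close>, and \<open>Y powr - alpha\<close> is singular at \<open>Y = 0\<close>.
  In the direction in which both unknowns grow, the unknown that starts positive stays above its
  initial value and pushes the other one away from 0 at least linearly. One existence and uniqueness
  lemma, applied with the two unknowns in either order, therefore covers both degenerate cases;
  \<open>alpha < 1\<close>, that is \<open>q > m\<close>, keeps the singularity integrable. For
  \<open>e = - 1\<close> growth is restored by reversing \<open>s\<close>. Only data prescribed at
  \<open>s = 0\<close> with \<open>e = - 1\<close>, from which both unknowns decrease, call for a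
  separate local construction.\<close>

section \<open>Gronwall's inequality and estimates for real powers\<close>

lemma gronwall_zero:
  fixes f f' :: "real \<Rightarrow> real"
  assumes cont: "continuous_on {a..b} f"
    and deriv: "\<And>x. a < x \<Longrightarrow> x < b \<Longrightarrow> (f has_real_derivative f' x) (at x)"
    and bound: "\<And>x. a < x \<Longrightarrow> x < b \<Longrightarrow> \<bar>f' x\<bar> \<le> C * f x"
    and nonneg: "\<And>x. x \<in> {a..b} \<Longrightarrow> 0 \<le> f x"
    and c: "c \<in> {a..b}" "f c = 0" and x: "x \<in> {a..b}"
  shows "f x = 0"
proof (cases "c \<le> x")
  case True
  \<comment> \<open>To the right of \<open>c\<close> the bound \<open>f' \<le> C f\<close> makes
    \<open>f t * exp (- C * t)\<close> nonincreasing; to the left, \<open>f' \<ge> - C f\<close>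
    makes \<open>f t * exp (C * t)\<close> nondecreasing. The zero at \<open>c\<close> thus spreads
    both ways.\<close>
  have "f c * exp (- C * c) \<ge> f x * exp (- C * x)"
  proof (rule DERIV_nonpos_imp_decreasing_open[OF True])
    fix t assume t: "c < t" "t < x"
    then have t': "a < t" "t < b" using c x by auto
    have "((\<lambda>t. f t * exp (- C * t)) has_real_derivative (f' t - C * f t) * exp (- C * t)) (at t)"
      using deriv[OF t'] by (auto intro!: derivative_eq_intros simp: algebra_simps)
    moreover have "(f' t - C * f t) * exp (- C * t) \<le> 0"
      using bound[OF t'] by (intro mult_nonpos_nonneg) auto
    ultimately show "\<exists>y. ((\<lambda>t. f t * exp (- C * t)) has_real_derivative y) (at t) \<and> y \<le> 0" by blast
  next
    have "continuous_on {c..x} f" by (rule continuous_on_subset[OF cont]) (use c x in auto)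
    then show "continuous_on {c..x} (\<lambda>t. f t * exp (- C * t))" by (intro continuous_intros)
  qed
  then have "f x * exp (- C * x) \<le> 0" using c by simp
  then have "f x \<le> 0" by (simp add: mult_le_0_iff)
  then show ?thesis using nonneg[OF x] by linarith
next
  case False
  then have xc: "x \<le> c" by simp
  have "f x * exp (C * x) \<le> f c * exp (C * c)"
  proof (rule DERIV_nonneg_imp_increasing_open[OF xc])
    fix t assume t: "x < t" "t < c"
    then have t': "a < t" "t < b" using c x by auto
    have "((\<lambda>t. f t * exp (C * t)) has_real_derivative (f' t + C * f t) * exp (C * t)) (at t)"
      using deriv[OF t'] by (auto intro!: derivative_eq_intros simp: algebra_simps)
    moreover have "(f' t + C * f t) * exp (C * t) \<ge> 0"
      using bound[OF t'] by (intro mult_nonneg_nonneg) auto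
    ultimately show "\<exists>y. ((\<lambda>t. f t * exp (C * t)) has_real_derivative y) (at t) \<and> 0 \<le> y" by blast
  next
    have "continuous_on {x..c} f" by (rule continuous_on_subset[OF cont]) (use c x in auto)
    then show "continuous_on {x..c} (\<lambda>t. f t * exp (C * t))" by (intro continuous_intros)
  qed
  then have "f x * exp (C * x) \<le> 0" using c by simp
  then have "f x \<le> 0" by (simp add: mult_le_0_iff)
  then show ?thesis using nonneg[OF x] by linarith
qed

text \<open>Mean value inequality. The derivative is bounded only between \<open>x\<close> and
  \<open>y\<close>, so \<open>B\<close> may depend on the pair; near the singularity of the power it
  is allowed to grow.\<close>

lemma powr_diff_le_mvt:
  fixes x y :: real
  assumes "0 < x" "0 < y" and B: "\<And>z. min x y \<le> z \<Longrightarrow> z \<le> max x y \<Longrightarrow> \<bar>P\<bar> * z powr (P - 1) \<le> B"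
  shows "\<bar>x powr P - y powr P\<bar> \<le> B * \<bar>x - y\<bar>"
proof -
  have "norm (x powr P - y powr P) \<le> B * norm (x - y)"
  proof (rule field_differentiable_bound[where S="{min x y..max x y}" and f'="\<lambda>z. P * z powr (P - 1)"])
    fix z assume z: "z \<in> {min x y..max x y}"
    then have "z > 0" using assms by auto
    then show "((\<lambda>z. z powr P) has_field_derivative P * z powr (P - 1)) (at z within {min x y..max x y})"
      by (auto intro!: derivative_eq_intros simp: powr_diff)
    show "norm (P * z powr (P - 1)) \<le> B" using z B[of z] by (simp add: abs_mult)
  qed auto
  then show ?thesis by simp
qed

text \<open>A power is monotone in its base, so it is at most one of its two endpoint values; taking
  their sum spares later proofs the case distinction on the sign of \<open>P\<close>.\<close>

lemma powr_le_max:
  fixes z c M P :: real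
  assumes "0 < c" "c \<le> z" "z \<le> M"
  shows "z powr P \<le> c powr P + M powr P"
proof (cases "P \<ge> 0")
  case True
  then have "z powr P \<le> M powr P" using assms by (intro powr_mono2) auto
  then show ?thesis by (smt (verit) powr_ge_zero)
next
  case False
  then have "z powr P \<le> c powr P" using assms by (intro powr_mono2') auto
  then show ?thesis by (smt (verit) powr_ge_zero)
qed

lemma powr_lipschitz:
  fixes c M P :: real
  assumes "0 < c"
  shows "\<exists>L\<ge>0. \<forall>x\<in>{c..M}. \<forall>y\<in>{c..M}. \<bar>x powr P - y powr P\<bar> \<le> L * \<bar>x - y\<bar>"
proof (intro exI[of _ "\<bar>P\<bar> * (c powr (P-1) + M powr (P-1))"] conjI ballI)
  fix x y assume "x \<in> {c..M}" "y \<in> {c..M}"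
  then show "\<bar>x powr P - y powr P\<bar> \<le> \<bar>P\<bar> * (c powr (P-1) + M powr (P-1)) * \<bar>x - y\<bar>"
    using assms by (intro powr_diff_le_mvt mult_left_mono powr_le_max) auto
qed auto

lemma uniform_limit_imp_tendsto:
  assumes "uniform_limit S f l F" "x \<in> S"
  shows "((\<lambda>n. f n x) \<longlongrightarrow> l x) F"
  using tendsto_uniform_limitI[OF assms] .

section \<open>Volterra integral equations\<close>

text \<open>
  The bounds are written \<^term>\<open>(t powr w) ^ n\<close> rather than \<^term>\<open>t powr (w * real n)\<close>, because
  \<^term>\<open>0 powr 0 = (0::real)\<close> would force the two functions of the case \<^term>\<open>n = (0::nat)\<close> to agree at \<open>0\<close>.
\<close>

lemma volterra_fixpoint:
  fixes T :: "(real \<Rightarrow> real) \<Rightarrow> real \<Rightarrow> real" and K :: "(real \<Rightarrow> real) set"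
  assumes J: "\<And>t. t \<in> J \<Longrightarrow> 0 \<le> t"
    and w: "0 < w" and X0: "X0 \<in> K" and self: "\<And>X. X \<in> K \<Longrightarrow> T X \<in> K"
    and closed: "\<And>X x. (\<And>n::nat. X n \<in> K) \<Longrightarrow> (\<And>b. b \<in> J \<Longrightarrow> uniform_limit {0..b} X x sequentially) \<Longrightarrow> x \<in> K"
    and bdd: "\<And>X Y b. X \<in> K \<Longrightarrow> Y \<in> K \<Longrightarrow> b \<in> J \<Longrightarrow> \<exists>B. \<forall>t\<in>{0..b}. \<bar>X t - Y t\<bar> \<le> B"
    and lip: "\<And>b. b \<in> J \<Longrightarrow> \<exists>C\<ge>0. \<forall>X\<in>K. \<forall>Y\<in>K. \<forall>B n. 0 \<le> B \<longrightarrow>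
        (\<forall>t\<in>{0..b}. \<bar>X t - Y t\<bar> \<le> B * (t powr w) ^ n) \<longrightarrow>
        (\<forall>t\<in>{0..b}. \<bar>T X t - T Y t\<bar> \<le> C * B / real (Suc n) * (t powr w) ^ Suc n)"
  shows "\<exists>X\<in>K. \<forall>t\<in>J. T X t = X t"
    and "\<And>X Y t. X \<in> K \<Longrightarrow> Y \<in> K \<Longrightarrow> (\<And>t. t \<in> J \<Longrightarrow> T X t = X t) \<Longrightarrow> (\<And>t. t \<in> J \<Longrightarrow> T Y t = Y t) \<Longrightarrow>
       (\<And>s t. t \<in> J \<Longrightarrow> 0 \<le> s \<Longrightarrow> s \<le> t \<Longrightarrow> s \<in> J) \<Longrightarrow> t \<in> J \<Longrightarrow> X t = Y t"
proof -
  \<comment> \<open>Each application of \<open>T\<close> gains a factor \<open>C / Suc n\<close> and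
    one more power of \<open>t powr w\<close>. The iterates thus have the Lipschitz constants of an
    exponential series, however large \<open>C\<close> is.\<close>
  have iter: "\<bar>(T ^^ n) X t - (T ^^ n) Y t\<bar> \<le> B * C ^ n / fact n * (t powr w) ^ n"
    if b: "b \<in> J" and C: "0 \<le> C" "\<forall>X\<in>K. \<forall>Y\<in>K. \<forall>B n. 0 \<le> B \<longrightarrow>
        (\<forall>t\<in>{0..b}. \<bar>X t - Y t\<bar> \<le> B * (t powr w) ^ n) \<longrightarrow>
        (\<forall>t\<in>{0..b}. \<bar>T X t - T Y t\<bar> \<le> C * B / real (Suc n) * (t powr w) ^ Suc n)"
      and XY: "X \<in> K" "Y \<in> K" and B: "\<forall>t\<in>{0..b}. \<bar>X t - Y t\<bar> \<le> B" "0 \<le> B" and t: "t \<in> {0..b}"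
    for X Y B C n b t
    using t
  proof (induction n arbitrary: t)
    case 0
    then show ?case using B by simp
  next
    case (Suc n)
    have mem: "(T ^^ n) Z \<in> K" if "Z \<in> K" for Z using that self by (induction n) auto
    have "\<forall>t\<in>{0..b}. \<bar>T ((T ^^ n) X) t - T ((T ^^ n) Y) t\<bar> \<le> C * (B * C ^ n / fact n) / real (Suc n) * (t powr w) ^ Suc n"
      using C(2)[rule_format, OF mem[OF XY(1)] mem[OF XY(2)], of "B * C ^ n / fact n" n] Suc.IH B C by auto
    with Suc.prems have "\<bar>T ((T ^^ n) X) t - T ((T ^^ n) Y) t\<bar> \<le> C * (B * C ^ n / fact n) / real (Suc n) * (t powr w) ^ Suc n"
      by blast
    also have "C * (B * C ^ n / fact n) / real (Suc n) = B * C ^ Suc n / fact (Suc n)"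
      by (simp add: field_simps)
    finally show ?case by simp
  qed
  have maj: "B * C ^ n / fact n * (t powr w) ^ n \<le> B * ((C * b powr w) ^ n / fact n)"
    if "0 \<le> B" "0 \<le> C" "t \<in> {0..b}" for B C b t :: real and n
  proof -
    have "(t powr w) ^ n \<le> (b powr w) ^ n"
      using that w by (intro power_mono powr_mono2) auto
    then have "B * C ^ n / fact n * (t powr w) ^ n \<le> B * C ^ n / fact n * (b powr w) ^ n"
      using that by (intro mult_left_mono) auto
    then show ?thesis by (simp add: power_mult_distrib algebra_simps)
  qed
  have summ: "summable (\<lambda>n. B * (x ^ n / fact n))" for B x :: real
    using summable_exp[of x] by (intro summable_mult) (simp add: divide_inverse mult.commute)

  \<comment> \<open>Picard iterates, with their limit written as a telescoping series so that the
    Weierstrass test gives uniform convergence on each \<open>{0..b}\<close>.\<close>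
  define S where "S n = (T ^^ n) X0" for n
  define x where "x t = X0 t + (\<Sum>i. S (Suc i) t - S i t)" for t
  have SK: "S n \<in> K" for n unfolding S_def using self X0 by (induction n) auto
  have unif: "uniform_limit {0..b} S x sequentially" if b: "b \<in> J" for b
  proof -
    obtain C where C: "0 \<le> C" "\<forall>X\<in>K. \<forall>Y\<in>K. \<forall>B n. 0 \<le> B \<longrightarrow>
        (\<forall>t\<in>{0..b}. \<bar>X t - Y t\<bar> \<le> B * (t powr w) ^ n) \<longrightarrow>
        (\<forall>t\<in>{0..b}. \<bar>T X t - T Y t\<bar> \<le> C * B / real (Suc n) * (t powr w) ^ Suc n)"
      using lip[OF b] by blast
    obtain B where B: "\<forall>t\<in>{0..b}. \<bar>T X0 t - X0 t\<bar> \<le> B" using bdd[OF self[OF X0] X0 b] by blast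
    have "0 \<in> {0..b}" using J[OF b] by auto
    with B have B0: "0 \<le> B" by fastforce
    have "uniform_limit {0..b} (\<lambda>n t. \<Sum>i<n. S (Suc i) t - S i t) (\<lambda>t. \<Sum>i. S (Suc i) t - S i t) sequentially"
    proof (rule Weierstrass_m_test[where M="\<lambda>n. B * ((C * b powr w) ^ n / fact n)"])
      fix n t assume t: "t \<in> {0..b}"
      have "S (Suc n) t - S n t = (T ^^ n) (T X0) t - (T ^^ n) X0 t"
        unfolding S_def by (simp add: funpow_swap1)
      then show "norm (S (Suc n) t - S n t) \<le> B * ((C * b powr w) ^ n / fact n)"
        using iter[OF b C self[OF X0] X0 B B0 t, of n] maj[OF B0 C(1) t, of n] by simp
    qed (rule summ)
    then have "uniform_limit {0..b} (\<lambda>n t. X0 t + (\<Sum>i<n. S (Suc i) t - S i t)) x sequentially"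
      unfolding x_def by (intro uniform_limit_add uniform_limit_const)
    moreover have "X0 t + (\<Sum>i<n. S (Suc i) t - S i t) = S n t" for n t
      using sum_lessThan_telescope[of "\<lambda>i. S i t" n] by (simp add: S_def)
    ultimately show ?thesis by simp
  qed
  have xK: "x \<in> K" using closed[of S x] SK unif by blast
  have "T x t = x t" if t: "t \<in> J" for t
  proof -
    obtain C where C: "0 \<le> C" "\<forall>X\<in>K. \<forall>Y\<in>K. \<forall>B n. 0 \<le> B \<longrightarrow>
        (\<forall>s\<in>{0..t}. \<bar>X s - Y s\<bar> \<le> B * (s powr w) ^ n) \<longrightarrow>
        (\<forall>s\<in>{0..t}. \<bar>T X s - T Y s\<bar> \<le> C * B / real (Suc n) * (s powr w) ^ Suc n)"
      using lip[OF t] by blast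
    have tt: "t \<in> {0..t}" using J[OF t] by auto
    have lim1: "(\<lambda>n. S n t) \<longlonglongrightarrow> x t" using uniform_limit_imp_tendsto[OF unif[OF t] tt] .
    \<comment> \<open>\<open>T\<close> passes to the uniform limit because \<open>lip\<close> with
      \<open>n = 0\<close> bounds it in the supremum norm. The summand 1 in \<open>k\<close> makes
      it positive, so that \<open>d\<close> is a legitimate tolerance.\<close>
    have "(\<lambda>n. S (Suc n) t) \<longlonglongrightarrow> T x t"
    proof (rule LIMSEQ_I)
      fix e :: real assume e: "0 < e"
      define k where "k = C * t powr w + 1"
      define d where "d = e / (2 * k)"
      have pos: "k > 0" using C by (simp add: k_def add_nonneg_pos)
      have d: "0 < d" unfolding d_def using e pos by auto
      obtain n0 where n0: "\<And>n. n \<ge> n0 \<Longrightarrow> \<forall>s\<in>{0..t}. dist (S n s) (x s) < d"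
        using unif[OF t] d unfolding uniform_limit_iff eventually_sequentially by blast
      have "norm (S (Suc n) t - T x t) < e" if n: "n \<ge> n0" for n
      proof -
        have "\<forall>s\<in>{0..t}. \<bar>S n s - x s\<bar> \<le> d * (s powr w) ^ 0" using n0[OF n] by (auto simp: dist_real_def less_imp_le)
        then have "\<bar>T (S n) t - T x t\<bar> \<le> C * d / real (Suc 0) * (t powr w) ^ Suc 0"
          using C(2) SK[of n] xK d tt by (meson less_imp_le)
        also have "\<dots> \<le> k * d" using d by (simp add: k_def algebra_simps)
        also have "\<dots> = e / 2" unfolding d_def using pos by simp
        also have "\<dots> < e" using e by simp
        finally show ?thesis by (simp add: S_def)
      qed
      then show "\<exists>no. \<forall>n\<ge>no. norm (S (Suc n) t - T x t) < e" by blast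
    qed
    moreover have "(\<lambda>n. S (Suc n) t) \<longlonglongrightarrow> x t" using LIMSEQ_Suc[OF lim1] .
    ultimately show ?thesis using LIMSEQ_unique by blast
  qed
  with xK show "\<exists>X\<in>K. \<forall>t\<in>J. T X t = X t" by blast

  fix X Y t assume XY: "X \<in> K" "Y \<in> K" and fX: "\<And>t. t \<in> J \<Longrightarrow> T X t = X t" and fY: "\<And>t. t \<in> J \<Longrightarrow> T Y t = Y t"
    and down: "\<And>s t. t \<in> J \<Longrightarrow> 0 \<le> s \<Longrightarrow> s \<le> t \<Longrightarrow> s \<in> J" and t: "t \<in> J"
  obtain C where C: "0 \<le> C" "\<forall>X\<in>K. \<forall>Y\<in>K. \<forall>B n. 0 \<le> B \<longrightarrow>
        (\<forall>s\<in>{0..t}. \<bar>X s - Y s\<bar> \<le> B * (s powr w) ^ n) \<longrightarrow>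
        (\<forall>s\<in>{0..t}. \<bar>T X s - T Y s\<bar> \<le> C * B / real (Suc n) * (s powr w) ^ Suc n)"
    using lip[OF t] by blast
  obtain B where B: "\<forall>s\<in>{0..t}. \<bar>X s - Y s\<bar> \<le> B" using bdd[OF XY t] by blast
  have tt: "t \<in> {0..t}" using J[OF t] by auto
  with B have B0: "0 \<le> B" by fastforce
  \<comment> \<open>The fixed point equations hold on \<open>J\<close> only, so
    \<open>(T ^^ n) X\<close> cannot be replaced by \<open>X\<close> in \<open>iter\<close>. The
    induction is repeated for \<open>X\<close> and \<open>Y\<close> themselves, and
    \<open>down\<close> keeps the points involved in \<open>J\<close>.\<close>
  have bd: "\<bar>X s - Y s\<bar> \<le> B * C ^ n / fact n * (s powr w) ^ n" if "s \<in> {0..t}" for s n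
    using that
  proof (induction n arbitrary: s)
    case 0
    then show ?case using B by simp
  next
    case (Suc n)
    have "\<forall>s\<in>{0..t}. \<bar>T X s - T Y s\<bar> \<le> C * (B * C ^ n / fact n) / real (Suc n) * (s powr w) ^ Suc n"
      using C(2)[rule_format, OF XY, of "B * C ^ n / fact n" n] Suc.IH B0 C by auto
    with Suc.prems have "\<bar>T X s - T Y s\<bar> \<le> C * (B * C ^ n / fact n) / real (Suc n) * (s powr w) ^ Suc n"
      by blast
    also have "C * (B * C ^ n / fact n) / real (Suc n) = B * C ^ Suc n / fact (Suc n)"
      by (simp add: field_simps)
    finally show ?case using Suc.prems fX[of s] fY[of s] down[OF t, of s] by simp
  qed
  have "(\<lambda>n. B * ((C * t powr w) ^ n / fact n)) \<longlonglongrightarrow> 0"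
    by (rule summable_LIMSEQ_zero[OF summ])
  then have "\<bar>X t - Y t\<bar> \<le> 0"
    by (rule LIMSEQ_le_const) (use bd[OF tt] maj[OF B0 C(1) tt] order_trans in blast)
  then show "X t = Y t" by simp
qed

text \<open>Continuity gives measurability on the half-open interval, and the majorant is integrable
  since its exponent exceeds -1. The point 0, where nothing is known about \<open>f\<close>, is a
  null set.\<close>

lemma continuous_powr_bound_integrable:
  fixes f :: "real \<Rightarrow> real"
  assumes cont: "continuous_on {0<..b} f" and w: "0 < w"
    and bound: "\<And>t. t \<in> {0<..b} \<Longrightarrow> \<bar>f t\<bar> \<le> C * t powr (w - 1)"
  shows "f integrable_on {0..b}"
proof (cases "b \<ge> 0")
  case True
  have g: "(\<lambda>t. C * t powr (w - 1)) integrable_on {0..b}"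
    using integrable_on_cmult_left[OF integrable_on_powr_from_0[of "w - 1" b], of C] w True by simp
  have neg: "negligible (sym_diff {0..b} {0<..b})"
    by (rule negligible_subset[of "{0}"]) auto
  have "f integrable_on {0<..b}"
  proof (rule measurable_bounded_by_integrable_imp_integrable)
    show "f \<in> borel_measurable (lebesgue_on {0<..b})"
      by (rule continuous_imp_measurable_on_sets_lebesgue[OF cont]) auto
    show "(\<lambda>t. C * t powr (w - 1)) integrable_on {0<..b}"
      using g integrable_spike_set_eq[OF neg] by blast
  qed (use bound in auto)
  then show ?thesis using integrable_spike_set_eq[OF neg] by blast
qed auto
lemma integral_powr_bound:
  fixes f :: "real \<Rightarrow> real"
  assumes f: "f integrable_on {0..t}" and a: "0 < a" and t: "0 \<le> t"
    and bound: "\<And>s. s \<in> {0<..t} \<Longrightarrow> \<bar>f s\<bar> \<le> C * s powr (a - 1)"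
  shows "\<bar>integral {0..t} f\<bar> \<le> C / a * t powr a"
proof -
  \<comment> \<open>The bound says nothing at 0. Resetting that value changes no integral and makes
    the majorant valid on the closed interval.\<close>
  let ?g = "\<lambda>s. if s = 0 then 0 else f s"
  have g: "?g integrable_on {0..t}"
    by (rule integrable_spike[OF f negligible_sing[of 0]]) auto
  have h: "((\<lambda>s. C * s powr (a - 1)) has_integral C * (t powr (a - 1 + 1) / (a - 1 + 1))) {0..t}"
    using has_integral_powr_from_0[of "a - 1" t] a t by (intro has_integral_mult_right) auto
  have "integral {0..t} f = integral {0..t} ?g"
    by (rule integral_spike[OF negligible_sing[of 0]]) auto
  also have "norm \<dots> \<le> integral {0..t} (\<lambda>s. C * s powr (a - 1))"
  proof (rule integral_norm_bound_integral[OF g])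
    show "(\<lambda>s. C * s powr (a - 1)) integrable_on {0..t}" using h by blast
    show "norm (?g s) \<le> C * s powr (a - 1)" if "s \<in> {0..t}" for s
      using that bound[of s] by auto
  qed
  also have "\<dots> = C / a * t powr a" using integral_unique[OF h] by simp
  finally show ?thesis by simp
qed

text \<open>\<open>J\<close> has no largest element, so around each of its points it coincides with
  some \<open>{0..b}\<close> reaching further. Continuity on a half-open interval or a ray is thus
  reduced to compact intervals.\<close>

lemma continuous_on_exhaust:
  fixes x :: "real \<Rightarrow> real"
  assumes J: "\<And>t. t \<in> J \<Longrightarrow> 0 \<le> t" and nxt: "\<And>t. t \<in> J \<Longrightarrow> \<exists>t'\<in>J. t < t'"
    and down: "\<And>s t. t \<in> J \<Longrightarrow> 0 \<le> s \<Longrightarrow> s \<le> t \<Longrightarrow> s \<in> J"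
    and cont: "\<And>b. b \<in> J \<Longrightarrow> continuous_on {0..b} x"
  shows "continuous_on J x"
  unfolding continuous_on_eq_continuous_within
proof
  fix t assume t: "t \<in> J"
  obtain b where b: "b \<in> J" "t < b" using nxt[OF t] by blast
  have "at t within J = at t within {0..b}"
  proof (rule at_within_nhd[of t "{..<b}"])
    have "J \<inter> {..<b} = {0..b} \<inter> {..<b}" using J down[OF b(1)] by force
    then show "J \<inter> {..<b} - {t} = {0..b} \<inter> {..<b} - {t}" by simp
  qed (use b in auto)
  moreover have "continuous (at t within {0..b}) x"
    using cont[OF b(1)] J[OF t] b(2) by (simp add: continuous_on_eq_continuous_within)
  ultimately show "continuous (at t within J) x" by simp
qed

text \<open>
  Iterating \<open>X \<mapsto> x0 + \<integral>F(t, \<integral>f(s, X s))\<close> instead of the pair of equations puts the singularity of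
  \<^term>\<open>F\<close> at \<open>t = 0\<close> under an integral sign: a Lipschitz constant of order \<^term>\<open>t powr (w - 2)\<close> is
  harmless, since the inner integrals differ by \<open>O(t)\<close>.
\<close>

lemma integral_equation_ivp:
  fixes f F :: "real \<Rightarrow> real \<Rightarrow> real" and lo hi :: "real \<Rightarrow> real" and x0 w :: real and J :: "real set"
  defines "K \<equiv> {X. continuous_on J X \<and> (\<forall>t\<in>J. lo t \<le> X t \<and> X t \<le> hi t)}"
  assumes J: "\<And>t. t \<in> J \<Longrightarrow> 0 \<le> t" and J0: "0 \<in> J" and nxt: "\<And>t. t \<in> J \<Longrightarrow> \<exists>t'\<in>J. t < t'"
    and down: "\<And>s t. t \<in> J \<Longrightarrow> 0 \<le> s \<Longrightarrow> s \<le> t \<Longrightarrow> s \<in> J"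
    and w: "0 < w"
    and x0: "\<And>t. t \<in> J \<Longrightarrow> lo t \<le> x0 \<and> x0 \<le> hi t"
    and f_cont: "\<And>X. X \<in> K \<Longrightarrow> continuous_on J (\<lambda>t. f t (X t))"
    and F_cont: "\<And>X. X \<in> K \<Longrightarrow> continuous_on J (\<lambda>t. integral {0..t} (\<lambda>s. f s (X s))) \<Longrightarrow>
          continuous_on (J - {0}) (\<lambda>t. F t (integral {0..t} (\<lambda>s. f s (X s))))"
    and F_bound: "\<And>X b. X \<in> K \<Longrightarrow> b \<in> J \<Longrightarrow> \<exists>C. \<forall>t\<in>{0<..b}.
          \<bar>F t (integral {0..t} (\<lambda>s. f s (X s)))\<bar> \<le> C * t powr (w - 1)"
    and self: "\<And>X t. X \<in> K \<Longrightarrow> t \<in> J \<Longrightarrow>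
          (\<lambda>t. F t (integral {0..t} (\<lambda>s. f s (X s)))) integrable_on {0..t} \<Longrightarrow>
          lo t \<le> x0 + integral {0..t} (\<lambda>t. F t (integral {0..t} (\<lambda>s. f s (X s)))) \<and>
          x0 + integral {0..t} (\<lambda>t. F t (integral {0..t} (\<lambda>s. f s (X s)))) \<le> hi t"
    and f_lip: "\<And>b. b \<in> J \<Longrightarrow> \<exists>L\<ge>0. \<forall>X\<in>K. \<forall>Y\<in>K. \<forall>t\<in>{0..b}. \<bar>f t (X t) - f t (Y t)\<bar> \<le> L * \<bar>X t - Y t\<bar>"
    and F_lip: "\<And>b. b \<in> J \<Longrightarrow> \<exists>L\<ge>0. \<forall>X\<in>K. \<forall>Y\<in>K. \<forall>t\<in>{0<..b}.
          \<bar>F t (integral {0..t} (\<lambda>s. f s (X s))) - F t (integral {0..t} (\<lambda>s. f s (Y s)))\<bar>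
          \<le> L * t powr (w - 2) * \<bar>integral {0..t} (\<lambda>s. f s (X s)) - integral {0..t} (\<lambda>s. f s (Y s))\<bar>"
  shows "\<exists>X A. X \<in> K \<and> continuous_on J A \<and> X 0 = x0 \<and> A 0 = 0 \<and>
      (\<forall>t\<in>J. 0 < t \<longrightarrow> (X has_real_derivative F t (A t)) (at t) \<and> (A has_real_derivative f t (X t)) (at t))"
    and "\<And>X A Y B t. X \<in> K \<Longrightarrow> continuous_on J A \<Longrightarrow> X 0 = x0 \<Longrightarrow> A 0 = 0 \<Longrightarrow>
      Y \<in> K \<Longrightarrow> continuous_on J B \<Longrightarrow> Y 0 = x0 \<Longrightarrow> B 0 = 0 \<Longrightarrow>
      (\<And>t. t \<in> J \<Longrightarrow> 0 < t \<Longrightarrow> (X has_real_derivative F t (A t)) (at t) \<and> (A has_real_derivative f t (X t)) (at t)) \<Longrightarrow>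
      (\<And>t. t \<in> J \<Longrightarrow> 0 < t \<Longrightarrow> (Y has_real_derivative F t (B t)) (at t) \<and> (B has_real_derivative f t (Y t)) (at t)) \<Longrightarrow>
      t \<in> J \<Longrightarrow> X t = Y t \<and> A t = B t"
proof -
  define A where "A X t = integral {0..t} (\<lambda>s. f s (X s))" for X t
  define T where "T X t = x0 + integral {0..t} (\<lambda>t. F t (A X t))" for X t
  note [simp del] = greaterThanAtMost_iff
  have sub: "{0..b} \<subseteq> J" "{0<..b} \<subseteq> J - {0}" if "b \<in> J" for b
    using down[OF that] by (auto simp: greaterThanAtMost_iff)
  have f_int: "(\<lambda>s. f s (X s)) integrable_on {0..b}" if "X \<in> K" "b \<in> J" for X b
    using continuous_on_subset[OF f_cont[OF that(1)] sub(1)[OF that(2)]] by (rule integrable_continuous_real)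
  have A_cont: "continuous_on J (A X)" if "X \<in> K" for X
    unfolding A_def
    by (rule continuous_on_exhaust[OF J nxt down]) (use indefinite_integral_continuous_1[OF f_int[OF that]] in auto)
  have FA_cont: "continuous_on (J - {0}) (\<lambda>t. F t (A X t))" if "X \<in> K" for X
    using F_cont[OF that] A_cont[OF that] by (simp add: A_def[abs_def])
  have FA_int: "(\<lambda>t. F t (A X t)) integrable_on {0..b}" if X: "X \<in> K" and b: "b \<in> J" for X b
  proof -
    obtain C where "\<forall>t\<in>{0<..b}. \<bar>F t (A X t)\<bar> \<le> C * t powr (w - 1)"
      using F_bound[OF X b] by (auto simp: A_def)
    then show ?thesis
      using continuous_powr_bound_integrable[OF continuous_on_subset[OF FA_cont[OF X] sub(2)[OF b]] w] by blast
  qed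
  have T_cont: "continuous_on J (T X)" if "X \<in> K" for X
    unfolding T_def
    by (intro continuous_intros continuous_on_exhaust[OF J nxt down])
       (use indefinite_integral_continuous_1[OF FA_int[OF that]] in auto)
  have TK: "T X \<in> K" if X: "X \<in> K" for X
    using T_cont[OF X] self[OF X] FA_int[OF X] unfolding K_def T_def A_def by blast

  have K_cont: "continuous_on {0..b} X" if "X \<in> K" "b \<in> J" for X b
    using that sub(1) continuous_on_subset unfolding K_def by blast
  have X0K: "(\<lambda>_. x0) \<in> K" unfolding K_def using x0 by auto
  have closed: "x \<in> K" if X: "\<And>n::nat. X n \<in> K"
      and lim: "\<And>b. b \<in> J \<Longrightarrow> uniform_limit {0..b} X x sequentially" for X x
  proof -
    have "continuous_on J x"
    proof (rule continuous_on_exhaust[OF J nxt down])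
      fix b assume b: "b \<in> J"
      show "continuous_on {0..b} x"
        by (rule uniform_limit_theorem[OF _ lim[OF b]]) (use K_cont[OF X b] in auto)
    qed
    moreover have "lo t \<le> x t \<and> x t \<le> hi t" if t: "t \<in> J" for t
    proof -
      have "(\<lambda>n. X n t) \<longlonglongrightarrow> x t"
        by (rule uniform_limit_imp_tendsto[OF lim[OF t]]) (use J[OF t] in auto)
      moreover have "\<forall>n. lo t \<le> X n t \<and> X n t \<le> hi t" using X t unfolding K_def by blast
      ultimately show ?thesis by (meson LIMSEQ_le_const LIMSEQ_le_const2)
    qed
    ultimately show ?thesis unfolding K_def by blast
  qed
  have bdd: "\<exists>B. \<forall>t\<in>{0..b}. \<bar>X t - Y t\<bar> \<le> B" if "X \<in> K" "Y \<in> K" "b \<in> J" for X Y b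
  proof -
    have "continuous_on {0..b} (\<lambda>t. X t - Y t)"
      using K_cont that by (intro continuous_intros) auto
    then have "bounded ((\<lambda>t. X t - Y t) ` {0..b})"
      by (intro compact_imp_bounded compact_continuous_image) auto
    then show ?thesis unfolding bounded_iff by auto
  qed
  have lip: "\<exists>C\<ge>0. \<forall>X\<in>K. \<forall>Y\<in>K. \<forall>B n. 0 \<le> B \<longrightarrow>
        (\<forall>t\<in>{0..b}. \<bar>X t - Y t\<bar> \<le> B * (t powr w) ^ n) \<longrightarrow>
        (\<forall>t\<in>{0..b}. \<bar>T X t - T Y t\<bar> \<le> C * B / real (Suc n) * (t powr w) ^ Suc n)"
    if b: "b \<in> J" for b
  proof -
    obtain L1 where L1: "0 \<le> L1" "\<forall>X\<in>K. \<forall>Y\<in>K. \<forall>t\<in>{0..b}. \<bar>f t (X t) - f t (Y t)\<bar> \<le> L1 * \<bar>X t - Y t\<bar>"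
      using f_lip[OF b] by blast
    obtain L2 where L2: "0 \<le> L2" "\<forall>X\<in>K. \<forall>Y\<in>K. \<forall>t\<in>{0<..b}.
          \<bar>F t (A X t) - F t (A Y t)\<bar> \<le> L2 * t powr (w - 2) * \<bar>A X t - A Y t\<bar>"
      using F_lip[OF b] unfolding A_def by blast
    show ?thesis
    \<comment> \<open>The inner integrals differ by at most
      \<open>L1 * B * (s powr w) ^ n * s\<close>. Together with \<open>L2 * s powr (w - 2)\<close>
      this has exponent \<open>w * Suc n - 1\<close>, whose integral supplies the factor
      \<open>1 / (w * Suc n)\<close>.\<close>
    proof (intro exI[of _ "L1 * L2 / w"] conjI ballI allI impI)
      show "0 \<le> L1 * L2 / w" using L1 L2 w by auto
      fix X Y B t and n :: nat
      assume X: "X \<in> K" and Y: "Y \<in> K" and B: "0 \<le> B" and t: "t \<in> {0..b}"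
        and D: "\<forall>t\<in>{0..b}. \<bar>X t - Y t\<bar> \<le> B * (t powr w) ^ n"
      have pw: "(s powr w) ^ k = s powr (w * real k)" if "0 < s" for s and k :: nat
        using that powr_realpow[of "s powr w" k] by (simp add: powr_powr)
      have tJ: "t \<in> J" using t sub(1)[OF b] by auto
      have AA: "\<bar>A X s - A Y s\<bar> \<le> L1 * B * (s powr w) ^ n * s" if s: "s \<in> {0..b}" for s
      proof -
        have sJ: "s \<in> J" using s sub(1)[OF b] by auto
        have "A X s - A Y s = integral {0..s} (\<lambda>t. f t (X t) - f t (Y t))"
          unfolding A_def by (rule integral_diff[symmetric]; rule f_int[OF _ sJ]; fact)
        also have "norm \<dots> \<le> L1 * B * (s powr w) ^ n * (s - 0)"
        proof (rule integral_bound)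
          have "continuous_on J (\<lambda>t. f t (X t) - f t (Y t))"
            using f_cont X Y by (intro continuous_intros) auto
          then show "continuous_on {0..s} (\<lambda>t. f t (X t) - f t (Y t))"
            using sub(1)[OF sJ] by (rule continuous_on_subset)
          fix r assume r: "r \<in> {0..s}"
          then have rb: "r \<in> {0..b}" using s by auto
          have "\<bar>f r (X r) - f r (Y r)\<bar> \<le> L1 * (B * (r powr w) ^ n)"
            using L1(2)[rule_format, OF X Y rb] mult_left_mono[OF D[rule_format, OF rb] L1(1)] by linarith
          also have "\<dots> \<le> L1 * (B * (s powr w) ^ n)"
            using r w L1 B by (intro mult_left_mono power_mono powr_mono2) auto
          finally show "norm (f r (X r) - f r (Y r)) \<le> L1 * B * (s powr w) ^ n" by (simp add: mult.assoc)
        qed (use s in auto)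
        finally show ?thesis by simp
      qed
      have "T X t - T Y t = integral {0..t} (\<lambda>t. F t (A X t) - F t (A Y t))"
        unfolding T_def using integral_diff[OF FA_int[OF X tJ] FA_int[OF Y tJ]] by simp
      also have "\<bar>\<dots>\<bar> \<le> L1 * L2 * B / (w * Suc n) * t powr (w * Suc n)"
      proof (rule integral_powr_bound)
        show "(\<lambda>t. F t (A X t) - F t (A Y t)) integrable_on {0..t}"
          using FA_int[OF X tJ] FA_int[OF Y tJ] by (rule integrable_diff)
        fix s assume s: "s \<in> {0<..t}"
        then have sb: "s \<in> {0..b}" "s \<in> {0<..b}" and s0: "0 < s" using t by (auto simp: greaterThanAtMost_iff)
        have "\<bar>F s (A X s) - F s (A Y s)\<bar> \<le> L2 * s powr (w - 2) * \<bar>A X s - A Y s\<bar>"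
          using L2 X Y sb by blast
        also have "\<dots> \<le> L2 * s powr (w - 2) * (L1 * B * (s powr w) ^ n * s)"
          using AA[OF sb(1)] L2 by (intro mult_left_mono) auto
        also have "\<dots> = L1 * L2 * B * (s powr (w - 2) * s powr (w * n) * s powr 1)"
          using s0 by (simp add: pw)
        also have "s powr (w - 2) * s powr (w * n) * s powr 1 = s powr (w * Suc n - 1)"
          using s0 by (simp only: powr_add[symmetric]) (simp add: algebra_simps)
        finally show "\<bar>F s (A X s) - F s (A Y s)\<bar> \<le> L1 * L2 * B * s powr (w * Suc n - 1)" .
      qed (use w t in auto)
      also have "\<dots> = L1 * L2 / w * B / Suc n * (t powr w) ^ Suc n"
      proof (cases "t = 0")
        case False
        then have "t powr (w * Suc n) = (t powr w) ^ Suc n"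
          using pw[of t "Suc n"] t by auto
        then show ?thesis by (simp add: field_simps)
      qed auto
      finally show "\<bar>T X t - T Y t\<bar> \<le> L1 * L2 / w * B / real (Suc n) * (t powr w) ^ Suc n" .
    qed
  qed
  have "\<exists>X\<in>K. \<forall>t\<in>J. T X t = X t"
  proof (rule volterra_fixpoint(1)[of J w "\<lambda>_. x0" K T])
    show "x \<in> K" if "\<And>n::nat. X n \<in> K" "\<And>b. b \<in> J \<Longrightarrow> uniform_limit {0..b} X x sequentially" for X x
      using that by (rule closed)
  qed (use J w X0K TK in blast, use J w X0K TK in blast, use J w X0K TK in blast, use J w X0K TK in blast,
       rule bdd, assumption+, rule lip, assumption)
  then obtain X where X: "X \<in> K" "\<And>t. t \<in> J \<Longrightarrow> T X t = X t" by blast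
  have "(A X has_real_derivative f t (X t)) (at t) \<and> (X has_real_derivative F t (A X t)) (at t)"
    if t: "t \<in> J" "0 < t" for t
  proof -
    \<comment> \<open>An interval reaching beyond \<open>t\<close> makes \<open>t\<close> an
      interior point, so the fundamental theorem of calculus yields two-sided derivatives.\<close>
    obtain b where b: "b \<in> J" "t < b" using nxt[OF t(1)] by blast
    have at: "at t within {0..b} = at t" using t b by (intro at_within_interior) auto
    define S where "S = {0<..<b}"
    have S: "open S" "t \<in> S" "S \<subseteq> J - {0}"
      using t b down[OF b(1)] by (auto simp: S_def)
    have 1: "continuous (at t) (\<lambda>t. f t (X t))"
      using continuous_on_subset[OF f_cont[OF X(1)], of S] S continuous_on_eq_continuous_at by blast
    have 2: "continuous (at t) (\<lambda>t. F t (A X t))"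
      using continuous_on_subset[OF FA_cont[OF X(1)], of S] S continuous_on_eq_continuous_at by blast
    have d1: "(A X has_real_derivative f t (X t)) (at t)"
      using integral_has_vector_derivative_continuous_at[OF f_int[OF X(1) b(1)], of t "{}"] t b at 1
      by (simp add: A_def[abs_def] has_real_derivative_iff_has_vector_derivative)
    have "((\<lambda>u. integral {0..u} (\<lambda>t. F t (A X t))) has_real_derivative F t (A X t)) (at t)"
      using integral_has_vector_derivative_continuous_at[OF FA_int[OF X(1) b(1)], of t "{}"] t b at 2
      by (simp add: has_real_derivative_iff_has_vector_derivative)
    then have "(T X has_real_derivative F t (A X t)) (at t)"
      unfolding T_def by (auto intro!: derivative_eq_intros)
    moreover have "T X s = X s" if "s \<in> S" for s using X(2) S that by blast
    ultimately have "(X has_real_derivative F t (A X t)) (at t)"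
      using has_field_derivative_transform_within_open[OF _ S(1,2)] by blast
    with d1 show ?thesis by blast
  qed
  moreover have "X 0 = x0" using X(2)[OF J0] by (simp add: T_def)
  moreover have "A X 0 = 0" by (simp add: A_def)
  ultimately show "\<exists>X A. X \<in> K \<and> continuous_on J A \<and> X 0 = x0 \<and> A 0 = 0 \<and>
      (\<forall>t\<in>J. 0 < t \<longrightarrow> (X has_real_derivative F t (A t)) (at t) \<and> (A has_real_derivative f t (X t)) (at t))"
    using X(1) A_cont by blast

  \<comment> \<open>Integrating both differential equations shows that any solution with first
    component in \<open>K\<close> is a fixed point of \<open>T\<close>, and that its second
    component is determined by the first.\<close>
  have fixpt: "T X t = X t \<and> Z t = A X t"
    if X: "X \<in> K" and Z: "continuous_on J Z" "X 0 = x0" "Z 0 = 0"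
      and d: "\<And>t. t \<in> J \<Longrightarrow> 0 < t \<Longrightarrow> (X has_real_derivative F t (Z t)) (at t) \<and> (Z has_real_derivative f t (X t)) (at t)"
      and t: "t \<in> J" for X Z t
  proof -
    have Zs: "Z s = A X s" if s: "s \<in> J" for s
    proof -
      have "((\<lambda>r. f r (X r)) has_integral Z s - Z 0) {0..s}"
        using J[OF s] continuous_on_subset[OF Z(1) sub(1)[OF s]] d down[OF s]
        by (intro fundamental_theorem_of_calculus_interior) (auto simp: has_real_derivative_iff_has_vector_derivative)
      then show ?thesis unfolding A_def using Z by (simp add: integral_unique)
    qed
    have "((\<lambda>r. F r (Z r)) has_integral X t - X 0) {0..t}"
      using J[OF t] K_cont[OF X t] d down[OF t]
      by (intro fundamental_theorem_of_calculus_interior) (auto simp: has_real_derivative_iff_has_vector_derivative)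
    then have "((\<lambda>r. F r (A X r)) has_integral X t - X 0) {0..t}"
      by (rule has_integral_eq[rotated]) (use Zs sub(1)[OF t] in auto)
    then show ?thesis unfolding T_def using Z Zs[OF t] by (simp add: integral_unique)
  qed
  fix X Z Y W t
  assume "X \<in> K" "continuous_on J Z" "X 0 = x0" "Z 0 = 0" "Y \<in> K" "continuous_on J W" "Y 0 = x0" "W 0 = 0"
      "\<And>t. t \<in> J \<Longrightarrow> 0 < t \<Longrightarrow> (X has_real_derivative F t (Z t)) (at t) \<and> (Z has_real_derivative f t (X t)) (at t)"
      "\<And>t. t \<in> J \<Longrightarrow> 0 < t \<Longrightarrow> (Y has_real_derivative F t (W t)) (at t) \<and> (W has_real_derivative f t (Y t)) (at t)"
      "t \<in> J"
  note XY = this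
  have eq: "X t = Y t" if t: "t \<in> J" for t
  proof (rule volterra_fixpoint(2)[of J w "\<lambda>_. x0" K T X Y])
    show "x \<in> K" if "\<And>n::nat. X n \<in> K" "\<And>b. b \<in> J \<Longrightarrow> uniform_limit {0..b} X x sequentially" for X x
      using that by (rule closed)
    show "T X t = X t" if "t \<in> J" for t using fixpt[OF XY(1-4,9) that] ..
    show "T Y t = Y t" if "t \<in> J" for t using fixpt[OF XY(5-8,10) that] ..
    show "s \<in> J" if "t \<in> J" "0 \<le> s" "s \<le> t" for s t using that by (rule down)
    show "X \<in> K" "Y \<in> K" "t \<in> J" using XY(1,5) t .
  qed (use J w X0K TK in blast, use J w X0K TK in blast, use J w X0K TK in blast, use J w X0K TK in blast,
       rule bdd, assumption+, rule lip, assumption)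
  have "A X t = A Y t"
    unfolding A_def by (rule integral_cong) (use eq sub(1)[OF XY(11)] in auto)
  then show "X t = Y t \<and> Z t = W t"
    using eq[OF XY(11)] fixpt[OF XY(1-4,9,11)] fixpt[OF XY(5-8,10,11)] by simp
qed
text \<open>The exponent on the right is \<open>min 0 P\<close>, written as \<open>w - 1\<close>
  with \<open>w = min 1 (1 + P)\<close>; this \<open>w\<close> is positive, and the bound
  integrable, exactly when \<open>P > - 1\<close>.\<close>

lemma powr_singular_bound:
  fixes k M P :: real
  assumes "0 < k" "0 < t" "k * t \<le> y" "y \<le> M"
  shows "y powr P \<le> (k powr P + M powr P) * t powr (min 1 (1 + P) - 1)"
proof (cases "P \<ge> 0")
  case True
  have "0 < k * t" using assms by simp
  then have "0 < y" using assms by linarith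
  then have "y powr P \<le> M powr P" using assms True by (intro powr_mono2) auto
  moreover have "min 1 (1 + P) - 1 = 0" using True by simp
  ultimately show ?thesis using assms by simp (smt (verit) powr_ge_zero)
next
  case False
  have "y powr P \<le> (k * t) powr P" using assms False by (intro powr_mono2') auto
  also have "\<dots> = k powr P * t powr P" using assms by (simp add: powr_mult)
  also have "\<dots> \<le> (k powr P + M powr P) * t powr P" by (intro mult_right_mono) auto
  also have "P = min 1 (1 + P) - 1" using False by simp
  finally show ?thesis using False by simp
qed

section \<open>Systems of power type\<close>

text \<open>
  The initial value \<^term>\<open>a0 = (0::real)\<close> is allowed although \<open>a powr P\<close> is then not Lipschitz (or singular) at
  the start: \<open>A - a0\<close> stays above a multiple of \<open>t\<close>. The sign condition on \<^term>\<open>P\<close> and \<^term>\<open>Q\<close> makes the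
  iteration antitone, so its first step \<open>hi\<close> is an a priori upper bound.
\<close>

lemma power_system_increasing:
  fixes H g :: "real \<Rightarrow> real" and x0 a0 P Q :: real and J :: "real set"
  assumes J: "\<And>t. t \<in> J \<Longrightarrow> 0 \<le> t" and J0: "0 \<in> J" and nxt: "\<And>t. t \<in> J \<Longrightarrow> \<exists>t'\<in>J. t < t'"
    and down: "\<And>s t. t \<in> J \<Longrightarrow> 0 \<le> s \<Longrightarrow> s \<le> t \<Longrightarrow> s \<in> J"
    and H: "continuous_on J H" "\<And>t. t \<in> J \<Longrightarrow> 0 \<le> H t"
    and g: "continuous_on J g" "\<And>t. t \<in> J \<Longrightarrow> 0 < g t"
    and x0: "0 < x0" and a0: "0 \<le> a0" and P: "- 1 < P" and PQ: "0 \<le> P \<and> Q \<le> 0 \<or> P \<le> 0 \<and> 0 \<le> Q"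
  shows "\<exists>X A. continuous_on J X \<and> continuous_on J A \<and> X 0 = x0 \<and> A 0 = a0 \<and>
      (\<forall>t\<in>J. x0 \<le> X t \<and> (0 < t \<longrightarrow> 0 < A t \<and> (X has_real_derivative H t * A t powr P) (at t) \<and>
         (A has_real_derivative g t * X t powr Q) (at t)))"
    and "\<And>X A Y B t. continuous_on J X \<Longrightarrow> continuous_on J A \<Longrightarrow> X 0 = x0 \<Longrightarrow> A 0 = a0 \<Longrightarrow>
      continuous_on J Y \<Longrightarrow> continuous_on J B \<Longrightarrow> Y 0 = x0 \<Longrightarrow> B 0 = a0 \<Longrightarrow>
      (\<And>t. t \<in> J \<Longrightarrow> 0 < t \<Longrightarrow> x0 \<le> X t \<and> (X has_real_derivative H t * A t powr P) (at t) \<and>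
         (A has_real_derivative g t * X t powr Q) (at t)) \<Longrightarrow>
      (\<And>t. t \<in> J \<Longrightarrow> 0 < t \<Longrightarrow> x0 \<le> Y t \<and> (Y has_real_derivative H t * B t powr P) (at t) \<and>
         (B has_real_derivative g t * Y t powr Q) (at t)) \<Longrightarrow>
      t \<in> J \<Longrightarrow> X t = Y t \<and> A t = B t"
proof -
  define w where "w = min 1 (1 + P)"
  have w: "0 < w" using P by (simp add: w_def)
  define G where "G t = integral {0..t} g" for t
  \<comment> \<open>The right-hand side of the equation for \<open>X\<close> when the other unknown
    is driven by the constant \<open>x0\<close>; its integral yields the upper barrier
    \<open>hi\<close>.\<close>
  define U where "U t = H t * (a0 + x0 powr Q * G t) powr P" for t
  define hi where "hi t = x0 + integral {0..t} U" for t
  note [simp del] = greaterThanAtMost_iff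
  have x0Q: "0 < x0 powr Q" using x0 by simp
  have sub: "{0..b} \<subseteq> J" "{0<..b} \<subseteq> J - {0}" if "b \<in> J" for b
    using down[OF that] by (auto simp: greaterThanAtMost_iff)
  have inJ: "t \<in> J" "0 < t" "0 \<le> t" "t \<le> b" "t \<in> {0..b}" if "t \<in> {0<..b}" "b \<in> J" for t b
    using that down[of b t] by (auto simp: greaterThanAtMost_iff)
  have inJ0: "s \<in> J" if "0 \<le> s" "s \<le> t" "t \<in> J" for s t
    using that down[of t s] by simp
  have g_pos: "0 \<le> g s" if "s \<in> {0..t}" "t \<in> J" for s t
    using that inJ0[of s t] g(2)[of s] by simp
  have g_bounds: "\<exists>c M. 0 < c \<and> 0 < M \<and> (\<forall>t\<in>{0..b}. c \<le> g t \<and> g t \<le> M)" if b: "b \<in> J" for b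
  proof -
    have cont: "continuous_on {0..b} g" using g(1) sub(1)[OF b] by (rule continuous_on_subset)
    have ne: "{0..b} \<noteq> {}" using J[OF b] by simp
    obtain s where s: "s \<in> {0..b}" "\<forall>t\<in>{0..b}. g s \<le> g t"
      using continuous_attains_inf[OF compact_Icc ne cont] by blast
    obtain r where r: "r \<in> {0..b}" "\<forall>t\<in>{0..b}. g t \<le> g r"
      using continuous_attains_sup[OF compact_Icc ne cont] by blast
    have "0 < g s" "0 < g r" using s(1) r(1) g(2) sub(1)[OF b] by auto
    then show ?thesis using s(2) r(2) by (intro exI[of _ "g s"] exI[of _ "g r"]) auto
  qed
  have H_bound: "\<exists>M\<ge>0. \<forall>t\<in>{0..b}. H t \<le> M" if b: "b \<in> J" for b
  proof -
    have cont: "continuous_on {0..b} H" using H(1) sub(1)[OF b] by (rule continuous_on_subset)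
    have ne: "{0..b} \<noteq> {}" using J[OF b] by simp
    obtain r where r: "r \<in> {0..b}" "\<forall>t\<in>{0..b}. H t \<le> H r"
      using continuous_attains_sup[OF compact_Icc ne cont] by blast
    moreover have "0 \<le> H r" using r(1) H(2) sub(1)[OF b] by auto
    ultimately show ?thesis by (intro exI[of _ "H r"]) auto
  qed
  have g_int: "g integrable_on {0..b}" if "b \<in> J" for b
    using continuous_on_subset[OF g(1) sub(1)[OF that]] by (rule integrable_continuous_real)
  have G_cont: "continuous_on J G"
    unfolding G_def
    by (rule continuous_on_exhaust[OF J nxt down]) (use indefinite_integral_continuous_1[OF g_int] in auto)
  have lin: "c * t \<le> integral {0..t} f \<and> integral {0..t} f \<le> M * t"
    if f: "f integrable_on {0..t}" and t: "0 \<le> t" and "\<And>s. s \<in> {0..t} \<Longrightarrow> c \<le> f s \<and> f s \<le> M" for c M t and f :: "real \<Rightarrow> real"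
  proof -
    have "integral {0..t} (\<lambda>_. c) \<le> integral {0..t} f" by (rule integral_le) (use that in auto)
    moreover have "integral {0..t} f \<le> integral {0..t} (\<lambda>_. M)" by (rule integral_le) (use that in auto)
    ultimately show ?thesis using t by (simp add: mult.commute)
  qed
  \<comment> \<open>The common source of integrability for \<open>U\<close> and for every iterate: a
    linear lower bound on \<open>Z\<close> makes the right-hand side at worst of order
    \<open>t powr (w - 1)\<close>.\<close>
  have sing: "\<exists>C\<ge>0. \<forall>t\<in>{0<..b}. \<forall>Z. k * t \<le> Z \<and> Z \<le> M \<longrightarrow> H t * (a0 + Z) powr P \<le> C * t powr (w - 1)"
    if b: "b \<in> J" and k: "0 < k" for k M b
  proof -
    obtain h where h: "0 \<le> h" "\<forall>t\<in>{0..b}. H t \<le> h" using H_bound[OF b] by blast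
    show ?thesis
    proof (intro exI[of _ "h * (k powr P + (a0 + M) powr P)"] conjI ballI allI impI)
      fix t Z assume t: "t \<in> {0<..b}" and Z: "k * t \<le> Z \<and> Z \<le> M"
      have "(a0 + Z) powr P \<le> (k powr P + (a0 + M) powr P) * t powr (w - 1)"
        unfolding w_def using Z t k a0 by (intro powr_singular_bound) (auto simp: greaterThanAtMost_iff)
      moreover have "0 \<le> H t" "H t \<le> h" using h inJ[OF t b] H(2) by auto
      ultimately have "H t * (a0 + Z) powr P \<le> h * ((k powr P + (a0 + M) powr P) * t powr (w - 1))"
        using h by (intro mult_mono) auto
      then show "H t * (a0 + Z) powr P \<le> h * (k powr P + (a0 + M) powr P) * t powr (w - 1)"
        by (simp only: mult.assoc)
    qed (use h in auto)
  qed
  have G_pos: "0 \<le> G t" if t: "t \<in> J" for t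
    unfolding G_def using g_int[OF t] by (rule integral_nonneg) (rule g_pos[OF _ t])
  have U_int: "U integrable_on {0..b}" if b: "b \<in> J" for b
  proof -
    obtain c M where cM: "0 < c" "\<forall>t\<in>{0..b}. c \<le> g t \<and> g t \<le> M" "0 < M" using g_bounds[OF b] by blast
    obtain C where C: "\<forall>t\<in>{0<..b}. \<forall>Z. x0 powr Q * c * t \<le> Z \<and> Z \<le> x0 powr Q * (M * b) \<longrightarrow> H t * (a0 + Z) powr P \<le> C * t powr (w - 1)"
      using sing[OF b, of "x0 powr Q * c" "x0 powr Q * (M * b)"] x0Q cM by auto
    have bd: "c * t \<le> G t" "G t \<le> M * b" if t: "t \<in> {0<..b}" for t
    proof -
      have tJ: "t \<in> J" by (rule inJ(1)[OF t b])
      have 1: "c * t \<le> G t \<and> G t \<le> M * t" unfolding G_def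
        by (rule lin) (use g_int[OF tJ] cM t in \<open>auto simp: greaterThanAtMost_iff\<close>)
      moreover have "M * t \<le> M * b" using t cM by (simp add: greaterThanAtMost_iff)
      ultimately show "c * t \<le> G t" "G t \<le> M * b" by auto
    qed
    show ?thesis
    proof (rule continuous_powr_bound_integrable[OF _ w])
      fix t assume t: "t \<in> {0<..b}"
      have "H t * (a0 + x0 powr Q * G t) powr P \<le> C * t powr (w - 1)"
        using C t bd[OF t] x0Q by (auto simp: mult.assoc intro!: mult_left_mono)
      moreover have "0 \<le> H t" using H(2) inJ[OF t b] by auto
      ultimately show "\<bar>U t\<bar> \<le> C * t powr (w - 1)" unfolding U_def by (simp add: abs_mult)
    next
      have c1: "continuous_on {0<..b} H" "continuous_on {0<..b} G"
        using H(1) G_cont sub(2)[OF b] by (auto intro: continuous_on_subset)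
      have "a0 + x0 powr Q * G t \<noteq> 0" if "t \<in> {0<..b}" for t
      proof -
        have "0 < c * t" using that cM by (simp add: greaterThanAtMost_iff)
        then have "0 < G t" using bd(1)[OF that] by linarith
        then show ?thesis using x0Q a0 by (smt (verit) mult_pos_pos)
      qed
      then show "continuous_on {0<..b} U"
        unfolding U_def using c1 by (intro continuous_intros) auto
    qed
  qed
  have U0: "0 \<le> U t" if "t \<in> J" for t unfolding U_def using H(2)[OF that] by simp
  have hi_mono: "hi s \<le> hi t" if "t \<in> J" "0 \<le> s" "s \<le> t" for s t
  proof -
    have "integral {0..s} U \<le> integral {0..t} U"
      by (rule integral_subset_le)
         (use that U_int[OF that(1)] U_int[OF down[OF that]] inJ0[OF _ _ that(1)] U0 in auto)
    then show ?thesis by (simp add: hi_def)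
  qed
  have hi_ge: "x0 \<le> hi t" if "t \<in> J" for t
    using hi_mono[OF that, of 0] J[OF that] by (simp add: hi_def)
  let ?K = "{X. continuous_on J X \<and> (\<forall>t\<in>J. x0 \<le> X t \<and> X t \<le> hi t)}"
  define Z where "Z X t = integral {0..t} (\<lambda>s. g s * X s powr Q)" for X t
  have gX_cont: "continuous_on J (\<lambda>t. g t * X t powr Q)" if X: "continuous_on J X" "\<And>t. t \<in> J \<Longrightarrow> x0 \<le> X t" for X
  proof -
    have "X t \<noteq> 0" if "t \<in> J" for t using X(2)[OF that] x0 by simp
    then show ?thesis using g X by (intro continuous_intros) auto
  qed
  have gX_int: "(\<lambda>t. g t * X t powr Q) integrable_on {0..b}" if X: "continuous_on J X" "\<And>t. t \<in> J \<Longrightarrow> x0 \<le> X t" and "b \<in> J" for X b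
    using continuous_on_subset[OF gX_cont[OF X] sub(1)[OF \<open>b \<in> J\<close>]] by (rule integrable_continuous_real)
  \<comment> \<open>Replacing \<open>X\<close> by its lower bound \<open>x0\<close> can only raise
    the power. If \<open>Q \<le> 0 \<le> P\<close> it raises the base of an increasing power, and if
    \<open>P \<le> 0 \<le> Q\<close> it lowers the base of a decreasing one.\<close>
  have compare: "(a0 + Z X t) powr P \<le> (a0 + x0 powr Q * G t) powr P"
    if X: "continuous_on J X" "\<And>t. t \<in> J \<Longrightarrow> x0 \<le> X t" and t: "t \<in> J" for X t
  proof -
    have int: "x0 powr Q * G t = integral {0..t} (\<lambda>s. g s * x0 powr Q)"
      unfolding G_def by (simp add: mult.commute)
    have gx: "(\<lambda>s. g s * x0 powr Q) integrable_on {0..t}"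
      using integrable_on_cmult_right[OF g_int[OF t], of "x0 powr Q"] by simp
    have Gp: "0 \<le> x0 powr Q * G t" using G_pos[OF t] x0Q by simp
    show ?thesis
    proof (cases "0 \<le> P \<and> Q \<le> 0")
      case True
      have "Z X t \<le> x0 powr Q * G t"
        unfolding Z_def int
      proof (rule integral_le[OF gX_int[OF X t] gx])
        fix s assume "s \<in> {0..t}"
        then have s: "s \<in> J" using sub(1)[OF t] by auto
        show "g s * X s powr Q \<le> g s * x0 powr Q"
          using g(2)[OF s] X(2)[OF s] x0 True by (intro mult_left_mono powr_mono2') auto
      qed
      moreover have "0 \<le> Z X t"
        unfolding Z_def by (rule integral_nonneg[OF gX_int[OF X t]]) (use g_pos[OF _ t] in auto)
      ultimately show ?thesis using True a0 by (intro powr_mono2) auto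
    next
      case False
      then have PQ': "P \<le> 0" "0 \<le> Q" using PQ by auto
      have le: "x0 powr Q * G t \<le> Z X t"
        unfolding Z_def int
      proof (rule integral_le[OF gx gX_int[OF X t]])
        fix s assume "s \<in> {0..t}"
        then have s: "s \<in> J" using sub(1)[OF t] by auto
        show "g s * x0 powr Q \<le> g s * X s powr Q"
          using g(2)[OF s] X(2)[OF s] x0 PQ' by (intro mult_left_mono powr_mono2) auto
      qed
      show ?thesis
      \<comment> \<open>A power with nonpositive exponent decreases only on positive bases, since
        \<open>0 powr P = 0\<close>. The base vanishes only at \<open>t = 0\<close> with
        \<open>a0 = 0\<close>, where both sides are 0.\<close>
      proof (cases "a0 + x0 powr Q * G t = 0")
        case True
        then have a: "a0 = 0" "G t = 0" using Gp a0 x0Q by (auto simp: add_nonneg_eq_0_iff)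
        have "t = 0"
        proof (rule ccontr)
          assume "t \<noteq> 0"
          then have "0 < t" using J[OF t] by simp
          moreover obtain c M where "0 < c" "\<forall>s\<in>{0..t}. c \<le> g s \<and> g s \<le> M" using g_bounds[OF t] by blast
          ultimately have "c * t \<le> G t" "0 < c * t" unfolding G_def using lin[OF g_int[OF t], of c M] by auto
          then show False using a by simp
        qed
        then show ?thesis by (simp add: Z_def a)
      next
        case False
        then show ?thesis using le Gp a0 PQ' by (intro powr_mono2') auto
      qed
    qed
  qed
  \<comment> \<open>Uniform over \<open>?K\<close>: on \<open>{0..b}\<close> every member lies
    between \<open>x0\<close> and \<open>hi b\<close>, so the integrand of \<open>Z X\<close> has
    positive bounds independent of \<open>X\<close>.\<close>
  have Z_bounds: "\<exists>k M. 0 < k \<and> (\<forall>X\<in>?K. \<forall>t\<in>{0<..b}. k * t \<le> Z X t \<and> Z X t \<le> M)" if b: "b \<in> J" for b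
  proof -
    obtain c M where cM: "0 < c" "0 < M" "\<forall>t\<in>{0..b}. c \<le> g t \<and> g t \<le> M" using g_bounds[OF b] by blast
    define u where "u = min (x0 powr Q) (hi b powr Q)"
    define v where "v = x0 powr Q + hi b powr Q"
    have hb: "0 < hi b" using hi_ge[OF b] x0 by simp
    have u: "0 < u" using x0 hb by (simp add: u_def)
    have v: "0 < v" using x0 by (simp add: v_def add_pos_nonneg)
    show ?thesis
    proof (rule exI[of _ "c * u"], rule exI[of _ "M * v * b"], intro conjI ballI)
      fix X t assume X: "X \<in> ?K" and t: "t \<in> {0<..b}"
      have tJ: "t \<in> J" by (rule inJ(1)[OF t b])
      have t0: "0 \<le> t" "t \<le> b" using inJ[OF t b] by auto
      have "c * u * t \<le> Z X t \<and> Z X t \<le> M * v * t"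
        unfolding Z_def
      proof (rule lin)
        show "(\<lambda>s. g s * X s powr Q) integrable_on {0..t}" using gX_int X tJ by auto
        fix s assume s: "s \<in> {0..t}"
        then have sb: "s \<in> {0..b}" using t0 by auto
        then have sJ: "s \<in> J" using sub(1)[OF b] by auto
        have Xs: "x0 \<le> X s" "X s \<le> hi b" using X sJ hi_mono[OF b, of s] sb by fastforce+
        have "X s powr Q \<le> v" unfolding v_def using Xs x0 by (intro powr_le_max) auto
        moreover have "u \<le> X s powr Q"
        proof (cases "Q \<ge> 0")
          case True
          then have "x0 powr Q \<le> X s powr Q" using Xs x0 by (intro powr_mono2) auto
          then show ?thesis by (simp add: u_def)
        next
          case False
          then have "hi b powr Q \<le> X s powr Q" using Xs x0 by (intro powr_mono2') auto
          then show ?thesis by (simp add: u_def)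
        qed
        ultimately show "c * u \<le> g s * X s powr Q \<and> g s * X s powr Q \<le> M * v"
          using cM sb u v g_pos[OF sb b] by (auto intro!: mult_mono)
      qed (use t0 in auto)
      moreover have "M * v * t \<le> M * v * b" using cM v t0 by (intro mult_left_mono) auto
      ultimately show "c * u * t \<le> Z X t" "Z X t \<le> M * v * b" by auto
    qed (use cM u in auto)
  qed
  \<comment> \<open>The second unknown of the integral equation starts at 0, so its actual initial
    value \<open>a0\<close> is absorbed into the right-hand side.\<close>
  let ?F = "\<lambda>t i. H t * (a0 + i) powr P"
  have F_bound: "\<exists>C. \<forall>t\<in>{0<..b}. \<bar>?F t (Z X t)\<bar> \<le> C * t powr (w - 1)" if X: "X \<in> ?K" and b: "b \<in> J" for X b
  proof -
    obtain k M where kM: "0 < k" "\<forall>X\<in>?K. \<forall>t\<in>{0<..b}. k * t \<le> Z X t \<and> Z X t \<le> M" using Z_bounds[OF b] by blast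
    obtain C where "\<forall>t\<in>{0<..b}. \<forall>Z. k * t \<le> Z \<and> Z \<le> M \<longrightarrow> H t * (a0 + Z) powr P \<le> C * t powr (w - 1)"
      using sing[OF b kM(1)] by blast
    then have "\<forall>t\<in>{0<..b}. H t * (a0 + Z X t) powr P \<le> C * t powr (w - 1)" using kM(2) X by blast
    moreover have "0 \<le> H t" if "t \<in> {0<..b}" for t using H(2) inJ[OF that b] by auto
    ultimately show ?thesis by (intro exI[of _ C]) (auto simp: abs_mult)
  qed
  have F_cont: "continuous_on (J - {0}) (\<lambda>t. ?F t (Z X t))" if X: "X \<in> ?K" and c: "continuous_on J (Z X)" for X
  proof -
    have "a0 + Z X t \<noteq> 0" if t: "t \<in> J - {0}" for t
    proof -
      have tJ: "t \<in> J" and "0 < t" using t J[of t] by (auto simp: less_le)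
      obtain k M where kM: "0 < k" "\<forall>X\<in>?K. \<forall>s\<in>{0<..t}. k * s \<le> Z X s \<and> Z X s \<le> M" using Z_bounds[OF tJ] by blast
      have "t \<in> {0<..t}" using \<open>0 < t\<close> by (simp add: greaterThanAtMost_iff)
      then have "k * t \<le> Z X t" "0 < k * t" using kM X \<open>0 < t\<close> by auto
      then show ?thesis using a0 by linarith
    qed
    moreover have "continuous_on (J - {0}) H" "continuous_on (J - {0}) (Z X)"
      using H(1) c by (auto intro: continuous_on_subset)
    ultimately show ?thesis by (intro continuous_intros) auto
  qed
  have F_lip: "\<exists>L\<ge>0. \<forall>X\<in>?K. \<forall>Y\<in>?K. \<forall>t\<in>{0<..b}. \<bar>?F t (Z X t) - ?F t (Z Y t)\<bar> \<le> L * t powr (w - 2) * \<bar>Z X t - Z Y t\<bar>"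
    if b: "b \<in> J" for b
  proof -
    obtain k M where kM: "0 < k" "\<forall>X\<in>?K. \<forall>t\<in>{0<..b}. k * t \<le> Z X t \<and> Z X t \<le> M" using Z_bounds[OF b] by blast
    obtain h where h: "0 \<le> h" "\<forall>t\<in>{0..b}. H t \<le> h" using H_bound[OF b] by blast
    define D where "D = k powr P + (a0 + M) powr P"
    have D: "0 \<le> D" by (simp add: D_def)
    show ?thesis
    proof (intro exI[of _ "h * (\<bar>P\<bar> * (D / k))"] conjI ballI)
      fix X Y t assume X: "X \<in> ?K" and Y: "Y \<in> ?K" and t: "t \<in> {0<..b}"
      have t0: "0 < t" using t by (simp add: greaterThanAtMost_iff)
      then have kt: "0 < k * t" using kM by simp
      have ZX: "k * t \<le> Z X t" "Z X t \<le> M" and ZY: "k * t \<le> Z Y t" "Z Y t \<le> M" using kM X Y t by auto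
      \<comment> \<open>Between the two bases \<open>z \<ge> k * t\<close>, so
        \<open>z powr (P - 1) = z powr P / z\<close> is of order \<open>t powr (w - 1) / t\<close>.
        This is precisely the singular Lipschitz constant that the integral equation
        tolerates.\<close>
      have "\<bar>(a0 + Z X t) powr P - (a0 + Z Y t) powr P\<bar> \<le> \<bar>P\<bar> * (D / k * t powr (w - 2)) * \<bar>(a0 + Z X t) - (a0 + Z Y t)\<bar>"
      proof (rule powr_diff_le_mvt)
        fix z assume z: "min (a0 + Z X t) (a0 + Z Y t) \<le> z" "z \<le> max (a0 + Z X t) (a0 + Z Y t)"
        have z1: "k * t \<le> z" "z \<le> a0 + M" using z ZX ZY a0 by auto
        then have z0: "0 < z" using kt by linarith
        have "z powr (P - 1) = z powr P / z" using z0 by (simp add: powr_diff)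
        also have "\<dots> \<le> (D * t powr (w - 1)) / (k * t)"
          unfolding D_def w_def using z1 kt kM t0 by (intro frac_le powr_singular_bound) auto
        also have "\<dots> = D / k * (t powr (w - 1) / t powr 1)" using t0 by simp
        also have "t powr (w - 1) / t powr 1 = t powr (w - 2)" by (simp only: powr_diff[symmetric]) simp
        finally show "\<bar>P\<bar> * z powr (P - 1) \<le> \<bar>P\<bar> * (D / k * t powr (w - 2))" by (rule mult_left_mono) simp
      qed (use ZX ZY kt a0 in linarith)+
      then have 1: "\<bar>(a0 + Z X t) powr P - (a0 + Z Y t) powr P\<bar> \<le> \<bar>P\<bar> * (D / k * t powr (w - 2)) * \<bar>Z X t - Z Y t\<bar>" by simp
      have Ht: "0 \<le> H t" "H t \<le> h" using h inJ[OF t b] H(2) by auto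
      have "\<bar>?F t (Z X t) - ?F t (Z Y t)\<bar> = H t * \<bar>(a0 + Z X t) powr P - (a0 + Z Y t) powr P\<bar>"
        using Ht(1) by (simp add: abs_mult right_diff_distrib[symmetric])
      also have "\<dots> \<le> h * (\<bar>P\<bar> * (D / k * t powr (w - 2)) * \<bar>Z X t - Z Y t\<bar>)"
        using 1 Ht by (intro mult_mono) auto
      finally show "\<bar>?F t (Z X t) - ?F t (Z Y t)\<bar> \<le> h * (\<bar>P\<bar> * (D / k)) * t powr (w - 2) * \<bar>Z X t - Z Y t\<bar>"
        by (simp add: mult.assoc)
    qed (use h D kM in auto)
  qed
  have f_lip: "\<exists>L\<ge>0. \<forall>X\<in>?K. \<forall>Y\<in>?K. \<forall>t\<in>{0..b}. \<bar>g t * X t powr Q - g t * Y t powr Q\<bar> \<le> L * \<bar>X t - Y t\<bar>" if b: "b \<in> J" for b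
  proof -
    obtain c M where cM: "0 < c" "0 < M" "\<forall>t\<in>{0..b}. c \<le> g t \<and> g t \<le> M" using g_bounds[OF b] by blast
    obtain L where L: "0 \<le> L" "\<forall>x\<in>{x0..hi b}. \<forall>y\<in>{x0..hi b}. \<bar>x powr Q - y powr Q\<bar> \<le> L * \<bar>x - y\<bar>"
      using powr_lipschitz[OF x0, of "hi b" Q] by blast
    show ?thesis
    proof (intro exI[of _ "M * L"] conjI ballI)
      fix X Y t assume X: "X \<in> ?K" and Y: "Y \<in> ?K" and t: "t \<in> {0..b}"
      have tJ: "t \<in> J" using t sub(1)[OF b] by auto
      have "X t \<in> {x0..hi b}" "Y t \<in> {x0..hi b}" using X Y tJ hi_mono[OF b, of t] t by fastforce+
      then have 1: "\<bar>X t powr Q - Y t powr Q\<bar> \<le> L * \<bar>X t - Y t\<bar>" using L by blast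
      have "\<bar>g t * X t powr Q - g t * Y t powr Q\<bar> = g t * \<bar>X t powr Q - Y t powr Q\<bar>"
        using g(2)[OF tJ] by (simp add: abs_mult right_diff_distrib[symmetric])
      also have "\<dots> \<le> M * (L * \<bar>X t - Y t\<bar>)" using 1 cM t L by (intro mult_mono) auto
      finally show "\<bar>g t * X t powr Q - g t * Y t powr Q\<bar> \<le> M * L * \<bar>X t - Y t\<bar>" by (simp add: mult.assoc)
    qed (use cM L in auto)
  qed
  have self: "x0 \<le> x0 + integral {0..t} (\<lambda>t. ?F t (Z X t)) \<and> x0 + integral {0..t} (\<lambda>t. ?F t (Z X t)) \<le> hi t"
    if X: "X \<in> ?K" and t: "t \<in> J" and int: "(\<lambda>t. ?F t (Z X t)) integrable_on {0..t}" for X t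
  proof -
    have Hs: "0 \<le> H s" if "s \<in> {0..t}" for s using that H(2) inJ0[OF _ _ t] by auto
    have "0 \<le> integral {0..t} (\<lambda>t. ?F t (Z X t))"
      by (rule integral_nonneg[OF int]) (use Hs in auto)
    moreover have "integral {0..t} (\<lambda>t. ?F t (Z X t)) \<le> integral {0..t} U"
    proof (rule integral_le[OF int U_int[OF t]])
      fix s assume s: "s \<in> {0..t}"
      then have "(a0 + Z X s) powr P \<le> (a0 + x0 powr Q * G s) powr P"
        using compare[of X s] X inJ0[OF _ _ t, of s] by auto
      then show "?F s (Z X s) \<le> U s" unfolding U_def using Hs[OF s] by (intro mult_left_mono)
    qed
    ultimately show ?thesis by (simp add: hi_def)
  qed
  have gK: "continuous_on J (\<lambda>t. g t * X t powr Q)" if "X \<in> ?K" for X using gX_cont that by auto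
  have x0_hi: "x0 \<le> x0 \<and> x0 \<le> hi t" if "t \<in> J" for t using hi_ge[OF that] by simp
  note ivp = integral_equation_ivp[where J=J and f="\<lambda>t x. g t * x powr Q" and F="?F" and lo="\<lambda>_. x0" and hi=hi and ?x0.0=x0 and w=w,
      folded Z_def]

  have "\<exists>X A. X \<in> ?K \<and> continuous_on J A \<and> X 0 = x0 \<and> A 0 = 0 \<and>
      (\<forall>t\<in>J. 0 < t \<longrightarrow> (X has_real_derivative ?F t (A t)) (at t) \<and> (A has_real_derivative g t * X t powr Q) (at t))"
    by (rule ivp(1); (rule J J0 nxt down w x0_hi gK F_cont F_bound self f_lip F_lip; assumption)?)
  then obtain X A where X: "X \<in> ?K" and A: "continuous_on J A" "X 0 = x0" "A 0 = 0"
    and d: "\<forall>t\<in>J. 0 < t \<longrightarrow> (X has_real_derivative ?F t (A t)) (at t) \<and> (A has_real_derivative g t * X t powr Q) (at t)"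
    by blast
  have Apos: "0 < A t" if t: "t \<in> J" "0 < t" for t
  proof -
    have "A 0 < A t"
    proof (rule DERIV_pos_imp_increasing_open[OF t(2)])
      fix s assume s: "0 < s" "s < t"
      then have sJ: "s \<in> J" using down[OF t(1), of s] by simp
      then have "0 < X s" using X x0 by fastforce
      then have "0 < g s * X s powr Q" using g(2)[OF sJ] by simp
      then show "\<exists>y. (A has_real_derivative y) (at s) \<and> 0 < y" using d sJ s by blast
    qed (use continuous_on_subset[OF A(1) sub(1)[OF t(1)]] in auto)
    then show ?thesis using A by simp
  qed
  show "\<exists>X A. continuous_on J X \<and> continuous_on J A \<and> X 0 = x0 \<and> A 0 = a0 \<and>
      (\<forall>t\<in>J. x0 \<le> X t \<and> (0 < t \<longrightarrow> 0 < A t \<and> (X has_real_derivative H t * A t powr P) (at t) \<and>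
         (A has_real_derivative g t * X t powr Q) (at t)))"
  proof (rule exI[of _ X], rule exI[of _ "\<lambda>t. a0 + A t"], intro conjI ballI impI)
    fix t assume t: "t \<in> J" "0 < t"
    show "((\<lambda>t. a0 + A t) has_real_derivative g t * X t powr Q) (at t)"
      using d t by (auto intro!: derivative_eq_intros)
  qed (use X A d Apos a0 in \<open>auto intro!: continuous_intros add_nonneg_pos\<close>)

  fix X A Y B t
  assume X: "continuous_on J X" "continuous_on J A" "X 0 = x0" "A 0 = a0"
    and Y: "continuous_on J Y" "continuous_on J B" "Y 0 = x0" "B 0 = a0"
    and dX: "\<And>t. t \<in> J \<Longrightarrow> 0 < t \<Longrightarrow> x0 \<le> X t \<and> (X has_real_derivative H t * A t powr P) (at t) \<and>
         (A has_real_derivative g t * X t powr Q) (at t)"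
    and dY: "\<And>t. t \<in> J \<Longrightarrow> 0 < t \<Longrightarrow> x0 \<le> Y t \<and> (Y has_real_derivative H t * B t powr P) (at t) \<and>
         (B has_real_derivative g t * Y t powr Q) (at t)"
    and t: "t \<in> J"
  \<comment> \<open>Uniqueness is asserted among all solutions above \<open>x0\<close>. The barrier
    \<open>hi\<close> comes for free: integrate the equations and apply
    \<open>compare\<close>.\<close>
  have inK: "X \<in> ?K" if X: "continuous_on J X" "continuous_on J A" "X 0 = x0" "A 0 = a0"
    and d: "\<And>t. t \<in> J \<Longrightarrow> 0 < t \<Longrightarrow> x0 \<le> X t \<and> (X has_real_derivative H t * A t powr P) (at t) \<and>
         (A has_real_derivative g t * X t powr Q) (at t)" for X A
  proof -
    have Xge: "x0 \<le> X t" if "t \<in> J" for t using d[OF that] X(3) J[OF that] by (cases "t = 0") auto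
    have "X t \<le> hi t" if t: "t \<in> J" for t
    proof -
      have AZ: "A s = a0 + Z X s" if s: "s \<in> J" for s
      proof -
        have "((\<lambda>r. g r * X r powr Q) has_integral A s - A 0) {0..s}"
          using J[OF s] continuous_on_subset[OF X(2) sub(1)[OF s]] d down[OF s]
          by (intro fundamental_theorem_of_calculus_interior) (auto simp: has_real_derivative_iff_has_vector_derivative)
        then show ?thesis unfolding Z_def using X by (simp add: integral_unique)
      qed
      have "((\<lambda>r. H r * A r powr P) has_integral X t - X 0) {0..t}"
        using J[OF t] continuous_on_subset[OF X(1) sub(1)[OF t]] d down[OF t]
        by (intro fundamental_theorem_of_calculus_interior) (auto simp: has_real_derivative_iff_has_vector_derivative)
      moreover have "(U has_integral integral {0..t} U) {0..t}" using U_int[OF t] by blast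
      ultimately have "X t - X 0 \<le> integral {0..t} U"
      proof (rule has_integral_le)
        fix s assume "s \<in> {0..t}"
        then have s: "s \<in> J" using sub(1)[OF t] by auto
        show "H s * A s powr P \<le> U s"
          unfolding U_def AZ[OF s] using compare[OF X(1) Xge s] H(2)[OF s] by (intro mult_left_mono) auto
      qed
      then show ?thesis using X by (simp add: hi_def)
    qed
    then show ?thesis using X Xge by blast
  qed
  have XK: "X \<in> ?K" using X dX by (rule inK)
  have YK: "Y \<in> ?K" using Y dY by (rule inK)
  have cA: "continuous_on J (\<lambda>t. A t - a0)" "continuous_on J (\<lambda>t. B t - a0)" using X Y by (auto intro!: continuous_intros)
  have z: "A 0 - a0 = 0" "B 0 - a0 = 0" using X Y by auto
  have dX': "(X has_real_derivative ?F t (A t - a0)) (at t) \<and> ((\<lambda>t. A t - a0) has_real_derivative g t * X t powr Q) (at t)"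
    if "t \<in> J" "0 < t" for t using dX[OF that] by (auto intro!: derivative_eq_intros)
  have dY': "(Y has_real_derivative ?F t (B t - a0)) (at t) \<and> ((\<lambda>t. B t - a0) has_real_derivative g t * Y t powr Q) (at t)"
    if "t \<in> J" "0 < t" for t using dY[OF that] by (auto intro!: derivative_eq_intros)
  have "X t = Y t \<and> A t - a0 = B t - a0"
    by (rule ivp(2)[where X=X and Y=Y and A="\<lambda>t. A t - a0" and B="\<lambda>t. B t - a0" and t=t];
        (rule J J0 nxt down w x0_hi gK F_cont F_bound self f_lip F_lip XK cA(1) X(3) z(1) YK cA(2) Y(3) z(2) dX' dY' t; assumption?)?)
  then show "X t = Y t \<and> A t = B t" by simp
qed

section \<open>Uniqueness for positive data and local existence for decreasing systems\<close>

lemma continuous_pos_bounds: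
  fixes f :: "real \<Rightarrow> real"
  assumes "continuous_on {a..b} f" "\<And>x. x \<in> {a..b} \<Longrightarrow> 0 < f x"
  shows "\<exists>c M. 0 < c \<and> (\<forall>x\<in>{a..b}. c \<le> f x \<and> f x \<le> M)"
proof (cases "a \<le> b")
  case True
  then have ne: "{a..b} \<noteq> {}" by simp
  obtain s where s: "s \<in> {a..b}" "\<forall>t\<in>{a..b}. f s \<le> f t"
    using continuous_attains_inf[OF compact_Icc ne assms(1)] by blast
  obtain r where r: "r \<in> {a..b}" "\<forall>t\<in>{a..b}. f t \<le> f r"
    using continuous_attains_sup[OF compact_Icc ne assms(1)] by blast
  show ?thesis
    by (rule exI[of _ "f s"], rule exI[of _ "f r"]) (use s r assms(2)[OF s(1)] in auto)
qed (auto intro: exI[of _ 1])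

text \<open>On a compact interval positive continuous unknowns are bounded away from 0, so both
  powers are Lipschitz there and Gronwall applies to the squared distance of the two solutions. The
  point of agreement \<open>c\<close> may lie anywhere in the interval.\<close>

lemma power_system_unique:
  fixes v w Y Z h :: "real \<Rightarrow> real" and e alpha p :: real
  assumes cont: "continuous_on {a..b} v" "continuous_on {a..b} w" "continuous_on {a..b} Y" "continuous_on {a..b} Z"
    and pos: "\<And>t. t \<in> {a..b} \<Longrightarrow> 0 < v t \<and> 0 < w t \<and> 0 < Y t \<and> 0 < Z t"
    and h: "\<And>t. a < t \<Longrightarrow> t < b \<Longrightarrow> \<bar>h t\<bar> \<le> M"
    and vY: "\<And>t. a < t \<Longrightarrow> t < b \<Longrightarrow> (v has_real_derivative e * Y t powr alpha) (at t) \<and> (Y has_real_derivative e * h t * v t powr p) (at t)"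
    and wZ: "\<And>t. a < t \<Longrightarrow> t < b \<Longrightarrow> (w has_real_derivative e * Z t powr alpha) (at t) \<and> (Z has_real_derivative e * h t * w t powr p) (at t)"
    and c: "c \<in> {a..b}" "v c = w c" "Y c = Z c" and t: "t \<in> {a..b}"
  shows "v t = w t \<and> Y t = Z t"
proof -
  obtain c1 M1 where 1: "0 < c1" "\<forall>t\<in>{a..b}. c1 \<le> v t \<and> v t \<le> M1" using continuous_pos_bounds[OF cont(1)] pos by blast
  obtain c2 M2 where 2: "0 < c2" "\<forall>t\<in>{a..b}. c2 \<le> w t \<and> w t \<le> M2" using continuous_pos_bounds[OF cont(2)] pos by blast
  obtain c3 M3 where 3: "0 < c3" "\<forall>t\<in>{a..b}. c3 \<le> Y t \<and> Y t \<le> M3" using continuous_pos_bounds[OF cont(3)] pos by blast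
  obtain c4 M4 where 4: "0 < c4" "\<forall>t\<in>{a..b}. c4 \<le> Z t \<and> Z t \<le> M4" using continuous_pos_bounds[OF cont(4)] pos by blast
  obtain L where L: "0 \<le> L" "\<forall>x\<in>{min c1 c2..max M1 M2}. \<forall>y\<in>{min c1 c2..max M1 M2}. \<bar>x powr p - y powr p\<bar> \<le> L * \<bar>x - y\<bar>"
    using powr_lipschitz[of "min c1 c2" "max M1 M2" p] 1(1) 2(1) by auto
  obtain L' where L': "0 \<le> L'" "\<forall>x\<in>{min c3 c4..max M3 M4}. \<forall>y\<in>{min c3 c4..max M3 M4}. \<bar>x powr alpha - y powr alpha\<bar> \<le> L' * \<bar>x - y\<bar>"
    using powr_lipschitz[of "min c3 c4" "max M3 M4" alpha] 3(1) 4(1) by auto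
  define E where "E s = (v s - w s)\<^sup>2 + (Y s - Z s)\<^sup>2" for s
  define E' where "E' s = 2 * (v s - w s) * (e * Y s powr alpha - e * Z s powr alpha)
      + 2 * (Y s - Z s) * (e * h s * v s powr p - e * h s * w s powr p)" for s
  have "E t = 0"
  proof (rule gronwall_zero[where f=E and a=a and b=b and x=t and f'=E' and C="\<bar>e\<bar> * (L' + M * L)" and c=c])
    show "continuous_on {a..b} E" unfolding E_def using cont by (intro continuous_intros)
    fix s assume s: "a < s" "s < b"
    show "(E has_real_derivative E' s) (at s)"
      unfolding E_def E'_def using vY[OF s] wZ[OF s] by (auto intro!: derivative_eq_intros simp: algebra_simps)
    have sab: "s \<in> {a..b}" using s by simp
    have in1: "v s \<in> {min c1 c2..max M1 M2}" "w s \<in> {min c1 c2..max M1 M2}"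
      using 1(2)[rule_format, OF sab] 2(2)[rule_format, OF sab] by auto
    have in2: "Y s \<in> {min c3 c4..max M3 M4}" "Z s \<in> {min c3 c4..max M3 M4}"
      using 3(2)[rule_format, OF sab] 4(2)[rule_format, OF sab] by auto
    define d1 where "d1 = \<bar>v s - w s\<bar>"
    define d2 where "d2 = \<bar>Y s - Z s\<bar>"
    have A: "\<bar>v s powr p - w s powr p\<bar> \<le> L * d1" using L(2) in1 by (auto simp: d1_def)
    have B: "\<bar>Y s powr alpha - Z s powr alpha\<bar> \<le> L' * d2" using L'(2) in2 by (auto simp: d2_def)
    have hM: "\<bar>h s\<bar> \<le> M" using h[OF s] .
    have "\<bar>E' s\<bar> \<le> \<bar>2 * (v s - w s) * (e * Y s powr alpha - e * Z s powr alpha)\<bar>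
      + \<bar>2 * (Y s - Z s) * (e * h s * v s powr p - e * h s * w s powr p)\<bar>"
      unfolding E'_def by (rule abs_triangle_ineq)
    also have "\<bar>2 * (v s - w s) * (e * Y s powr alpha - e * Z s powr alpha)\<bar> = 2 * d1 * \<bar>e\<bar> * \<bar>Y s powr alpha - Z s powr alpha\<bar>"
    proof -
      have "2 * (v s - w s) * (e * Y s powr alpha - e * Z s powr alpha) = 2 * (v s - w s) * e * (Y s powr alpha - Z s powr alpha)"
        by (simp add: algebra_simps)
      then show ?thesis by (simp only: d1_def abs_mult abs_numeral mult.assoc)
    qed
    also have "\<bar>2 * (Y s - Z s) * (e * h s * v s powr p - e * h s * w s powr p)\<bar> = 2 * d2 * \<bar>e\<bar> * (\<bar>h s\<bar> * \<bar>v s powr p - w s powr p\<bar>)"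
    proof -
      have "2 * (Y s - Z s) * (e * h s * v s powr p - e * h s * w s powr p) = 2 * (Y s - Z s) * e * (h s * (v s powr p - w s powr p))"
        by (simp add: algebra_simps)
      then show ?thesis by (simp only: d2_def abs_mult abs_numeral mult.assoc)
    qed
    also have "2 * d1 * \<bar>e\<bar> * \<bar>Y s powr alpha - Z s powr alpha\<bar> \<le> 2 * d1 * \<bar>e\<bar> * (L' * d2)"
      using B by (intro mult_left_mono) (auto simp: d1_def)
    also have "2 * d2 * \<bar>e\<bar> * (\<bar>h s\<bar> * \<bar>v s powr p - w s powr p\<bar>) \<le> 2 * d2 * \<bar>e\<bar> * (M * (L * d1))"
      using A hM by (intro mult_left_mono mult_mono) (auto simp: d2_def)
    also have "2 * d1 * \<bar>e\<bar> * (L' * d2) + 2 * d2 * \<bar>e\<bar> * (M * (L * d1)) = \<bar>e\<bar> * (L' + M * L) * (2 * d1 * d2)"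
      by (simp add: algebra_simps)
    also have "\<dots> \<le> \<bar>e\<bar> * (L' + M * L) * E s"
    proof (rule mult_left_mono)
      have "0 \<le> (d1 - d2)\<^sup>2" by simp
      then show "2 * d1 * d2 \<le> E s" by (simp add: E_def d1_def d2_def power2_diff)
      have "0 \<le> M" using hM by linarith
      then show "0 \<le> \<bar>e\<bar> * (L' + M * L)" using L L' by simp
    qed
    finally show "\<bar>E' s\<bar> \<le> \<bar>e\<bar> * (L' + M * L) * E s" by linarith
  qed (use c t in \<open>auto simp: E_def\<close>)
  then show ?thesis by (simp add: E_def sum_power2_eq_zero_iff)
qed

text \<open>Both unknowns decrease and might reach 0, so the solution is built on an interval so
  short that neither loses more than half of its initial value. \<open>Y\<close> is the unknown of
  the integral equation, and \<open>V\<close> is recovered as \<open>l\<close> plus an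
  integral.\<close>

lemma power_system_decreasing_local:
  fixes h :: "real \<Rightarrow> real" and l y0 alpha p :: real
  assumes h: "continuous_on {0..1} h" "\<And>t. t \<in> {0..1} \<Longrightarrow> 0 \<le> h t" and l: "0 < l" and y0: "0 < y0"
  shows "\<exists>d>0. \<exists>V Y. continuous_on {0..<d} V \<and> continuous_on {0..<d} Y \<and> V 0 = l \<and> Y 0 = y0 \<and>
      (\<forall>t. 0 < t \<longrightarrow> t < d \<longrightarrow> 0 < V t \<and> 0 < Y t \<and> (V has_real_derivative - (Y t powr alpha)) (at t) \<and>
         (Y has_real_derivative - (h t * V t powr p)) (at t))"
proof -
  have "bounded (h ` {0..1})" by (intro compact_imp_bounded compact_continuous_image h) auto
  then obtain B where B: "\<forall>t\<in>{0..1}. h t \<le> B" by (auto simp: bounded_iff abs_le_iff)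
  have B0: "0 \<le> B" using B h(2)[of 0] order_trans[of 0 "h 0" B] by auto
  \<comment> \<open>\<open>m\<close> and \<open>n\<close> bound the speeds of \<open>V\<close> and
    \<open>Y\<close> as long as \<open>Y\<close> stays in \<open>[y0/2, y0]\<close> and
    \<open>V\<close> in \<open>[l/2, l]\<close>.\<close>
  define m where "m = (y0/2) powr alpha + y0 powr alpha"
  define n where "n = B * ((l/2) powr p + l powr p)"
  have m: "0 < m" using y0 by (simp add: m_def add_pos_pos)
  have n: "0 \<le> n" using B0 by (simp add: n_def)
  \<comment> \<open>Chosen so that \<open>d * m \<le> l / 2\<close> and
    \<open>d * n \<le> y0 / 2\<close>. The denominator has \<open>n + 1\<close> because
    \<open>n\<close> may be 0, and \<open>d \<le> 1\<close> stays within the domain of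
    \<open>h\<close>.\<close>
  define d where "d = min 1 (min (l / (2 * m)) (y0 / (2 * (n + 1))))"
  have d0: "0 < d" using l y0 m n by (simp add: d_def)
  have dm: "d * m \<le> l / 2"
  proof -
    have "d \<le> l / (2 * m)" by (simp add: d_def)
    then have "d * m \<le> l / (2 * m) * m" using m by (intro mult_right_mono) auto
    then show ?thesis using m by simp
  qed
  have dn: "d * n \<le> y0 / 2"
  proof -
    have "d \<le> y0 / (2 * (n + 1))" by (simp add: d_def)
    then have "d * (n + 1) \<le> y0 / (2 * (n + 1)) * (n + 1)" using n by (intro mult_right_mono) auto
    also have "\<dots> = y0 / 2" using n by (simp add: field_simps)
    finally show ?thesis using d0 by (simp add: algebra_simps)
  qed
  have d1: "d \<le> 1" by (simp add: d_def)
  let ?J = "{0..<d}"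
  let ?K = "{X. continuous_on ?J X \<and> (\<forall>t\<in>?J. y0 / 2 \<le> X t \<and> X t \<le> y0)}"
  define Z where "Z X t = integral {0..t} (\<lambda>s. - (X s powr alpha))" for X :: "real \<Rightarrow> real" and t
  let ?F = "\<lambda>t i. - (h t * (l + i) powr p)"
  have Xpos: "0 < X t" if "X \<in> ?K" "t \<in> ?J" for X t
    using that y0 by fastforce
  have f_cont: "continuous_on ?J (\<lambda>t. - (X t powr alpha))" if X: "X \<in> ?K" for X
  proof -
    have "continuous_on ?J X" "\<And>t. t \<in> ?J \<Longrightarrow> X t \<noteq> 0" using X Xpos[OF X] by fastforce+
    then show ?thesis by (intro continuous_intros) auto
  qed
  have Zb: "- (l / 2) \<le> Z X t \<and> Z X t \<le> 0" if X: "X \<in> ?K" and t: "t \<in> ?J" for X t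
  proof -
    have sub: "{0..t} \<subseteq> ?J" using t by auto
    have int: "(\<lambda>s. - (X s powr alpha)) integrable_on {0..t}"
      using continuous_on_subset[OF f_cont[OF X] sub] by (rule integrable_continuous_real)
    have "integral {0..t} (\<lambda>_. - m) \<le> Z X t" unfolding Z_def
    proof (rule integral_le[OF _ int])
      fix s assume "s \<in> {0..t}"
      then have "y0 / 2 \<le> X s \<and> X s \<le> y0" using X t by auto
      then have "X s powr alpha \<le> m" unfolding m_def using y0 by (intro powr_le_max) auto
      then show "- m \<le> - (X s powr alpha)" by simp
    qed auto
    moreover have "integral {0..t} (\<lambda>_. - m) = - (t * m)" using t by simp
    moreover have "t * m \<le> d * m" using t m by (intro mult_right_mono) auto
    moreover have "Z X t \<le> 0"
      using integral_le[OF int integrable_0] unfolding Z_def by simp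
    ultimately show ?thesis using dm by linarith
  qed
  have hb: "0 \<le> h t" "h t \<le> B" if "t \<in> ?J" for t using that d1 B h(2)[of t] by auto
  have Fb: "\<bar>?F t (Z X t)\<bar> \<le> n" if X: "X \<in> ?K" and t: "t \<in> ?J" for X t
  proof -
    have "(l + Z X t) powr p \<le> (l/2) powr p + l powr p"
      using Zb[OF X t] l by (intro powr_le_max) auto
    then have "h t * (l + Z X t) powr p \<le> n" unfolding n_def using hb[OF t] by (intro mult_mono) auto
    then show ?thesis using hb[OF t] by (simp add: abs_mult)
  qed
  note ivp = integral_equation_ivp(1)[where J="?J" and f="\<lambda>t x. - (x powr alpha)" and F="?F" and lo="\<lambda>_. y0/2" and hi="\<lambda>_. y0" and ?x0.0=y0 and w=1,
      folded Z_def]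
  have "\<exists>X A. X \<in> ?K \<and> continuous_on ?J A \<and> X 0 = y0 \<and> A 0 = 0 \<and>
      (\<forall>t\<in>?J. 0 < t \<longrightarrow> (X has_real_derivative ?F t (A t)) (at t) \<and> (A has_real_derivative - (X t powr alpha)) (at t))"
  proof (rule ivp)
    show "\<exists>t'\<in>?J. t < t'" if "t \<in> ?J" for t
      using that dense[of t d] by (auto intro: less_imp_le)
    show "continuous_on ?J (\<lambda>t. - (X t powr alpha))" if "X \<in> ?K" for X using f_cont[OF that] .
    show "continuous_on (?J - {0}) (\<lambda>t. ?F t (Z X t))" if X: "X \<in> ?K" and c: "continuous_on ?J (Z X)" for X
    proof -
      have "continuous_on (?J - {0}) h" "continuous_on (?J - {0}) (Z X)"
        using h(1) c d1 by (auto intro: continuous_on_subset)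
      moreover have "l + Z X t \<noteq> 0" if "t \<in> ?J - {0}" for t using Zb[OF X, of t] that l by fastforce
      ultimately show ?thesis by (intro continuous_intros) auto
    qed
    show "\<exists>C. \<forall>t\<in>{0<..b}. \<bar>?F t (Z X t)\<bar> \<le> C * t powr (1 - 1)" if "X \<in> ?K" "b \<in> ?J" for X b
      by (rule exI[of _ n]) (use Fb[OF that(1)] that in auto)
    show "y0/2 \<le> y0 + integral {0..t} (\<lambda>t. ?F t (Z X t)) \<and> y0 + integral {0..t} (\<lambda>t. ?F t (Z X t)) \<le> y0"
      if X: "X \<in> ?K" and t: "t \<in> ?J" and int: "(\<lambda>t. ?F t (Z X t)) integrable_on {0..t}" for X t
    proof -
      have "integral {0..t} (\<lambda>_. - n) \<le> integral {0..t} (\<lambda>t. ?F t (Z X t))"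
      proof (rule integral_le[OF _ int])
        fix s assume "s \<in> {0..t}"
        then show "- n \<le> ?F s (Z X s)" using Fb[OF X, of s] t by auto
      qed auto
      moreover have "integral {0..t} (\<lambda>_. - n) = - (t * n)" using t by simp
      moreover have "t * n \<le> d * n" using t n by (intro mult_right_mono) auto
      moreover have "integral {0..t} (\<lambda>t. ?F t (Z X t)) \<le> integral {0..t} (\<lambda>_. 0)"
      proof (rule integral_le[OF int])
        fix s assume "s \<in> {0..t}"
        then show "?F s (Z X s) \<le> 0" using hb[of s] t by auto
      qed auto
      moreover have "integral {0..t} (\<lambda>_. 0 :: real) = 0" by simp
      ultimately show ?thesis using dn by linarith
    qed
    show "\<exists>L\<ge>0. \<forall>X\<in>?K. \<forall>Y\<in>?K. \<forall>t\<in>{0..b}. \<bar>- (X t powr alpha) - - (Y t powr alpha)\<bar> \<le> L * \<bar>X t - Y t\<bar>" if b: "b \<in> ?J" for b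
    proof -
      obtain L where L: "0 \<le> L" "\<forall>x\<in>{y0/2..y0}. \<forall>y\<in>{y0/2..y0}. \<bar>x powr alpha - y powr alpha\<bar> \<le> L * \<bar>x - y\<bar>"
        using powr_lipschitz[of "y0/2" y0 alpha] y0 by auto
      show ?thesis
      proof (intro exI[of _ L] conjI ballI)
        fix X Y t assume "X \<in> ?K" "Y \<in> ?K" "t \<in> {0..b}"
        then have "X t \<in> {y0/2..y0}" "Y t \<in> {y0/2..y0}" using b by auto
        then have "\<bar>X t powr alpha - Y t powr alpha\<bar> \<le> L * \<bar>X t - Y t\<bar>" using L by blast
        then show "\<bar>- (X t powr alpha) - - (Y t powr alpha)\<bar> \<le> L * \<bar>X t - Y t\<bar>" by linarith
      qed (rule L)
    qed
    show "\<exists>L\<ge>0. \<forall>X\<in>?K. \<forall>Y\<in>?K. \<forall>t\<in>{0<..b}. \<bar>?F t (Z X t) - ?F t (Z Y t)\<bar> \<le> L * t powr (1 - 2) * \<bar>Z X t - Z Y t\<bar>" if b: "b \<in> ?J" for b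
    proof -
      obtain L where L: "0 \<le> L" "\<forall>x\<in>{l/2..l}. \<forall>y\<in>{l/2..l}. \<bar>x powr p - y powr p\<bar> \<le> L * \<bar>x - y\<bar>"
        using powr_lipschitz[of "l/2" l p] l by auto
      show ?thesis
      proof (intro exI[of _ "B * L"] conjI ballI)
        fix X Y t assume X: "X \<in> ?K" and Y: "Y \<in> ?K" and t: "t \<in> {0<..b}"
        have tJ: "t \<in> ?J" using t b by auto
        \<comment> \<open>With \<open>w = 1\<close> the integral equation allows a Lipschitz
          constant of order \<open>1 / t\<close>. For \<open>t < 1\<close> this exceeds 1, so the
          ordinary Lipschitz bound is enough.\<close>
        have t1: "1 \<le> t powr (1 - 2)" using t b d1 by (simp add: powr_minus_divide)
        have "l + Z X t \<in> {l/2..l}" "l + Z Y t \<in> {l/2..l}" using Zb[OF X tJ] Zb[OF Y tJ] by auto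
        then have "\<bar>(l + Z X t) powr p - (l + Z Y t) powr p\<bar> \<le> L * \<bar>(l + Z X t) - (l + Z Y t)\<bar>" using L by blast
        then have 1: "\<bar>(l + Z X t) powr p - (l + Z Y t) powr p\<bar> \<le> L * \<bar>Z X t - Z Y t\<bar>" by simp
        have "\<bar>?F t (Z X t) - ?F t (Z Y t)\<bar> = \<bar>h t * ((l + Z X t) powr p - (l + Z Y t) powr p)\<bar>"
          by (simp add: right_diff_distrib abs_minus_commute)
        also have "\<dots> = h t * \<bar>(l + Z X t) powr p - (l + Z Y t) powr p\<bar>"
          using hb[OF tJ] by (simp add: abs_mult)
        also have "\<dots> \<le> B * (L * \<bar>Z X t - Z Y t\<bar>)"
          using 1 hb[OF tJ] B0 by (intro mult_mono) auto
        also have "\<dots> \<le> B * (L * \<bar>Z X t - Z Y t\<bar>) * t powr (1 - 2)"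
          using mult_left_mono[OF t1, of "B * (L * \<bar>Z X t - Z Y t\<bar>)"] B0 L(1) by simp
        finally show "\<bar>?F t (Z X t) - ?F t (Z Y t)\<bar> \<le> B * L * t powr (1 - 2) * \<bar>Z X t - Z Y t\<bar>"
          by (simp add: mult_ac)
      qed (use B0 L in auto)
    qed
  qed (use d0 y0 in auto)
  then obtain X A where X: "X \<in> ?K" "X 0 = y0" and A: "continuous_on ?J A" "A 0 = 0"
    and D: "\<forall>t\<in>?J. 0 < t \<longrightarrow> (X has_real_derivative ?F t (A t)) (at t) \<and> (A has_real_derivative - (X t powr alpha)) (at t)"
    by blast
  have Apos: "0 < l + A t" if t: "0 < t" "t < d" for t
  proof -
    have sub: "{0..t} \<subseteq> ?J" using t by auto
    have "((\<lambda>s. - (X s powr alpha)) has_integral A t - A 0) {0..t}"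
      using t D continuous_on_subset[OF A(1) sub]
      by (intro fundamental_theorem_of_calculus_interior) (auto simp: has_real_derivative_iff_has_vector_derivative)
    then have "A t = Z X t" unfolding Z_def using A(2) by (metis diff_zero integral_unique)
    then show ?thesis using Zb[OF X(1), of t] t l by auto
  qed
  show ?thesis
  proof (intro exI[of _ d] conjI d0, rule exI[of _ "\<lambda>t. l + A t"], rule exI[of _ X], intro conjI allI impI)
    fix t assume t: "0 < t" "t < d"
    show "((\<lambda>t. l + A t) has_real_derivative - (X t powr alpha)) (at t)"
      using D t by (auto intro!: derivative_eq_intros)
    show "0 < X t" using Xpos[OF X(1), of t] t by auto
    show "(X has_real_derivative - (h t * (l + A t) powr p)) (at t)" using D t by auto
  qed (use X A Apos in \<open>auto intro!: continuous_intros\<close>)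
qed
section \<open>Limits of real functions\<close>

lemma mono_bounded_tendsto_at_right:
  fixes f :: "real \<Rightarrow> real"
  assumes ab: "a < b" and mono: "\<And>x y. a < x \<Longrightarrow> x \<le> y \<Longrightarrow> y < b \<Longrightarrow> f x \<le> f y"
    and lower: "\<And>x. a < x \<Longrightarrow> x < b \<Longrightarrow> c \<le> f x"
  shows "\<exists>l\<ge>c. (f \<longlongrightarrow> l) (at_right a) \<and> (\<forall>x. a < x \<longrightarrow> x < b \<longrightarrow> l \<le> f x)"
proof -
  define l where "l = Inf (f ` {a<..<b})"
  have bdd: "bdd_below (f ` {a<..<b})" using lower by (auto simp: bdd_below_def intro!: exI[of _ c])
  have ne: "f ` {a<..<b} \<noteq> {}" using ab by auto
  have le: "l \<le> f x" if "a < x" "x < b" for x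
    unfolding l_def using that bdd by (intro cInf_lower) auto
  have "c \<le> l" unfolding l_def using ne lower by (intro cInf_greatest) auto
  moreover have "(f \<longlongrightarrow> l) (at_right a)"
  proof (rule order_tendstoI)
    fix k assume "k < l"
    then show "\<forall>\<^sub>F x in at_right a. k < f x"
      using le ab by (intro eventually_at_rightI[of a b]) (auto intro: less_le_trans)
  next
    fix k assume "l < k"
    then obtain x where x: "a < x" "x < b" "f x < k"
      unfolding l_def using cInf_lessD[OF ne] by force
    then show "\<forall>\<^sub>F x in at_right a. f x < k"
      using mono by (intro eventually_at_rightI[of a x]) (auto intro: le_less_trans less_imp_le)
  qed
  ultimately show ?thesis using le by blast
qed

lemma mono_bounded_tendsto_at_top:
  fixes f :: "real \<Rightarrow> real"
  assumes mono: "\<And>x y. a < x \<Longrightarrow> x \<le> y \<Longrightarrow> f x \<le> f y" and upper: "\<And>x. a < x \<Longrightarrow> f x \<le> c"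
  shows "\<exists>l\<le>c. (f \<longlongrightarrow> l) at_top \<and> (\<forall>x>a. f x \<le> l)"
proof -
  define l where "l = Sup (f ` {a<..})"
  have bdd: "bdd_above (f ` {a<..})" using upper by (auto simp: bdd_above_def intro!: exI[of _ c])
  have ne: "f ` {a<..} \<noteq> {}" by auto
  have le: "f x \<le> l" if "a < x" for x
    unfolding l_def using that bdd by (intro cSup_upper) auto
  have "l \<le> c" unfolding l_def using ne upper by (intro cSup_least) auto
  moreover have "(f \<longlongrightarrow> l) at_top"
  proof (rule order_tendstoI)
    fix k assume "k < l"
    then obtain x where x: "a < x" "k < f x"
      unfolding l_def using less_cSupD[OF ne] by force
    then have "\<forall>y\<ge>x. k < f y" using mono by (meson less_le_trans)
    then show "\<forall>\<^sub>F x in at_top. k < f x" by (auto simp: eventually_at_top_linorder)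
  next
    fix k assume k: "l < k"
    show "\<forall>\<^sub>F x in at_top. f x < k"
      by (rule eventually_mono[OF eventually_gt_at_top[of a]]) (rule le_less_trans[OF le k])
  qed
  ultimately show ?thesis using le by blast
qed

lemma has_real_derivative_mult_powr:
  fixes x C a :: real
  assumes "0 < x"
  shows "((\<lambda>s. C * s powr a) has_real_derivative C * (a * x powr (a - 1))) (at x)"
  using has_real_derivative_powr[OF assms] by (rule DERIV_cmult)

section \<open>Extended intervals, extension to the endpoint 0, and limits under negative
  powers\<close>

lemma einterval_subset_pos: "0 \<le> a \<Longrightarrow> r \<in> einterval a b \<Longrightarrow> 0 < r"
  by (metis einterval_iff ereal_less(2) le_less_trans)

lemma einterval_convexD:
  assumes "x \<in> einterval a b" "y \<in> einterval a b" "x \<le> z" "z \<le> y"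
  shows "z \<in> einterval a b"
  using assms by (meson einterval_iff ereal_less_eq(3) le_less_trans less_le_trans)

lemma convex_einterval: "convex (einterval a b)"
  unfolding is_interval_convex_1[symmetric] is_interval_1 using einterval_convexD by blast

lemma einterval_nonempty: "a < b \<Longrightarrow> \<exists>r. r \<in> einterval a b"
  using ereal_dense2[of a b] by (auto simp: einterval_iff)

text \<open>Solutions of the reduced system live on \<open>s > 0\<close>. Filling in their limit at
  0 makes them continuous up to 0, as the uniqueness statements for initial data at 0
  require.\<close>

lemma continuous_on_fill_0:
  fixes f :: "real \<Rightarrow> real"
  assumes lim: "(f \<longlongrightarrow> l) (at_right 0)" and cont: "\<And>t. t \<in> J \<Longrightarrow> 0 < t \<Longrightarrow> isCont f t"
    and J: "\<And>t. t \<in> J \<Longrightarrow> 0 \<le> t"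
  shows "continuous_on J (\<lambda>t. if t = 0 then l else f t)"
  unfolding continuous_on_eq_continuous_within
proof
  fix t assume t: "t \<in> J"
  let ?f = "\<lambda>t. if t = 0 then l else f t"
  show "continuous (at t within J) ?f"
  proof (cases "t = 0")
    case True
    have "(?f \<longlongrightarrow> l) (at_right 0)"
      by (rule Lim_transform_eventually[OF lim]) (auto simp: eventually_at_filter)
    then have "(?f \<longlongrightarrow> l) (at 0 within J)"
    proof (rule filterlim_mono)
      have "at 0 within J \<le> at 0 within {0..}" using J by (intro at_le) auto
      also have "at 0 within {0..} = at_right (0::real)"
        by (rule at_within_nhd[of 0 UNIV]) auto
      finally show "at 0 within J \<le> at_right 0" .
    qed simp
    then show ?thesis using True by (simp add: continuous_within)
  next
    case False
    then have pos: "0 < t" using J[OF t] by simp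
    have "isCont ?f t"
      by (rule isCont_cong[THEN iffD1, OF _ cont[OF t pos]])
         (rule eventually_mono[OF eventually_nhds_in_open[of "{0<..}" t]], use pos in auto)
    then show ?thesis by (rule continuous_at_imp_continuous_at_within)
  qed
qed

lemma has_real_derivative_fill_0:
  fixes f :: "real \<Rightarrow> real"
  assumes "(f has_real_derivative d) (at t)" "0 < t"
  shows "((\<lambda>t. if t = 0 then l else f t) has_real_derivative d) (at t)"
  by (rule has_field_derivative_transform_within_open[OF assms(1), of "{0<..}"]) (use assms(2) in auto)

lemma powr_neg_at_top:
  assumes "0 < c"
  shows "filterlim (\<lambda>r::real. r powr - c) at_top (at_right 0)"
proof -
  have pos: "\<forall>\<^sub>F r::real in at_right 0. 0 < r" by (rule eventually_at_right_less)
  have "((\<lambda>r::real. r powr c) \<longlongrightarrow> 0) (at_right 0)"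
    by (rule tendsto_zero_powrI[OF tendsto_ident_at tendsto_const eventually_mono[OF pos] assms]) simp
  then have "filterlim (\<lambda>r::real. inverse (r powr c)) at_top (at_right 0)"
    by (rule filterlim_inverse_at_top) (rule eventually_mono[OF pos], simp)
  then show ?thesis by (simp add: powr_minus)
qed

lemma powr_neg_at_right_0:
  assumes "0 < c"
  shows "filterlim (\<lambda>r::real. r powr - c) (at_right 0) at_top"
  unfolding filterlim_at
proof
  show "((\<lambda>r::real. r powr - c) \<longlongrightarrow> 0) at_top"
    using assms by (intro tendsto_neg_powr filterlim_ident) simp
  show "\<forall>\<^sub>F r::real in at_top. r powr - c \<in> {0<..} \<and> r powr - c \<noteq> 0"
    by (rule eventually_mono[OF eventually_gt_at_top[of 0]]) auto
qed

text \<open>A negative power reverses orientation: approaching a radius from the left means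
  approaching the corresponding \<open>s\<close> from the right.\<close>

lemma powr_neg_at_left:
  assumes "0 < c" "0 < \<rho>"
  shows "filterlim (\<lambda>r::real. r powr - c) (at_right (\<rho> powr - c)) (at_left \<rho>)"
  unfolding filterlim_at
proof
  show "((\<lambda>r. r powr - c) \<longlongrightarrow> \<rho> powr - c) (at_left \<rho>)" using assms by (intro tendsto_intros) auto
  show "\<forall>\<^sub>F r in at_left \<rho>. r powr - c \<in> {\<rho> powr - c<..} \<and> r powr - c \<noteq> \<rho> powr - c"
  proof (rule eventually_mono[OF eventually_at_left_real[OF assms(2)]])
    fix r assume "r \<in> {0<..<\<rho>}"
    then have "\<rho> powr - c < r powr - c" using assms by (intro powr_less_mono2_neg) auto
    then show "r powr - c \<in> {\<rho> powr - c<..} \<and> r powr - c \<noteq> \<rho> powr - c" by auto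
  qed
qed

lemma powr_neg_at_right:
  assumes "0 < c" "0 < \<rho>"
  shows "filterlim (\<lambda>r::real. r powr - c) (at_left (\<rho> powr - c)) (at_right \<rho>)"
  unfolding filterlim_at
proof
  show "((\<lambda>r. r powr - c) \<longlongrightarrow> \<rho> powr - c) (at_right \<rho>)" using assms by (intro tendsto_intros) auto
  show "\<forall>\<^sub>F r in at_right \<rho>. r powr - c \<in> {..<\<rho> powr - c} \<and> r powr - c \<noteq> \<rho> powr - c"
  proof (rule eventually_mono[OF eventually_at_right_less])
    fix r assume "\<rho> < r"
    then have "r powr - c < \<rho> powr - c" using assms by (intro powr_less_mono2_neg) auto
    then show "r powr - c \<in> {..<\<rho> powr - c} \<and> r powr - c \<noteq> \<rho> powr - c" by auto
  qed
qed

lemma eventually_einterval_at_right_0: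
  assumes "0 < b"
  shows "\<forall>\<^sub>F r in at_right 0. r \<in> einterval 0 b"
proof -
  obtain r1 where r1: "r1 \<in> einterval 0 b" using einterval_nonempty[OF assms] by blast
  then have "0 < r1" by (simp add: einterval_iff)
  show ?thesis
  proof (rule eventually_mono[OF eventually_at_right_real[OF \<open>0 < r1\<close>]])
    fix r assume "r \<in> {0<..<r1}"
    then have "0 < r" "r < r1" by auto
    then show "r \<in> einterval 0 b"
      using r1 by (simp add: einterval_iff) (meson ereal_less_eq(3) le_less_trans less_imp_le)
  qed
qed

lemma solution_has_derivative:
  assumes "is_solution N m p q a b u" "r \<in> einterval a b"
  shows "(u has_real_derivative deriv u r) (at r)"
proof -
  obtain D where "(u has_real_derivative D) (at r)"
    using assms unfolding is_solution_def radial_solution_def C1_differentiable_on_def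
      has_real_derivative_iff_has_vector_derivative by blast
  then show ?thesis using DERIV_imp_deriv by blast
qed

text \<open>Infinitely many pairs result from the free choice of the endpoint alone, since the first
  projection covers all positive reals.\<close>

lemma infinite_pairs:
  fixes P :: "real \<Rightarrow> 'a \<Rightarrow> bool"
  assumes "\<And>\<rho>. 0 < \<rho> \<Longrightarrow> \<exists>u. P \<rho> u"
  shows "infinite {(\<rho>, u). 0 < \<rho> \<and> P \<rho> u}"
proof
  assume "finite {(\<rho>, u). 0 < \<rho> \<and> P \<rho> u}"
  then have "finite (fst ` {(\<rho>, u). 0 < \<rho> \<and> P \<rho> u})" by (rule finite_imageI)
  moreover have "{0<..} \<subseteq> fst ` {(\<rho>, u). 0 < \<rho> \<and> P \<rho> u}" using assms by force
  ultimately show False using finite_subset infinite_Ioi by blast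
qed

lemma tendsto_imp_Bfun:
  fixes f :: "real \<Rightarrow> real"
  assumes "(f \<longlongrightarrow> l) F"
  shows "Bfun f F"
proof (rule BfunI)
  show "\<forall>\<^sub>F x in F. norm (f x) \<le> \<bar>l\<bar> + 1"
    by (rule eventually_mono[OF tendstoD[OF assms, of 1]]) (auto simp: dist_real_def)
qed

lemma tendsto_scale_at_right_0:
  fixes f :: "real \<Rightarrow> real"
  assumes "(f \<longlongrightarrow> l) (at_right 0)" "0 < k"
  shows "((\<lambda>s. c * f (k * s)) \<longlongrightarrow> c * l) (at_right (0::real))"
proof -
  have "filterlim (\<lambda>s. k * s) (at_right 0) (at_right 0)"
    unfolding filterlim_at
  proof
    show "((\<lambda>s. k * s) \<longlongrightarrow> 0) (at_right 0)" using tendsto_mult_left[OF tendsto_ident_at, of k 0] by simp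
    show "\<forall>\<^sub>F s in at_right 0. k * s \<in> {0<..} \<and> k * s \<noteq> 0"
      by (rule eventually_mono[OF eventually_at_right_less]) (use assms in auto)
  qed
  from tendsto_mult_left[OF filterlim_compose[OF assms(1) this]] show ?thesis .
qed

lemma tendsto_scale_at_top:
  fixes f :: "real \<Rightarrow> real"
  assumes "(f \<longlongrightarrow> l) at_top" "0 < k"
  shows "((\<lambda>s. c * f (k * s)) \<longlongrightarrow> c * l) (at_top :: real filter)"
proof -
  have "filterlim (\<lambda>s. k * s) at_top at_top"
    using filterlim_tendsto_pos_mult_at_top[OF tendsto_const assms(2) filterlim_ident] .
  from tendsto_mult_left[OF filterlim_compose[OF assms(1) this]] show ?thesis .
qed

lemma einterval_0_inf: "einterval 0 \<infinity> = {0<..}"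
  by (auto simp: einterval_iff)

section \<open>The reduced system\<close>

locale radial_parameters =
  fixes N :: nat and m p q :: real
  assumes m_gt_1: "1 < m" and m_less_N: "m < real N" and m_less_q: "m < q" and p_nonneg: "0 \<le> p"
begin

text \<open>The exponent for which \<open>r powr - nu\<close> is m-harmonic away from the origin; it
  is also the decay rate at infinity in the theorem.\<close>

definition nu :: real where "nu = (real N - m) / (m - 1)"
text \<open>The blow-up rate of \<open>u'\<close> at the origin. It lies in \<open>(0, 1)\<close>
  because \<open>q > m\<close>, and so \<open>Y powr - alpha\<close> remains integrable when
  \<open>Y\<close> starts linearly from 0.\<close>

definition alpha :: real where "alpha = 1 / (q + 1 - m)"
text \<open>After the substitution the factor \<open>r powr - ((nu + 1) * (q - m))\<close> is left
  over; as a power of \<open>s = r powr - nu\<close> it has exponent \<open>kappa\<close>. Being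
  positive, it gives a weight continuous at \<open>s = 0\<close>.\<close>

definition kappa :: real where "kappa = (nu + 1) * (q - m) / nu"
text \<open>Collects the constants produced by the chain rule and by differentiating the power that
  defines \<open>Y\<close>.\<close>

definition coef :: real where "coef = nu powr (q - m) * (q + 1 - m) / (m - 1)"

lemma nu_pos: "0 < nu" using m_gt_1 m_less_N by (simp add: nu_def)
lemma alpha_pos: "0 < alpha" and alpha_less_1: "alpha < 1" using m_gt_1 m_less_q by (simp_all add: alpha_def)
lemma kappa_pos: "0 < kappa" using nu_pos m_less_q by (simp add: kappa_def)
lemma coef_pos: "0 < coef" using nu_pos m_less_q m_gt_1 by (simp add: coef_def)
lemma N_eq: "real N - 1 = (nu + 1) * (m - 1)" using m_gt_1 by (simp add: nu_def field_simps)

text \<open>The rate \<open>s powr - (alpha * (kappa + 1))\<close> is used at both ends: its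
  integrability at \<open>\<infinity>\<close> bounds \<open>v\<close>, and its non-integrability at
  0 shows that \<open>Y\<close> cannot tend to 0 there.\<close>

lemma alpha_kappa: "1 < alpha * (kappa + 1)"
proof -
  have "alpha * (kappa + 1) = 1 + alpha * (kappa - (q - m))"
    using m_less_q by (simp add: alpha_def field_simps)
  moreover have "kappa - (q - m) = (q - m) / nu" using nu_pos by (simp add: kappa_def field_simps)
  moreover have "0 < alpha * ((q - m) / nu)" using alpha_pos nu_pos m_less_q by simp
  ultimately show ?thesis by simp
qed

text \<open>
  The reduced equation in the variable \<open>s = r powr - nu\<close>, for \<open>v s = u r\<close>: \<open>e = 1\<close> for solutions
  decreasing in \<open>r\<close>, \<open>e = - 1\<close> for increasing ones, and \<open>Y\<close> is \<open>\<bar>v'\<bar> powr - (1 / alpha)\<close>.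
\<close>

definition phase :: "real \<Rightarrow> real set \<Rightarrow> (real \<Rightarrow> real) \<Rightarrow> (real \<Rightarrow> real) \<Rightarrow> bool" where
  "phase e S v Y \<longleftrightarrow> (\<forall>s\<in>S. 0 < v s \<and> 0 < Y s \<and>
     (v has_real_derivative e * Y s powr - alpha) (at s) \<and>
     (Y has_real_derivative e * (coef * s powr kappa) * v s powr p) (at s))"

lemma phaseD:
  assumes "phase e S v Y" "s \<in> S"
  shows "0 < v s" "0 < Y s" "(v has_real_derivative e * Y s powr - alpha) (at s)"
    "(Y has_real_derivative e * (coef * s powr kappa) * v s powr p) (at s)"
  using assms by (auto simp: phase_def)

lemma phase_mono:
  assumes ph: "phase 1 S v Y" and sub: "\<forall>x. a \<le> x \<and> x \<le> b \<longrightarrow> x \<in> S" and ab: "a \<le> b"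
  shows "v a \<le> v b" "Y a \<le> Y b"
proof -
  have *: "0 \<le> 1 * Y x powr - alpha" "0 \<le> 1 * (coef * x powr kappa) * v x powr p" for x
    using coef_pos by simp_all
  show "v a \<le> v b" using ab phaseD(3)[OF ph] * sub
    by (intro DERIV_nonneg_imp_nondecreasing[of a b v]) blast+
  show "Y a \<le> Y b" using ab phaseD(4)[OF ph] * sub
    by (intro DERIV_nonneg_imp_nondecreasing[of a b Y]) blast+
qed

lemma phase_antimono:
  assumes ph: "phase (-1) S v Y" and sub: "\<forall>x. a \<le> x \<and> x \<le> b \<longrightarrow> x \<in> S" and ab: "a \<le> b"
  shows "v b \<le> v a" "Y b \<le> Y a"
proof -
  have *: "-1 * Y x powr - alpha \<le> 0" "-1 * (coef * x powr kappa) * v x powr p \<le> 0" for x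
    using coef_pos by simp_all
  show "v b \<le> v a" using ab phaseD(3)[OF ph] * sub
    by (intro DERIV_nonpos_imp_nonincreasing[of a b v]) blast+
  show "Y b \<le> Y a" using ab phaseD(4)[OF ph] * sub
    by (intro DERIV_nonpos_imp_nonincreasing[of a b Y]) blast+
qed

section \<open>Asymptotics of the reduced system at infinity and at 0\<close>

text \<open>Since \<open>v\<close> is nondecreasing, \<open>Y'\<close> is at least a multiple of
  \<open>s powr kappa\<close>, hence \<open>Y\<close> at least one of
  \<open>s powr (kappa + 1)\<close>, and \<open>v'\<close> is integrable. Once \<open>v\<close> is
  known to converge, the exact growth of \<open>Y\<close> follows by l'Hospital's rule.\<close>

lemma phase_at_top:
  assumes ph: "phase 1 {s0<..} v Y" and s0: "0 \<le> s0"
  shows "\<exists>u0>0. (v \<longlongrightarrow> u0) at_top \<and> ((\<lambda>s. Y s / s powr (kappa + 1)) \<longlongrightarrow> coef * u0 powr p / (kappa + 1)) at_top"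
proof -
  define s1 where "s1 = s0 + 1"
  have s1: "s0 < s1" "0 < s1" using s0 by (auto simp: s1_def)
  have mono: "v x \<le> v y" if "s0 < x" "x \<le> y" for x y
    using phase_mono[OF ph, of x y] that by auto
  \<comment> \<open>With this \<open>c\<close> the derivative of
    \<open>c * s powr (kappa + 1)\<close> is \<open>coef * s powr kappa * v s1 powr p\<close>, the
    lower bound for \<open>Y'\<close> beyond \<open>s1\<close>.\<close>
  define c where "c = coef * v s1 powr p / (kappa + 1)"
  have c: "0 < c" unfolding c_def using coef_pos kappa_pos phaseD(1)[OF ph, of s1] s1 by simp
  have Y1: "Y s1 - c * s1 powr (kappa + 1) \<le> Y s - c * s powr (kappa + 1)" if "s1 \<le> s" for s
  proof (rule DERIV_nonneg_imp_nondecreasing[OF that])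
    fix x assume x: "s1 \<le> x" "x \<le> s"
    then have x0: "s0 < x" "0 < x" using s1 by auto
    have d: "((\<lambda>s. Y s - c * s powr (kappa + 1)) has_real_derivative (coef * x powr kappa) * v x powr p - c * ((kappa + 1) * x powr kappa)) (at x)"
      using DERIV_diff[OF phaseD(4)[OF ph, of x] has_real_derivative_mult_powr[OF x0(2), of c "kappa + 1"]] x0 by simp
    have "v s1 powr p \<le> v x powr p"
      using mono[OF s1(1) x(1)] phaseD(1)[OF ph, of s1] s1 p_nonneg by (intro powr_mono2) auto
    then have "coef * x powr kappa * v s1 powr p \<le> coef * x powr kappa * v x powr p"
      using coef_pos by (intro mult_left_mono) auto
    moreover have "c * ((kappa + 1) * x powr kappa) = coef * x powr kappa * v s1 powr p"
      using kappa_pos by (simp add: c_def)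
    ultimately have "0 \<le> (coef * x powr kappa) * v x powr p - c * ((kappa + 1) * x powr kappa)" by linarith
    with d show "\<exists>y. ((\<lambda>s. Y s - c * s powr (kappa + 1)) has_real_derivative y) (at x) \<and> 0 \<le> y" by blast
  qed
  \<comment> \<open>Beyond twice \<open>s1\<close> the term \<open>c * s1 powr (kappa + 1)\<close>
    takes away at most half of \<open>c * s powr (kappa + 1)\<close>.\<close>
  define s2 where "s2 = 2 * s1"
  have s2: "s1 \<le> s2" "0 < s2" "s0 < s2" using s1 by (auto simp: s2_def)
  have Y2: "c / 2 * s powr (kappa + 1) \<le> Y s" if s: "s2 \<le> s" for s
  proof -
    have "s1 powr (kappa + 1) \<le> (s / 2) powr (kappa + 1)"
      using s s1 kappa_pos by (intro powr_mono2) (auto simp: s2_def)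
    also have "\<dots> = s powr (kappa + 1) / 2 powr (kappa + 1)" using s s2 by (simp add: powr_divide)
    also have "\<dots> \<le> s powr (kappa + 1) / 2 powr 1"
      using kappa_pos by (intro divide_left_mono powr_mono) auto
    finally have "c * s1 powr (kappa + 1) \<le> c * (s powr (kappa + 1) / 2)" using c by (intro mult_left_mono) auto
    moreover have "0 < Y s1" using phaseD(2)[OF ph, of s1] s1 by simp
    ultimately show ?thesis using Y1[of s] s s2 by (simp add: field_simps)
  qed
  define et where "et = alpha * (kappa + 1)"
  have et: "1 < et" using alpha_kappa by (simp add: et_def)
  \<comment> \<open>Chosen so that \<open>C * s powr (1 - et)\<close> decreases exactly at the rate
    that bounds \<open>v'\<close>; adding it to \<open>v\<close> gives a nonincreasing function and
    hence an upper bound for \<open>v\<close>.\<close>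
  define C where "C = (c / 2) powr - alpha / (et - 1)"
  have C: "0 < C" using c et by (simp add: C_def)
  have V: "v s + C * s powr (1 - et) \<le> v s2 + C * s2 powr (1 - et)" if "s2 \<le> s" for s
  proof (rule DERIV_nonpos_imp_nonincreasing[OF that])
    fix x assume x: "s2 \<le> x" "x \<le> s"
    then have x0: "s0 < x" "0 < x" using s2 by auto
    have d: "((\<lambda>s. v s + C * s powr (1 - et)) has_real_derivative Y x powr - alpha + C * ((1 - et) * x powr (1 - et - 1))) (at x)"
      using DERIV_add[OF phaseD(3)[OF ph, of x] has_real_derivative_mult_powr[OF x0(2), of C "1 - et"]] x0 by simp
    have "Y x powr - alpha \<le> (c / 2 * x powr (kappa + 1)) powr - alpha"
      using Y2[OF x(1)] alpha_pos c x0 by (intro powr_mono2') auto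
    moreover have "(c / 2 * x powr (kappa + 1)) powr - alpha = (c / 2) powr - alpha * x powr - et"
      using c x0 by (subst powr_mult) (auto simp: powr_powr et_def mult.commute)
    moreover have "C * ((1 - et) * x powr (1 - et - 1)) = - ((c / 2) powr - alpha * x powr - et)"
    proof -
      have "C * (1 - et) = - ((c/2) powr - alpha)" using et by (simp add: C_def field_simps)
      then show ?thesis by (simp add: mult.assoc[symmetric])
    qed
    ultimately have "Y x powr - alpha + C * ((1 - et) * x powr (1 - et - 1)) \<le> 0" by linarith
    with d show "\<exists>y. ((\<lambda>s. v s + C * s powr (1 - et)) has_real_derivative y) (at x) \<and> y \<le> 0" by blast
  qed
  have bound: "v s \<le> v s2 + C * s2 powr (1 - et)" if "s0 < s" for s
  proof (cases "s2 \<le> s")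
    case True
    then show ?thesis using V[OF True] C by (smt (verit) mult_nonneg_nonneg powr_ge_zero)
  next
    case False
    then show ?thesis using mono[OF that, of s2] C by (smt (verit) mult_nonneg_nonneg powr_ge_zero)
  qed
  obtain u0 where u0: "(v \<longlongrightarrow> u0) at_top" "\<forall>x>s0. v x \<le> u0"
    using mono_bounded_tendsto_at_top[of s0 v, OF mono bound] by blast
  have u0_pos: "0 < u0" using u0(2) s1 phaseD(1)[OF ph, of s1] by fastforce
  \<comment> \<open>This form of l'Hospital's rule asks only the denominator to diverge; the
    quotient of the derivatives is \<open>coef * v s powr p / (kappa + 1)\<close>.\<close>
  have "((\<lambda>s. Y s / s powr (kappa + 1)) \<longlongrightarrow> coef * u0 powr p / (kappa + 1)) at_top"
  proof (rule lhospital_at_top_at_top[where f'="\<lambda>s. 1 * (coef * s powr kappa) * v s powr p" and g'="\<lambda>s. (kappa + 1) * s powr kappa"])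
    have pos: "\<forall>\<^sub>F s in at_top. max 0 s0 < s" by (rule eventually_gt_at_top)
    have "\<forall>\<^sub>F s::real in at_top. s \<le> s powr (kappa + 1)"
    proof (rule eventually_mono[OF eventually_ge_at_top[of 1]])
      show "s \<le> s powr (kappa + 1)" if "1 \<le> s" for s :: real
        using powr_mono[of 1 "kappa + 1" s] that kappa_pos by simp
    qed
    then show "filterlim (\<lambda>s. s powr (kappa + 1)) at_top at_top"
      by (rule filterlim_at_top_mono[OF filterlim_ident])
    show "\<forall>\<^sub>F s in at_top. (kappa + 1) * s powr kappa \<noteq> 0" by (rule eventually_mono[OF pos]) (use kappa_pos in auto)
    show "\<forall>\<^sub>F s in at_top. (Y has_real_derivative 1 * (coef * s powr kappa) * v s powr p) (at s)"
      by (rule eventually_mono[OF pos]) (use phaseD(4)[OF ph] in auto)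
    show "\<forall>\<^sub>F s in at_top. ((\<lambda>s. s powr (kappa + 1)) has_real_derivative (kappa + 1) * s powr kappa) (at s)"
      by (rule eventually_mono[OF pos]) (use has_real_derivative_mult_powr[of _ 1 "kappa + 1"] in auto)
    have "((\<lambda>s. coef * v s powr p / (kappa + 1)) \<longlongrightarrow> coef * u0 powr p / (kappa + 1)) at_top"
      using u0(1) u0_pos kappa_pos by (intro tendsto_intros) auto
    moreover have "\<forall>\<^sub>F s in at_top. coef * v s powr p / (kappa + 1) = (1 * (coef * s powr kappa) * v s powr p) / ((kappa + 1) * s powr kappa)"
    proof (rule eventually_mono[OF pos])
      fix s :: real
      assume "max 0 s0 < s"
      then have A: "s powr kappa \<noteq> 0" by simp
      have "1 * (coef * s powr kappa) * v s powr p = coef * v s powr p * s powr kappa" by simp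
      then show "coef * v s powr p / (kappa + 1) = (1 * (coef * s powr kappa) * v s powr p) / ((kappa + 1) * s powr kappa)"
        by (simp only: nonzero_mult_divide_mult_cancel_right[OF A])
    qed
    ultimately show "((\<lambda>s. (1 * (coef * s powr kappa) * v s powr p) / ((kappa + 1) * s powr kappa)) \<longlongrightarrow> coef * u0 powr p / (kappa + 1)) at_top"
      by (rule Lim_transform_eventually)
  qed
  with u0 u0_pos show ?thesis by blast
qed

text \<open>As \<open>Y\<close> decreases, the speed \<open>Y powr - alpha\<close> at which
  \<open>v\<close> falls does not decrease, so \<open>v\<close> reaches 0 at a finite
  \<open>s\<close>. In terms of \<open>r\<close>: no solution on an interval reaching the origin is
  increasing.\<close>

lemma not_phase_decreasing_at_top:
  assumes "0 \<le> s0"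
  shows "\<not> phase (-1) {s0<..} v Y"
proof
  assume ph: "phase (-1) {s0<..} v Y"
  define s1 where "s1 = s0 + 1"
  define c where "c = Y s1 powr - alpha"
  have s1: "s0 < s1" by (simp add: s1_def)
  have c: "0 < c" using phaseD(2)[OF ph, of s1] s1 by (simp add: c_def)
  \<comment> \<open>The point where the line through \<open>(s1, v s1)\<close> with slope
    \<open>- c\<close>, which lies above \<open>v\<close>, vanishes.\<close>
  define s where "s = s1 + v s1 / c"
  have v1: "0 < v s1" using phaseD(1)[OF ph, of s1] s1 by simp
  then have s: "s1 \<le> s" using c by (simp add: s_def)
  have "v s + c * s \<le> v s1 + c * s1"
  proof (rule DERIV_nonpos_imp_nonincreasing[OF s])
    fix x assume x: "s1 \<le> x" "x \<le> s"
    then have x0: "s0 < x" using s1 by auto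
    have d: "((\<lambda>s. v s + c * s) has_real_derivative -1 * Y x powr - alpha + c) (at x)"
      using phaseD(3)[OF ph, of x] x0 by (auto intro!: derivative_eq_intros)
    have "Y x \<le> Y s1" using phase_antimono(2)[OF ph, of s1 x] x s1 by auto
    then have "c \<le> Y x powr - alpha"
      unfolding c_def using alpha_pos phaseD(2)[OF ph, of x] x0 by (intro powr_mono2') auto
    then show "\<exists>y. ((\<lambda>s. v s + c * s) has_real_derivative y) (at x) \<and> y \<le> 0" using d by - (rule exI, rule conjI, assumption, linarith)
  qed
  then have "v s \<le> 0" using c by (simp add: s_def algebra_simps)
  moreover have "0 < v s" using phaseD(1)[OF ph, of s] s s1 by simp
  ultimately show False by simp
qed

text \<open>The slope of \<open>v\<close> at \<open>s = 0\<close> is the limit of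
  \<open>r powr nu * (u r - l)\<close> at infinity; l'Hospital's rule reads it off from the limit of
  \<open>Y\<close>.\<close>

lemma phase_slope_at_0:
  assumes ph: "phase e {0<..<b} v Y" and b: "0 < b"
    and l: "(v \<longlongrightarrow> l) (at_right 0)" and y: "(Y \<longlongrightarrow> y) (at_right 0)" "0 < y"
  shows "((\<lambda>s. (v s - l) / s) \<longlongrightarrow> e * y powr - alpha) (at_right 0)"
proof (rule lhopital_right_0[where f'="\<lambda>s. e * Y s powr - alpha" and g'="\<lambda>_. 1"])
  show "((\<lambda>s. v s - l) \<longlongrightarrow> 0) (at_right 0)" using tendsto_diff[OF l tendsto_const[of l]] by simp
  have pos: "\<forall>\<^sub>F s in at_right 0. s \<in> {0<..<b}" using b by (rule eventually_at_right_real)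
  show "\<forall>\<^sub>F s in at_right 0. s \<noteq> (0::real)" by (rule eventually_mono[OF pos]) auto
  show "\<forall>\<^sub>F s in at_right 0. ((\<lambda>s. v s - l) has_real_derivative e * Y s powr - alpha) (at s)"
    by (rule eventually_mono[OF pos]) (use phaseD(3)[OF ph] in \<open>auto intro!: derivative_eq_intros\<close>)
  show "((\<lambda>s. e * Y s powr - alpha / 1) \<longlongrightarrow> e * y powr - alpha) (at_right 0)"
    using y by (auto intro!: tendsto_intros)
qed (auto intro: tendsto_ident_at)

text \<open>Monotonicity gives both limits; the point is that \<open>y\<close> is positive. If
  \<open>Y\<close> tended to 0 it would be at most a multiple of \<open>s powr (kappa + 1)\<close>,
  so \<open>v'\<close> would be at least a multiple of \<open>1 / s\<close> and \<open>v\<close>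
  would drop below 0 logarithmically.\<close>

lemma phase_increasing_at_0:
  assumes ph: "phase 1 {0<..<b} v Y" and b: "0 < b"
  shows "\<exists>l\<ge>0. \<exists>y>0. (v \<longlongrightarrow> l) (at_right 0) \<and> (Y \<longlongrightarrow> y) (at_right 0) \<and>
    ((\<lambda>s. (v s - l) / s) \<longlongrightarrow> y powr - alpha) (at_right 0) \<and> (\<forall>s. 0 < s \<longrightarrow> s < b \<longrightarrow> y \<le> Y s)"
proof -
  have mono: "v x \<le> v z" "Y x \<le> Y z" if "0 < x" "x \<le> z" "z < b" for x z
    using phase_mono[OF ph, of x z] that by auto
  have pos: "0 \<le> v x" "0 \<le> Y x" if "0 < x" "x < b" for x
    using phaseD(1,2)[OF ph, of x] that by auto
  obtain l where l: "0 \<le> l" "(v \<longlongrightarrow> l) (at_right 0)"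
    using mono_bounded_tendsto_at_right[of 0 b v 0, OF b mono(1) pos(1)] by blast
  obtain y where y: "0 \<le> y" "(Y \<longlongrightarrow> y) (at_right 0)" "\<forall>x. 0 < x \<longrightarrow> x < b \<longrightarrow> y \<le> Y x"
    using mono_bounded_tendsto_at_right[of 0 b Y 0, OF b mono(2) pos(2)] by blast
  have "y \<noteq> 0"
  proof
    assume y0: "y = 0"
    \<comment> \<open>Staying below 1 makes \<open>s powr - (alpha * (kappa + 1))\<close> at least
      \<open>1 / s\<close>.\<close>
    define s1 where "s1 = min 1 (b / 2)"
    have s1: "0 < s1" "s1 < b" "s1 \<le> 1" using b by (auto simp: s1_def)
    have v1: "0 < v s1" using phaseD(1)[OF ph, of s1] s1 by simp
    define c where "c = coef * v s1 powr p / (kappa + 1)"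
    have c: "0 < c" unfolding c_def using coef_pos kappa_pos v1 by simp
    \<comment> \<open>Nondecreasing, and with limit 0 at 0 because \<open>y = 0\<close> is supposed;
      it is therefore nonnegative, which is the upper bound for \<open>Y\<close>.\<close>
    define f where "f s = c * s powr (kappa + 1) - Y s" for s
    have fmono: "f x \<le> f z" if xz: "0 < x" "x \<le> z" "z < s1" for x z
    proof (rule DERIV_nonneg_imp_nondecreasing[OF xz(2)])
      fix r assume r: "x \<le> r" "r \<le> z"
      then have r0: "0 < r" "r \<le> s1" "r < b" using xz s1 by auto
      have d: "(f has_real_derivative c * ((kappa + 1) * r powr kappa) - (coef * r powr kappa) * v r powr p) (at r)"
        unfolding f_def
        using DERIV_diff[OF has_real_derivative_mult_powr[OF r0(1), of c "kappa + 1"] phaseD(4)[OF ph, of r]] r0 by simp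
      have "v r powr p \<le> v s1 powr p"
        using mono(1)[of r s1] r0 s1 pos(1)[of r] p_nonneg by (intro powr_mono2) auto
      then have "coef * r powr kappa * v r powr p \<le> coef * r powr kappa * v s1 powr p"
        using coef_pos by (intro mult_left_mono) auto
      moreover have "c * ((kappa + 1) * r powr kappa) = coef * r powr kappa * v s1 powr p"
        using kappa_pos by (simp add: c_def)
      ultimately show "\<exists>y. (f has_real_derivative y) (at r) \<and> 0 \<le> y" using d by - (rule exI, rule conjI, assumption, linarith)
    qed
    have "((\<lambda>s. s powr (kappa + 1)) \<longlongrightarrow> 0) (at_right (0::real))"
      using kappa_pos by (intro tendsto_zero_powrI[of _ _ _ "kappa + 1"] tendsto_ident_at tendsto_const)
         (auto intro: eventually_mono[OF eventually_at_right_less])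
    then have "((\<lambda>s. c * s powr (kappa + 1)) \<longlongrightarrow> c * 0) (at_right 0)"
      by (rule tendsto_mult_left)
    then have f0: "(f \<longlongrightarrow> 0) (at_right 0)"
      unfolding f_def using tendsto_diff[OF _ y(2), of "\<lambda>s. c * s powr (kappa + 1)" "c * 0"] y0 by simp
    have f_nonneg: "0 \<le> f s" if s: "0 < s" "s < s1" for s
    proof (rule tendsto_upperbound[OF f0])
      show "\<forall>\<^sub>F x in at_right 0. f x \<le> f s"
        using fmono s by (intro eventually_at_rightI[of 0 s]) auto
    qed auto
    define C where "C = c powr - alpha"
    have C: "0 < C" using c by (simp add: C_def)
    define s2 where "s2 = s1 / 2"
    have s2: "0 < s2" "s2 < s1" using s1 by (auto simp: s2_def)
    \<comment> \<open>The point where the logarithmic upper bound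
      \<open>v s2 + C * (ln s - ln s2)\<close> for \<open>v s\<close> becomes 0.\<close>
    define s where "s = s2 * exp (- v s2 / C)"
    have v2: "0 < v s2" using phaseD(1)[OF ph, of s2] s1 s2 by simp
    have s: "0 < s" "s \<le> s2" using s2 v2 C by (auto simp: s_def mult_le_cancel_left1)
    have "v s - C * ln s \<le> v s2 - C * ln s2"
    proof (rule DERIV_nonneg_imp_nondecreasing[OF s(2)])
      fix x assume x: "s \<le> x" "x \<le> s2"
      then have x0: "0 < x" "x < s1" "x < b" "x \<le> 1" using s s1 s2 by auto
      have d: "((\<lambda>s. v s - C * ln s) has_real_derivative Y x powr - alpha - C * (1 / x)) (at x)"
        using phaseD(3)[OF ph, of x] x0 by (auto intro!: derivative_eq_intros)
      have "Y x \<le> c * x powr (kappa + 1)" using f_nonneg[of x] x0 by (simp add: f_def)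
      then have "(c * x powr (kappa + 1)) powr - alpha \<le> Y x powr - alpha"
        using phaseD(2)[OF ph, of x] x0 alpha_pos by (intro powr_mono2') auto
      moreover have "(c * x powr (kappa + 1)) powr - alpha = C * x powr - (alpha * (kappa + 1))"
        using c x0 by (subst powr_mult) (auto simp: powr_powr C_def mult.commute)
      moreover have "x powr - 1 \<le> x powr - (alpha * (kappa + 1))"
        using x0 alpha_kappa by (intro powr_mono') auto
      then have "C * (1 / x) \<le> C * x powr - (alpha * (kappa + 1))"
        using C x0 by (intro mult_left_mono) (auto simp: powr_minus_divide)
      ultimately show "\<exists>y. ((\<lambda>s. v s - C * ln s) has_real_derivative y) (at x) \<and> 0 \<le> y" using d by - (rule exI, rule conjI, assumption, linarith)
    qed
    moreover have "ln s = ln s2 - v s2 / C" using s2 by (simp add: s_def ln_mult)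
    ultimately have "v s \<le> 0" using C by (simp add: algebra_simps)
    moreover have "0 < v s" using phaseD(1)[OF ph, of s] s s1 s2 by simp
    ultimately show False by simp
  qed
  then have "0 < y" using y by simp
  then show ?thesis using l y phase_slope_at_0[OF ph b l(2) y(2)] by auto
qed

text \<open>Toward 0 both unknowns grow, so positivity of the limits is automatic and only
  boundedness is at stake. There \<open>Y\<close> is at least \<open>Y s1\<close>, which bounds
  \<open>v'\<close> and hence \<open>v\<close>; a bounded \<open>v\<close> in turn bounds
  \<open>Y'\<close>.\<close>

lemma phase_decreasing_at_0:
  assumes ph: "phase (-1) {0<..<b} v Y" and b: "0 < b"
  shows "\<exists>l\<ge>0. \<exists>y>0. (v \<longlongrightarrow> l) (at_right 0) \<and> (Y \<longlongrightarrow> y) (at_right 0) \<and>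
    ((\<lambda>s. (v s - l) / s) \<longlongrightarrow> - (y powr - alpha)) (at_right 0)"
proof -
  define s1 where "s1 = b / 2"
  have s1: "0 < s1" "s1 < b" using b by (auto simp: s1_def)
  have anti: "v z \<le> v x" "Y z \<le> Y x" if "0 < x" "x \<le> z" "z < b" for x z
    using phase_antimono[OF ph, of x z] that by auto
  have pos: "0 < v x" "0 < Y x" if "0 < x" "x < b" for x
    using phaseD(1,2)[OF ph, of x] that by auto
  define C where "C = Y s1 powr - alpha"
  define M where "M = v s1 + C * s1"
  have C: "0 \<le> C" by (simp add: C_def)
  have vM: "v x \<le> M" if x: "0 < x" "x < s1" for x
  proof -
    have "v x + C * x \<le> v s1 + C * s1"
    proof (rule DERIV_nonneg_imp_nondecreasing[of x s1 "\<lambda>x. v x + C * x"])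
      fix r assume r: "x \<le> r" "r \<le> s1"
      then have r0: "0 < r" "r < b" using x s1 by auto
      have d: "((\<lambda>x. v x + C * x) has_real_derivative -1 * Y r powr - alpha + C) (at r)"
        using phaseD(3)[OF ph, of r] r0 by (auto intro!: derivative_eq_intros)
      have "Y r powr - alpha \<le> C"
        unfolding C_def using anti(2)[of r s1] r r0 s1 pos alpha_pos by (intro powr_mono2') auto
      then show "\<exists>y. ((\<lambda>x. v x + C * x) has_real_derivative y) (at r) \<and> 0 \<le> y" using d by - (rule exI, rule conjI, assumption, linarith)
    qed (use x in auto)
    moreover have "0 \<le> C * x" using C x by simp
    ultimately show ?thesis by (simp add: M_def)
  qed
  define B where "B = coef * s1 powr kappa * M powr p"
  have B: "0 \<le> B" using coef_pos by (simp add: B_def)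
  have YM: "Y x \<le> Y s1 + B * s1" if x: "0 < x" "x < s1" for x
  proof -
    have "Y x + B * x \<le> Y s1 + B * s1"
    proof (rule DERIV_nonneg_imp_increasing_open[of x s1 "\<lambda>x. Y x + B * x"])
      fix r assume r: "x < r" "r < s1"
      then have r0: "0 < r" "r < b" using x s1 by auto
      have d: "((\<lambda>x. Y x + B * x) has_real_derivative -1 * (coef * r powr kappa) * v r powr p + B) (at r)"
        using phaseD(4)[OF ph, of r] r0 by (auto intro!: derivative_eq_intros)
      have "coef * r powr kappa * v r powr p \<le> B"
        unfolding B_def using r r0 vM[of r] pos[of r] p_nonneg kappa_pos coef_pos
        by (intro mult_mono powr_mono2) auto
      then show "\<exists>y. ((\<lambda>x. Y x + B * x) has_real_derivative y) (at r) \<and> 0 \<le> y" using d by - (rule exI, rule conjI, assumption, linarith)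
    next
      have "isCont Y r" if "r \<in> {x..s1}" for r
        using phaseD(4)[OF ph, of r] that x s1 by (auto intro: DERIV_isCont)
      then show "continuous_on {x..s1} (\<lambda>x. Y x + B * x)"
        by (intro continuous_intros continuous_at_imp_continuous_on) auto
    qed (use x in auto)
    moreover have "0 \<le> B * x" using B x by simp
    ultimately show ?thesis by simp
  qed
  \<comment> \<open>The monotone limit statement is for nondecreasing functions, so it is applied to
    \<open>- v\<close> and \<open>- Y\<close>.\<close>
  obtain l where l: "((\<lambda>s. - v s) \<longlongrightarrow> l) (at_right 0)" "\<forall>x. 0 < x \<longrightarrow> x < s1 \<longrightarrow> l \<le> - v x"
    using mono_bounded_tendsto_at_right[of 0 s1 "\<lambda>s. - v s" "- M", OF s1(1)] anti(1) vM s1 by fastforce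
  obtain y where y: "((\<lambda>s. - Y s) \<longlongrightarrow> y) (at_right 0)" "\<forall>x. 0 < x \<longrightarrow> x < s1 \<longrightarrow> y \<le> - Y x"
    using mono_bounded_tendsto_at_right[of 0 s1 "\<lambda>s. - Y s" "- (Y s1 + B * s1)", OF s1(1)] anti(2) YM s1 by fastforce
  have lim: "(v \<longlongrightarrow> - l) (at_right 0)" "(Y \<longlongrightarrow> - y) (at_right 0)"
    using tendsto_minus[OF l(1)] tendsto_minus[OF y(1)] by auto
  have "0 < s1 / 2" "s1 / 2 < s1" using s1 by auto
  then have "0 < - l" "0 < - y" using l(2) y(2) pos[of "s1/2"] s1 by fastforce+
  then show ?thesis using lim phase_slope_at_0[OF ph b lim]
    by (intro exI[of _ "- l"] conjI exI[of _ "- y"]) auto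
qed

lemma inverse_alpha: "1 / alpha = q + 1 - m"
  by (simp add: alpha_def)

text \<open>This identity fixes \<open>alpha\<close>: differentiating the flux
  \<open>Y powr - (alpha * (m - 1))\<close> lowers its exponent by 1, and the result must match the
  source term \<open>Y powr - (alpha * q)\<close>.\<close>

lemma alpha_exponent: "alpha * (m - 1) + 1 = alpha * q"
  using m_less_q by (simp add: alpha_def field_simps)

lemma coef_alpha: "alpha * (m - 1) * coef = nu powr (q - m)"
  using m_less_q m_gt_1 by (simp add: alpha_def coef_def)

lemma nu_kappa: "nu * kappa = (nu + 1) * (q - m)"
  using nu_pos by (simp add: kappa_def)

section \<open>Radial solutions and the reduced system\<close>

text \<open>In \<open>r powr (real N - 1)\<close> times the flux all powers of \<open>r\<close>
  cancel because \<open>(nu + 1) * (m - 1) = real N - 1\<close>. What remains is a multiple of a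
  power of \<open>Y\<close>, differentiable by the reduced equation.\<close>

lemma phase_imp_solution:
  assumes ab: "0 \<le> a" "a < b" and e: "e = 1 \<or> e = -1" and ph: "phase e S v Y"
    and S: "\<And>r. r \<in> einterval a b \<Longrightarrow> r powr - nu \<in> S"
    and u: "\<And>r. r \<in> einterval a b \<Longrightarrow> u r = v (r powr - nu)"
  shows "is_solution N m p q a b u"
    and "\<And>r. r \<in> einterval a b \<Longrightarrow> deriv u r = - (e * (nu * r powr - (nu + 1) * Y (r powr - nu) powr - alpha))"
proof -
  let ?I = "einterval a b"
  have pos: "0 < r" if "r \<in> ?I" for r using einterval_subset_pos[OF ab(1) that] .
  have s: "((\<lambda>r. r powr - nu) has_real_derivative - (nu * r powr - (nu + 1))) (at r)" if "r \<in> ?I" for r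
    by (rule DERIV_cong[OF has_real_derivative_powr[OF pos[OF that], of "- nu"]]) simp
  have vY: "0 < v (r powr - nu)" "0 < Y (r powr - nu)"
    "((\<lambda>r. v (r powr - nu)) has_real_derivative (e * Y (r powr - nu) powr - alpha) * - (nu * r powr - (nu + 1))) (at r)"
    "((\<lambda>r. Y (r powr - nu)) has_real_derivative (e * (coef * (r powr - nu) powr kappa) * v (r powr - nu) powr p) * - (nu * r powr - (nu + 1))) (at r)"
    if r: "r \<in> ?I" for r
    using phaseD[OF ph S[OF r]] DERIV_chain2[OF _ s[OF r]] by blast+
  define D where "D r = - (e * (nu * r powr - (nu + 1) * Y (r powr - nu) powr - alpha))" for r
  have uD: "(u has_real_derivative D r) (at r)" if r: "r \<in> ?I" for r
  proof -
    have "((\<lambda>r. v (r powr - nu)) has_real_derivative D r) (at r)" using vY(3)[OF r] by (simp add: D_def mult_ac)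
    then show ?thesis
      by (rule has_field_derivative_transform_within_open[OF _ open_einterval r]) (simp add: u)
  qed
  then have du: "deriv u r = D r" if "r \<in> ?I" for r using that DERIV_imp_deriv by blast
  then show "deriv u r = - (e * (nu * r powr - (nu + 1) * Y (r powr - nu) powr - alpha))" if "r \<in> ?I" for r
    using that by (simp add: D_def)
  have cv: "continuous_on ?I (\<lambda>r. v (r powr - nu))" and cY: "continuous_on ?I (\<lambda>r. Y (r powr - nu))"
    using vY(3,4) by (meson DERIV_isCont continuous_at_imp_continuous_on)+
  have nz: "r \<noteq> 0" "Y (r powr - nu) \<noteq> 0" "v (r powr - nu) \<noteq> 0" if "r \<in> ?I" for r
    using pos[OF that] vY(1,2)[OF that] by auto
  have cD: "continuous_on ?I D" unfolding D_def using cY nz by (intro continuous_intros) auto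
  have C1u: "u C1_differentiable_on ?I"
    unfolding C1_differentiable_on_def using uD cD by (auto simp: has_real_derivative_iff_has_vector_derivative)
  have absD: "\<bar>D r\<bar> = nu * r powr - (nu + 1) * Y (r powr - nu) powr - alpha" if "r \<in> ?I" for r
    using e nu_pos by (auto simp: D_def abs_mult)
  \<comment> \<open>The value of \<open>r powr (real N - 1) * flux m u r\<close>; its derivative
    \<open>G'\<close> below is the source term of the radial equation.\<close>
  define G where "G r = - e * nu powr (m - 1) * Y (r powr - nu) powr - (alpha * (m - 1))" for r
  have fluxG: "flux m u r = r powr (1 - real N) * G r" if r: "r \<in> ?I" for r
  proof -
    define A where "A = nu * r powr - (nu + 1) * Y (r powr - nu) powr - alpha"
    have A: "0 < A" using nu_pos pos[OF r] vY(2)[OF r] by (simp add: A_def)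
    have "flux m u r = A powr (m - 2) * (- e * A)"
      unfolding flux_def du[OF r] absD[OF r] by (simp add: A_def D_def)
    also have "\<dots> = - e * (A powr (m - 2) * A powr 1)" using A by simp
    also have "A powr (m - 2) * A powr 1 = A powr (m - 1)" by (simp only: powr_add[symmetric]) simp
    also have "A powr (m - 1) = nu powr (m - 1) * r powr (- (nu + 1) * (m - 1)) * Y (r powr - nu) powr (- alpha * (m - 1))"
      unfolding A_def using nu_pos pos[OF r] vY(2)[OF r] by (simp add: powr_mult powr_powr)
    also have "- (nu + 1) * (m - 1) = 1 - real N" by (simp only: mult_minus_left N_eq[symmetric])
    finally show ?thesis by (simp add: G_def mult_ac)
  qed
  define G' where "G' r = - (nu powr q * r powr - ((nu + 1) * (1 + q - m)) * v (r powr - nu) powr p * Y (r powr - nu) powr - (alpha * q))" for r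
  have GG': "(G has_real_derivative G' r) (at r)" if r: "r \<in> ?I" for r
  proof -
    define y where "y = Y (r powr - nu)"
    define w where "w = v (r powr - nu)"
    have y: "0 < y" using vY(2)[OF r] by (simp add: y_def)
    have rp: "0 < r" using pos[OF r] .
    have "((\<lambda>r. Y (r powr - nu) powr - (alpha * (m - 1))) has_real_derivative
        (- (alpha * (m - 1)) * y powr (- (alpha * (m - 1)) - 1)) * ((e * (coef * (r powr - nu) powr kappa) * w powr p) * - (nu * r powr - (nu + 1)))) (at r)"
      unfolding y_def w_def
      by (rule DERIV_chain2[OF _ vY(4)[OF r], of "\<lambda>y. y powr - (alpha * (m - 1))"])
         (rule has_real_derivative_powr[OF vY(2)[OF r]])
    from DERIV_cmult[OF this, of "- e * nu powr (m - 1)"]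
    have d: "(G has_real_derivative - e * nu powr (m - 1) * ((- (alpha * (m - 1)) * y powr (- (alpha * (m - 1)) - 1)) * ((e * (coef * (r powr - nu) powr kappa) * w powr p) * - (nu * r powr - (nu + 1))))) (at r)"
      unfolding G_def .
    \<comment> \<open>Rearranged into separate factors: the signs give \<open>e * e = 1\<close>, the
      constants \<open>nu powr q\<close>, and the powers of \<open>r\<close> and of \<open>Y\<close>
      are simplified one by one.\<close>
    have 1: "- e * nu powr (m - 1) * ((- (alpha * (m - 1)) * y powr (- (alpha * (m - 1)) - 1)) * ((e * (coef * (r powr - nu) powr kappa) * w powr p) * - (nu * r powr - (nu + 1))))
      = - ((e * e) * (alpha * (m - 1) * coef * (nu powr (m - 1) * nu)) * ((r powr - nu) powr kappa * r powr - (nu + 1)) * w powr p * y powr (- (alpha * (m - 1)) - 1))"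
      by (simp add: algebra_simps)
    have 2: "e * e = 1" using e by auto
    have 3: "alpha * (m - 1) * coef * (nu powr (m - 1) * nu) = nu powr q"
    proof -
      have "alpha * (m - 1) * coef * (nu powr (m - 1) * nu) = nu powr (q - m) * (nu powr (m - 1) * nu powr 1)"
        unfolding coef_alpha using nu_pos by simp
      also have "\<dots> = nu powr q" by (simp only: powr_add[symmetric]) simp
      finally show ?thesis .
    qed
    have 4: "(r powr - nu) powr kappa * r powr - (nu + 1) = r powr - ((nu + 1) * (1 + q - m))"
    proof -
      have "(r powr - nu) powr kappa = r powr - ((nu + 1) * (q - m))" by (simp add: powr_powr nu_kappa)
      then show ?thesis by (simp only: powr_add[symmetric]) (simp add: algebra_simps)
    qed
    have 5: "- (alpha * (m - 1)) - 1 = - (alpha * q)" using alpha_exponent by simp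
    show ?thesis unfolding G'_def y_def[symmetric] w_def[symmetric]
      using d[unfolded 1, unfolded 2 3 4 5 mult_1] .
  qed
  have fd: "((\<lambda>r. r powr (1 - real N) * G r) has_real_derivative
      ((1 - real N) * r powr (1 - real N - 1)) * G r + G' r * r powr (1 - real N)) (at r)" if r: "r \<in> ?I" for r
    by (rule DERIV_mult[OF has_real_derivative_powr[OF pos[OF r]] GG'[OF r]])
  have flux_d: "(flux m u has_real_derivative ((1 - real N) * r powr (1 - real N - 1)) * G r + G' r * r powr (1 - real N)) (at r)"
    if r: "r \<in> ?I" for r
    by (rule has_field_derivative_transform_within_open[OF fd[OF r] open_einterval r]) (simp add: fluxG)
  have cG: "continuous_on ?I G" using GG' by (meson DERIV_isCont continuous_at_imp_continuous_on)
  have cG': "continuous_on ?I G'" unfolding G'_def using cY cv nz by (intro continuous_intros) auto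
  have "continuous_on ?I (\<lambda>r. ((1 - real N) * r powr (1 - real N - 1)) * G r + G' r * r powr (1 - real N))"
    using cG cG' nz by (intro continuous_intros) auto
  with flux_d have C1f: "flux m u C1_differentiable_on ?I"
    unfolding C1_differentiable_on_def has_real_derivative_iff_has_vector_derivative
    by (intro exI[of _ "\<lambda>r. ((1 - real N) * r powr (1 - real N - 1)) * G r + G' r * r powr (1 - real N)"]) blast
  have eqn: "r powr (1 - real N) * deriv (\<lambda>s. s powr (real N - 1) * flux m u s) r + u r powr p * \<bar>deriv u r\<bar> powr q = 0"
    if r: "r \<in> ?I" for r
  proof -
    have "s powr (real N - 1) * flux m u s = G s" if "s \<in> ?I" for s
    proof -
      have "s powr (real N - 1) * (s powr (1 - real N) * G s) = G s"
        using pos[OF that] by (simp add: mult.assoc[symmetric] powr_add[symmetric])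
      then show ?thesis using fluxG[OF that] by simp
    qed
    then have "((\<lambda>s. s powr (real N - 1) * flux m u s) has_real_derivative G' r) (at r)"
      using has_field_derivative_transform_within_open[OF GG'[OF r] open_einterval r] by simp
    then have 1: "deriv (\<lambda>s. s powr (real N - 1) * flux m u s) r = G' r" by (rule DERIV_imp_deriv)
    have "\<bar>deriv u r\<bar> powr q = nu powr q * r powr (- (nu + 1) * q) * Y (r powr - nu) powr (- alpha * q)"
      unfolding du[OF r] absD[OF r] using nu_pos pos[OF r] vY(2)[OF r] by (simp add: powr_mult powr_powr)
    moreover have "r powr (1 - real N) * r powr - ((nu + 1) * (1 + q - m)) = r powr (- (nu + 1) * q)"
    proof -
      have "1 - real N = - ((nu + 1) * (m - 1))" using N_eq by simp
      then show ?thesis by (simp only: powr_add[symmetric]) (simp add: algebra_simps)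
    qed
    ultimately show ?thesis unfolding 1 G'_def u[OF r] by (simp add: algebra_simps)
  qed
  have "\<not> u constant_on ?I"
  proof
    assume "u constant_on ?I"
    then obtain c where c: "\<And>r. r \<in> ?I \<Longrightarrow> u r = c" unfolding constant_on_def by blast
    obtain r where r: "r \<in> ?I" using einterval_nonempty[OF ab(2)] by blast
    have "(u has_real_derivative 0) (at r)"
      by (rule has_field_derivative_transform_within_open[OF DERIV_const open_einterval r, of c]) (simp add: c)
    then have "D r = 0" using uD[OF r] DERIV_unique by blast
    then show False using absD[OF r] nu_pos pos[OF r] vY(2)[OF r] by simp
  qed
  moreover have "0 < u r" if "r \<in> ?I" for r using u[OF that] vY(1)[OF that] by simp
  ultimately show "is_solution N m p q a b u"
    unfolding is_solution_def radial_solution_def using ab C1u C1f eqn by blast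
qed

text \<open>Because \<open>q > m\<close>, the factor \<open>|u'| powr q\<close> splits into
  \<open>|u'| powr (q - m + 1)\<close>, bounded on compact intervals, and
  \<open>|u'| powr (m - 1)\<close>, the modulus of the flux. The square of the weighted flux thus
  satisfies Gronwall's hypothesis, and one critical point forces \<open>u\<close> to be
  constant.\<close>

lemma solution_deriv_nonzero:
  assumes sol: "is_solution N m p q a b u" and r: "r \<in> einterval a b"
  shows "deriv u r \<noteq> 0"
proof
  assume zero: "deriv u r = 0"
  let ?I = "einterval a b"
  have a: "0 \<le> a" and C1u: "u C1_differentiable_on ?I" and C1f: "flux m u C1_differentiable_on ?I"
    and eqn: "\<And>r. r \<in> ?I \<Longrightarrow> r powr (1 - real N) * deriv (\<lambda>s. s powr (real N - 1) * flux m u s) r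
          + u r powr p * \<bar>deriv u r\<bar> powr q = 0"
    and upos: "\<And>r. r \<in> ?I \<Longrightarrow> 0 < u r" and nc: "\<not> u constant_on ?I"
    using sol unfolding is_solution_def radial_solution_def by blast+
  have pos: "0 < r" if "r \<in> ?I" for r using einterval_subset_pos[OF a that] .
  obtain D where D: "\<And>r. r \<in> ?I \<Longrightarrow> (u has_real_derivative D r) (at r)" "continuous_on ?I D"
    using C1u unfolding C1_differentiable_on_def has_real_derivative_iff_has_vector_derivative by blast
  obtain F where F: "\<And>r. r \<in> ?I \<Longrightarrow> (flux m u has_real_derivative F r) (at r)"
    using C1f unfolding C1_differentiable_on_def has_real_derivative_iff_has_vector_derivative by blast
  have du: "deriv u r = D r" if "r \<in> ?I" for r using D(1)[OF that] by (rule DERIV_imp_deriv)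
  define W where "W s = s powr (real N - 1) * flux m u s" for s
  have Wd: "(W has_real_derivative deriv W r) (at r)" if r: "r \<in> ?I" for r
    unfolding W_def
    using DERIV_mult[OF has_real_derivative_powr[OF pos[OF r]] F[OF r]]
    by (metis DERIV_imp_deriv)
  have W': "deriv W r = - (u r powr p * \<bar>D r\<bar> powr (q - m + 1)) * (r powr (real N - 1) * \<bar>D r\<bar> powr (m - 1))" if r: "r \<in> ?I" for r
  proof -
    have "r powr (real N - 1) * (r powr (1 - real N) * deriv W r) = - (r powr (real N - 1) * (u r powr p * \<bar>D r\<bar> powr q))"
      using eqn[OF r] du[OF r] unfolding W_def[abs_def] by (simp add: eq_neg_iff_add_eq_0[symmetric])
    moreover have "r powr (real N - 1) * (r powr (1 - real N) * deriv W r) = deriv W r"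
      using pos[OF r] by (simp add: mult.assoc[symmetric] powr_add[symmetric])
    moreover have "\<bar>D r\<bar> powr q = \<bar>D r\<bar> powr (q - m + 1) * \<bar>D r\<bar> powr (m - 1)"
      by (simp add: powr_add[symmetric])
    ultimately show ?thesis by (simp add: mult_ac)
  qed
  have absW: "\<bar>W r\<bar> = r powr (real N - 1) * \<bar>D r\<bar> powr (m - 1)" if r: "r \<in> ?I" for r
  proof (cases "D r = 0")
    case False
    have "\<bar>D r\<bar> powr (m - 2) * \<bar>D r\<bar> = \<bar>D r\<bar> powr (m - 2) * \<bar>D r\<bar> powr 1" by simp
    also have "\<dots> = \<bar>D r\<bar> powr (m - 1)" by (simp only: powr_add[symmetric]) simp
    finally show ?thesis by (simp add: W_def flux_def du[OF r] abs_mult)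
  qed (simp add: W_def flux_def du[OF r])
  have Dzero: "D x = 0" if x: "x \<in> ?I" for x
  proof -
    define a' where "a' = min r x"
    define b' where "b' = max r x"
    have sub: "z \<in> ?I" if "z \<in> {a'..b'}" for z
      using einterval_convexD[OF r x, of z] einterval_convexD[OF x r, of z] that
      by (auto simp: a'_def b'_def split: if_splits simp: min_def max_def)
    have csub: "{a'..b'} \<subseteq> ?I" using sub by blast
    have cu: "continuous_on {a'..b'} u" by (rule continuous_at_imp_continuous_on) (use D(1) sub DERIV_isCont in blast)
    have cW: "continuous_on {a'..b'} W" by (rule continuous_at_imp_continuous_on) (use Wd sub DERIV_isCont in blast)
    have cD: "continuous_on {a'..b'} D" using D(2) csub by (rule continuous_on_subset)
    have "continuous_on {a'..b'} (\<lambda>x. u x powr p * \<bar>D x\<bar> powr (q - m + 1))"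
    proof (rule continuous_on_mult)
      show "continuous_on {a'..b'} (\<lambda>x. \<bar>D x\<bar> powr (q - m + 1))"
        by (rule continuous_on_powr') (use cD m_less_q in \<open>auto intro!: continuous_intros\<close>)
      have "\<forall>x\<in>{a'..b'}. u x \<noteq> 0" using upos sub by fastforce
      then show "continuous_on {a'..b'} (\<lambda>x. u x powr p)" using cu by (intro continuous_on_powr continuous_on_const)
    qed
    then have "bounded ((\<lambda>x. u x powr p * \<bar>D x\<bar> powr (q - m + 1)) ` {a'..b'})"
      by (intro compact_imp_bounded compact_continuous_image) auto
    then obtain C where C: "\<forall>x\<in>{a'..b'}. u x powr p * \<bar>D x\<bar> powr (q - m + 1) \<le> C"
      by (auto simp: bounded_iff abs_le_iff)
    have "W x ^ 2 = 0"
    proof (rule gronwall_zero[where f="\<lambda>x. W x ^ 2" and a=a' and b=b' and c=r and x=x and f'="\<lambda>x. 2 * W x * deriv W x" and C="2 * C"])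
      show "continuous_on {a'..b'} (\<lambda>x. (W x)\<^sup>2)" using cW by (intro continuous_intros)
      fix z assume z: "a' < z" "z < b'"
      then have zI: "z \<in> ?I" using sub by auto
      show "((\<lambda>x. (W x)\<^sup>2) has_real_derivative 2 * W z * deriv W z) (at z)"
        using Wd[OF zI] by (auto intro!: derivative_eq_intros)
      have "\<bar>2 * W z * deriv W z\<bar> = 2 * (u z powr p * \<bar>D z\<bar> powr (q - m + 1)) * (\<bar>W z\<bar> * \<bar>W z\<bar>)"
        unfolding W'[OF zI] absW[OF zI, symmetric] by (simp add: abs_mult)
      also have "\<bar>W z\<bar> * \<bar>W z\<bar> = (W z)\<^sup>2" by (simp add: power2_eq_square)
      also have "2 * (u z powr p * \<bar>D z\<bar> powr (q - m + 1)) * (W z)\<^sup>2 \<le> 2 * C * (W z)\<^sup>2"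
        using C z by (intro mult_right_mono) auto
      finally show "\<bar>2 * W z * deriv W z\<bar> \<le> 2 * C * (W z)\<^sup>2" .
    qed (use zero in \<open>auto simp: a'_def b'_def W_def flux_def\<close>)
    then have "\<bar>D x\<bar> powr (m - 1) = 0" using absW[OF x] pos[OF x] by simp
    then show ?thesis by simp
  qed
  have "u constant_on ?I"
  proof -
    have "u x = u r" if x: "x \<in> ?I" for x
    proof -
      have "\<exists>c. \<forall>x\<in>?I. u x = c"
        by (rule has_field_derivative_zero_constant[OF convex_einterval])
           (use D(1) Dzero has_field_derivative_at_within in force)
      then show ?thesis using x r by metis
    qed
    then show ?thesis unfolding constant_on_def by blast
  qed
  with nc show False by blast
qed

text \<open>\<open>u'\<close> is a priori only continuous, whereas the flux is of class
  \<open>C1\<close>. \<open>Y\<close> is therefore built from the weighted flux \<open>P\<close>,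
  which can be differentiated with the radial equation.\<close>

lemma solution_imp_phase:
  assumes sol: "is_solution N m p q a b u"
  shows "\<exists>e Y. (e = 1 \<or> e = -1) \<and> phase e {s. 0 < s \<and> s powr - (1 / nu) \<in> einterval a b} (\<lambda>s. u (s powr - (1 / nu))) Y \<and>
    (\<forall>r\<in>einterval a b. deriv u r = - (e * (nu * r powr - (nu + 1) * Y (r powr - nu) powr - alpha)))"
proof -
  let ?I = "einterval a b"
  have ab: "0 \<le> a" "a < b" and C1u: "u C1_differentiable_on ?I" and C1f: "flux m u C1_differentiable_on ?I"
    and eqn: "\<And>r. r \<in> ?I \<Longrightarrow> r powr (1 - real N) * deriv (\<lambda>s. s powr (real N - 1) * flux m u s) r
          + u r powr p * \<bar>deriv u r\<bar> powr q = 0"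
    and upos: "\<And>r. r \<in> ?I \<Longrightarrow> 0 < u r"
    using sol unfolding is_solution_def radial_solution_def by blast+
  have pos: "0 < r" if "r \<in> ?I" for r using einterval_subset_pos[OF ab(1) that] .
  obtain D where D: "\<And>r. r \<in> ?I \<Longrightarrow> (u has_real_derivative D r) (at r)" "continuous_on ?I D"
    using C1u unfolding C1_differentiable_on_def has_real_derivative_iff_has_vector_derivative by blast
  obtain F where F: "\<And>r. r \<in> ?I \<Longrightarrow> (flux m u has_real_derivative F r) (at r)"
    using C1f unfolding C1_differentiable_on_def has_real_derivative_iff_has_vector_derivative by blast
  have du: "deriv u r = D r" if "r \<in> ?I" for r using D(1)[OF that] by (rule DERIV_imp_deriv)
  have D0: "D r \<noteq> 0" if "r \<in> ?I" for r using solution_deriv_nonzero[OF sol that] du[OF that] by simp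
  \<comment> \<open>A continuous derivative without zeros has constant sign on an interval;
    \<open>e\<close> is the opposite of this sign since \<open>r powr - nu\<close> is
    decreasing.\<close>
  have "\<exists>e. (e = 1 \<or> e = -1) \<and> (\<forall>r\<in>?I. 0 < - (e * D r))"
  proof (rule ccontr)
    assume none: "\<not> ?thesis"
    obtain x where x: "x \<in> ?I" "\<not> 0 < - (1 * D x)" using none by blast
    obtain y where y: "y \<in> ?I" "\<not> 0 < - (-1 * D y)" using none by blast
    have xy: "0 < D x" "D y < 0" using x y D0[OF x(1)] D0[OF y(1)] by auto
    have "connected (D ` ?I)" using D(2) by (intro connected_continuous_image convex_connected convex_einterval)
    then have "0 \<in> D ` ?I"
      using xy x(1) y(1) connectedD_interval[of "D ` ?I" "D y" "D x" 0] by auto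
    then show False using D0 by fastforce
  qed
  then obtain e where e: "e = 1 \<or> e = -1" and sgn: "\<And>r. r \<in> ?I \<Longrightarrow> 0 < - (e * D r)" by blast
  define A where "A r = - (e * D r)" for r
  have A: "0 < A r" "D r = - (e * A r)" "\<bar>D r\<bar> = A r" if "r \<in> ?I" for r
    using sgn[OF that] e by (auto simp: A_def)
  define W where "W s = s powr (real N - 1) * flux m u s" for s
  define P where "P r = - (e * W r)" for r
  have Wd: "(W has_real_derivative deriv W r) (at r)" if r: "r \<in> ?I" for r
    unfolding W_def
    using DERIV_mult[OF has_real_derivative_powr[OF pos[OF r]] F[OF r]]
    by (metis DERIV_imp_deriv)
  have P_eq: "P r = (r powr (nu + 1) * A r) powr (m - 1)" if r: "r \<in> ?I" for r
  proof -
    have "A r powr (m - 2) * A r powr 1 = A r powr (m - 1)" by (simp only: powr_add[symmetric]) simp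
    then have "A r powr (m - 2) * A r = A r powr (m - 1)" using A(1)[OF r] by simp
    moreover have "P r = r powr (real N - 1) * (A r powr (m - 2) * A r) * (e * e)"
      unfolding P_def W_def flux_def du[OF r] A(3)[OF r] by (simp add: A(2)[OF r])
    moreover have "e * e = 1" using e by auto
    ultimately have "P r = r powr (real N - 1) * A r powr (m - 1)" by simp
    then show ?thesis using pos[OF r] A(1)[OF r] by (simp add: powr_mult powr_powr N_eq)
  qed
  have P_pos: "0 < P r" if r: "r \<in> ?I" for r
    unfolding P_eq[OF r] using pos[OF r] A(1)[OF r] by simp
  have Pd: "(P has_real_derivative e * (r powr (real N - 1) * u r powr p * A r powr q)) (at r)" if r: "r \<in> ?I" for r
  proof -
    have "r powr (real N - 1) * (r powr (1 - real N) * deriv W r) = - (r powr (real N - 1) * (u r powr p * A r powr q))"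
      using eqn[OF r] du[OF r] A(3)[OF r] unfolding W_def[abs_def] by (simp add: eq_neg_iff_add_eq_0[symmetric])
    moreover have "r powr (real N - 1) * (r powr (1 - real N) * deriv W r) = deriv W r"
      using pos[OF r] by (simp add: mult.assoc[symmetric] powr_add[symmetric])
    ultimately have "deriv W r = - (r powr (real N - 1) * u r powr p * A r powr q)" by simp
    then have "(P has_real_derivative - (e * - (r powr (real N - 1) * u r powr p * A r powr q))) (at r)"
      unfolding P_def using DERIV_minus[OF DERIV_cmult[OF Wd[OF r], of e]] by simp
    then show ?thesis by simp
  qed
  \<comment> \<open>\<open>P\<close> is the power \<open>m - 1\<close> of \<open>nu * |v'|\<close>,
    so \<open>P powr - th\<close> is its power \<open>- (1 / alpha)\<close>; the factor in front of
    it in \<open>Y\<close> removes \<open>nu\<close>.\<close>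
  define th where "th = 1 / (alpha * (m - 1))"
  define Y where "Y s = nu powr (1 / alpha) * P (s powr - (1 / nu)) powr - th" for s
  have Y_eq: "Y s = (r powr (nu + 1) * A r / nu) powr - (1 / alpha)" if r: "r \<in> ?I" and s: "r = s powr - (1 / nu)" for r s
  proof -
    define B where "B = r powr (nu + 1) * A r"
    have B: "0 < B" using pos[OF r] A(1)[OF r] by (simp add: B_def)
    have "Y s = nu powr (1 / alpha) * B powr ((m - 1) * - th)"
      unfolding Y_def s[symmetric] P_eq[OF r] B_def[symmetric] by (simp add: powr_powr)
    also have "(m - 1) * - th = - (1 / alpha)" using m_gt_1 by (simp add: th_def)
    also have "nu powr (1 / alpha) * B powr - (1 / alpha) = (B / nu) powr - (1 / alpha)"
      using B nu_pos by (simp add: powr_divide powr_minus_divide)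
    finally show ?thesis by (simp add: B_def)
  qed
  have Y_al: "Y s powr - alpha = r powr (nu + 1) * A r / nu" if r: "r \<in> ?I" and s: "r = s powr - (1 / nu)" for r s
    unfolding Y_eq[OF r s] using alpha_pos nu_pos pos[OF r] A(1)[OF r] by (simp add: powr_powr)
  have inv: "(r powr - nu) powr - (1 / nu) = r" if "0 < r" for r
    using that nu_pos by (simp add: powr_powr)
  have ph: "phase e {s. 0 < s \<and> s powr - (1 / nu) \<in> ?I} (\<lambda>s. u (s powr - (1 / nu))) Y"
    unfolding phase_def
  proof (intro ballI conjI)
    fix s assume "s \<in> {s. 0 < s \<and> s powr - (1 / nu) \<in> ?I}"
    then have s0: "0 < s" and rI: "s powr - (1 / nu) \<in> ?I" by auto
    define r where "r = s powr - (1 / nu)"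
    have r: "r \<in> ?I" "0 < r" using rI pos[OF rI] by (simp_all only: r_def)
    have sr: "s = r powr - nu" using s0 nu_pos by (simp add: r_def powr_powr)
    have "s powr (- (1 / nu) - 1) = r powr (nu + 1)"
      unfolding sr powr_powr using nu_pos by (simp add: algebra_simps)
    then have rd: "((\<lambda>s. s powr - (1 / nu)) has_real_derivative - (1 / nu) * r powr (nu + 1)) (at s)"
      using has_real_derivative_powr[OF s0, of "- (1 / nu)"] by simp
    show "0 < u (s powr - (1 / nu))" using upos[OF rI] .
    show Ypos: "0 < Y s" unfolding Y_def using nu_pos P_pos[OF rI] by simp
    have "((\<lambda>s. u (s powr - (1 / nu))) has_real_derivative D r * (- (1 / nu) * r powr (nu + 1))) (at s)"
      unfolding r_def by (rule DERIV_chain2[OF D(1)[OF rI] rd[unfolded r_def]])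
    moreover have "D r * (- (1 / nu) * r powr (nu + 1)) = e * Y s powr - alpha"
      unfolding Y_al[OF r(1) r_def] A(2)[OF r(1)] by simp
    ultimately show "((\<lambda>s. u (s powr - (1 / nu))) has_real_derivative e * Y s powr - alpha) (at s)" by simp
    have "((\<lambda>s. P (s powr - (1 / nu))) has_real_derivative (e * (r powr (real N - 1) * u r powr p * A r powr q)) * (- (1 / nu) * r powr (nu + 1))) (at s)"
      unfolding r_def by (rule DERIV_chain2[OF Pd[OF rI] rd[unfolded r_def]])
    note Pr = this
    have "((\<lambda>s. P (s powr - (1 / nu)) powr - th) has_real_derivative (- th * P r powr (- th - 1)) *
        ((e * (r powr (real N - 1) * u r powr p * A r powr q)) * (- (1 / nu) * r powr (nu + 1)))) (at s)"
      unfolding r_def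
      by (rule DERIV_chain2[OF _ Pr[unfolded r_def], of "\<lambda>y. y powr - th"]) (rule has_real_derivative_powr[OF P_pos[OF rI]])
    from DERIV_cmult[OF this, of "nu powr (1 / alpha)"]
    have d: "(Y has_real_derivative nu powr (1 / alpha) * ((- th * P r powr (- th - 1)) *
        ((e * (r powr (real N - 1) * u r powr p * A r powr q)) * (- (1 / nu) * r powr (nu + 1))))) (at s)"
      unfolding Y_def .
    have 1: "nu powr (1 / alpha) * ((- th * P r powr (- th - 1)) *
        ((e * (r powr (real N - 1) * u r powr p * A r powr q)) * (- (1 / nu) * r powr (nu + 1))))
      = e * (th * (nu powr (1 / alpha) / nu)) * (P r powr (- th - 1) * A r powr q * (r powr (real N - 1) * r powr (nu + 1))) * u r powr p"
      by (simp add: mult_ac)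
    have 2: "th * (nu powr (1 / alpha) / nu) = coef"
    proof -
      have "nu powr (1 / alpha) / nu = nu powr (1 / alpha) / nu powr 1" using nu_pos by simp
      also have "\<dots> = nu powr (q - m)" by (simp only: powr_diff[symmetric] inverse_alpha) simp
      finally show ?thesis using m_gt_1 by (simp add: th_def coef_def alpha_def)
    qed
    have 3: "P r powr (- th - 1) * A r powr q * (r powr (real N - 1) * r powr (nu + 1)) = s powr kappa"
    proof -
      have "P r powr (- th - 1) = (r powr (nu + 1) * A r) powr ((m - 1) * (- th - 1))"
        unfolding P_eq[OF r(1)] by (simp add: powr_powr)
      also have "(m - 1) * (- th - 1) = - q"
        using m_gt_1 m_less_q by (simp add: th_def alpha_def field_simps)
      also have "(r powr (nu + 1) * A r) powr - q = r powr - ((nu + 1) * q) * A r powr - q"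
        using r A(1)[OF r(1)] by (simp add: powr_mult powr_powr)
      finally have "P r powr (- th - 1) * A r powr q * (r powr (real N - 1) * r powr (nu + 1))
          = (A r powr - q * A r powr q) * (r powr - ((nu + 1) * q) * (r powr (real N - 1) * r powr (nu + 1)))"
        by (simp add: mult_ac)
      also have "A r powr - q * A r powr q = 1" using A(1)[OF r(1)] by (simp add: powr_add[symmetric])
      also have "r powr - ((nu + 1) * q) * (r powr (real N - 1) * r powr (nu + 1)) = r powr - ((nu + 1) * (q - m))"
        unfolding N_eq by (simp only: powr_add[symmetric]) (simp add: algebra_simps)
      also have "\<dots> = s powr kappa" unfolding sr powr_powr using nu_kappa by simp
      finally show ?thesis by simp
    qed
    have "(Y has_real_derivative e * coef * s powr kappa * u r powr p) (at s)"
      using d by (simp only: 1 2 3)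
    then show "(Y has_real_derivative e * (coef * s powr kappa) * u (s powr - (1 / nu)) powr p) (at s)"
      by (simp only: r_def mult.assoc)
  qed
  have "deriv u r = - (e * (nu * r powr - (nu + 1) * Y (r powr - nu) powr - alpha))" if r: "r \<in> ?I" for r
  proof -
    have "nu * r powr - (nu + 1) * Y (r powr - nu) powr - alpha = (r powr - (nu + 1) * r powr (nu + 1)) * A r"
      unfolding Y_al[OF r inv[OF pos[OF r], symmetric]] using nu_pos by simp
    also have "r powr - (nu + 1) * r powr (nu + 1) = 1" using pos[OF r] by (simp add: powr_add[symmetric])
    finally show ?thesis using du[OF r] A(2)[OF r] by simp
  qed
  with ph e show ?thesis by blast
qed

section \<open>Existence and uniqueness for the reduced system\<close>

text \<open>The power system is used with its two unknowns in either order. If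
  \<open>y0 > 0\<close>, then \<open>Y\<close> is the one bounded below and \<open>V\<close> may
  start at 0. If \<open>y0 = 0\<close>, then \<open>V\<close> is bounded below, \<open>Y\<close> is
  driven away from 0 by the positive weight, and the singular exponent \<open>- alpha\<close> is
  admissible since it exceeds -1.\<close>

lemma increasing_flow_exists:
  fixes h :: "real \<Rightarrow> real" and J :: "real set"
  assumes J: "\<And>t. t \<in> J \<Longrightarrow> 0 \<le> t" and J0: "0 \<in> J" and nxt: "\<And>t. t \<in> J \<Longrightarrow> \<exists>t'\<in>J. t < t'"
    and down: "\<And>s t. t \<in> J \<Longrightarrow> 0 \<le> s \<Longrightarrow> s \<le> t \<Longrightarrow> s \<in> J"
    and h: "continuous_on J h" "\<And>t. t \<in> J \<Longrightarrow> 0 \<le> h t"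
    and init: "0 < y0 \<and> 0 \<le> v0 \<or> y0 = 0 \<and> 0 < v0 \<and> (\<forall>t\<in>J. 0 < h t)"
  shows "\<exists>V Y. continuous_on J V \<and> continuous_on J Y \<and> V 0 = v0 \<and> Y 0 = y0 \<and>
    (\<forall>t\<in>J. 0 < t \<longrightarrow> 0 < V t \<and> 0 < Y t \<and> (V has_real_derivative Y t powr - alpha) (at t) \<and>
       (Y has_real_derivative h t * V t powr p) (at t))"
proof (cases "0 < y0")
  case True
  have "\<exists>X A. continuous_on J X \<and> continuous_on J A \<and> X 0 = y0 \<and> A 0 = v0 \<and>
      (\<forall>t\<in>J. y0 \<le> X t \<and> (0 < t \<longrightarrow> 0 < A t \<and> (X has_real_derivative h t * A t powr p) (at t) \<and>
         (A has_real_derivative 1 * X t powr - alpha) (at t)))"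
    by (rule power_system_increasing(1)[OF J J0 nxt down h continuous_on_const]; (assumption)?)
       (use True init p_nonneg alpha_pos in auto)
  then obtain X A where "continuous_on J X" "continuous_on J A" "X 0 = y0" "A 0 = v0"
      "\<forall>t\<in>J. y0 \<le> X t \<and> (0 < t \<longrightarrow> 0 < A t \<and> (X has_real_derivative h t * A t powr p) (at t) \<and>
         (A has_real_derivative 1 * X t powr - alpha) (at t))" by blast
  then show ?thesis using True by (intro exI[of _ A] exI[of _ X]) fastforce
next
  case False
  then have i: "y0 = 0" "0 < v0" "\<And>t. t \<in> J \<Longrightarrow> 0 < h t" using init by auto
  have "\<exists>X A. continuous_on J X \<and> continuous_on J A \<and> X 0 = v0 \<and> A 0 = 0 \<and>
      (\<forall>t\<in>J. v0 \<le> X t \<and> (0 < t \<longrightarrow> 0 < A t \<and> (X has_real_derivative 1 * A t powr - alpha) (at t) \<and>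
         (A has_real_derivative h t * X t powr p) (at t)))"
    by (rule power_system_increasing(1)[OF J J0 nxt down continuous_on_const _ h(1) i(3)]; (assumption)?)
       (use i(2) p_nonneg alpha_pos alpha_less_1 in auto)
  then obtain X A where "continuous_on J X" "continuous_on J A" "X 0 = v0" "A 0 = 0"
      "\<forall>t\<in>J. v0 \<le> X t \<and> (0 < t \<longrightarrow> 0 < A t \<and> (X has_real_derivative 1 * A t powr - alpha) (at t) \<and>
         (A has_real_derivative h t * X t powr p) (at t))" by blast
  then show ?thesis using i by (intro exI[of _ X] exI[of _ A]) fastforce
qed

text \<open>Cauchy data at \<open>s0\<close>, shifted to time 0; growth makes the solution global.
  Data with \<open>y0 = 0\<close> ask for \<open>s0 > 0\<close>, where the weight
  \<open>s powr kappa\<close> does not vanish.\<close>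

lemma phase_increasing_exists:
  assumes s0: "0 \<le> s0" and init: "0 < y0 \<and> 0 \<le> v0 \<or> y0 = 0 \<and> 0 < v0 \<and> 0 < s0"
  shows "\<exists>v Y. phase 1 {s0<..} v Y \<and> (v \<longlongrightarrow> v0) (at_right s0) \<and> (Y \<longlongrightarrow> y0) (at_right s0)"
proof -
  define h where "h t = coef * (s0 + t) powr kappa" for t
  have "\<exists>V Y. continuous_on {0..} V \<and> continuous_on {0..} Y \<and> V 0 = v0 \<and> Y 0 = y0 \<and>
    (\<forall>t\<in>{0..}. 0 < t \<longrightarrow> 0 < V t \<and> 0 < Y t \<and> (V has_real_derivative Y t powr - alpha) (at t) \<and>
       (Y has_real_derivative h t * V t powr p) (at t))"
  proof (rule increasing_flow_exists)
    show "\<exists>t'\<in>{0..}. t < t'" if "t \<in> {0..}" for t :: real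
      using that by (intro bexI[of _ "t + 1"]) auto
    show "continuous_on {0..} h" unfolding h_def
      by (intro continuous_on_mult continuous_on_const continuous_on_powr')
         (use s0 kappa_pos in \<open>auto intro!: continuous_intros\<close>)
    show "0 < y0 \<and> 0 \<le> v0 \<or> y0 = 0 \<and> 0 < v0 \<and> (\<forall>t\<in>{0..}. 0 < h t)"
      using init coef_pos by (auto simp: h_def)
    show "0 \<le> h t" for t unfolding h_def using coef_pos by simp
  qed auto
  then obtain V Y where VY: "continuous_on {0..} V" "continuous_on {0..} Y" "V 0 = v0" "Y 0 = y0"
    and d: "\<And>t. 0 < t \<Longrightarrow> 0 < V t \<and> 0 < Y t \<and> (V has_real_derivative Y t powr - alpha) (at t) \<and>
       (Y has_real_derivative h t * V t powr p) (at t)" by auto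
  have "phase 1 {s0<..} (\<lambda>s. V (s - s0)) (\<lambda>s. Y (s - s0))"
    unfolding phase_def
  proof (intro ballI conjI)
    fix s assume "s \<in> {s0<..}"
    then have s: "0 < s - s0" by simp
    have sh: "((\<lambda>s. s - s0) has_real_derivative 1) (at s)" by (auto intro!: derivative_eq_intros)
    show "0 < V (s - s0)" "0 < Y (s - s0)" using d[OF s] by auto
    show "((\<lambda>s. V (s - s0)) has_real_derivative 1 * Y (s - s0) powr - alpha) (at s)"
      using DERIV_chain2[OF _ sh, of V] d[OF s] by fastforce
    show "((\<lambda>s. Y (s - s0)) has_real_derivative 1 * (coef * s powr kappa) * V (s - s0) powr p) (at s)"
      using DERIV_chain2[OF _ sh, of Y] d[OF s] by (fastforce simp: h_def)
  qed
  moreover have "((\<lambda>s. f (s - s0)) \<longlongrightarrow> f 0) (at_right s0)" if f: "continuous_on {0..} f" for f :: "real \<Rightarrow> real"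
  proof -
    have "(f \<longlongrightarrow> f 0) (at 0 within {0..})" using f by (simp add: continuous_on_def)
    then have "(f \<longlongrightarrow> f 0) (at_right 0)" by (rule tendsto_within_subset) auto
    then show ?thesis by (simp add: filterlim_at_right_to_0[of _ _ s0])
  qed
  ultimately show ?thesis using VY by metis
qed

text \<open>Running backwards, with \<open>t = s1 - s\<close>, both unknowns grow, so the increasing
  flow applies and the solution extends down to \<open>s = 0\<close>.\<close>

lemma phase_decreasing_exists:
  assumes s1: "0 < s1" and init: "0 < y0 \<and> 0 \<le> v0 \<or> y0 = 0 \<and> 0 < v0"
  shows "\<exists>v Y. phase (-1) {0<..<s1} v Y \<and> (v \<longlongrightarrow> v0) (at_left s1) \<and> (Y \<longlongrightarrow> y0) (at_left s1)"
proof -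
  define h where "h t = coef * (s1 - t) powr kappa" for t
  let ?J = "{0..<s1}"
  have "\<exists>V Y. continuous_on ?J V \<and> continuous_on ?J Y \<and> V 0 = v0 \<and> Y 0 = y0 \<and>
    (\<forall>t\<in>?J. 0 < t \<longrightarrow> 0 < V t \<and> 0 < Y t \<and> (V has_real_derivative Y t powr - alpha) (at t) \<and>
       (Y has_real_derivative h t * V t powr p) (at t))"
  proof (rule increasing_flow_exists)
    show "\<exists>t'\<in>?J. t < t'" if "t \<in> ?J" for t
      using that by (intro bexI[of _ "(t + s1) / 2"]) auto
    show "continuous_on ?J h" unfolding h_def
      by (intro continuous_on_mult continuous_on_const continuous_on_powr')
         (use kappa_pos in \<open>auto intro!: continuous_intros\<close>)
    show "0 < y0 \<and> 0 \<le> v0 \<or> y0 = 0 \<and> 0 < v0 \<and> (\<forall>t\<in>?J. 0 < h t)"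
      using init coef_pos by (auto simp: h_def)
    show "0 \<le> h t" for t unfolding h_def using coef_pos by simp
  qed (use s1 in auto)
  then obtain V Y where VY: "continuous_on ?J V" "continuous_on ?J Y" "V 0 = v0" "Y 0 = y0"
    and d: "\<And>t. 0 < t \<Longrightarrow> t < s1 \<Longrightarrow> 0 < V t \<and> 0 < Y t \<and> (V has_real_derivative Y t powr - alpha) (at t) \<and>
       (Y has_real_derivative h t * V t powr p) (at t)" by auto
  have "phase (-1) {0<..<s1} (\<lambda>s. V (s1 - s)) (\<lambda>s. Y (s1 - s))"
    unfolding phase_def
  proof (intro ballI conjI)
    fix s assume "s \<in> {0<..<s1}"
    then have s: "0 < s1 - s" "s1 - s < s1" by auto
    have sh: "((\<lambda>s. s1 - s) has_real_derivative -1) (at s)" by (auto intro!: derivative_eq_intros)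
    show "0 < V (s1 - s)" "0 < Y (s1 - s)" using d[OF s] by auto
    have "((\<lambda>s. V (s1 - s)) has_real_derivative Y (s1 - s) powr - alpha * -1) (at s)"
      by (rule DERIV_chain2[OF _ sh]) (use d[OF s] in auto)
    then show "((\<lambda>s. V (s1 - s)) has_real_derivative -1 * Y (s1 - s) powr - alpha) (at s)" by simp
    have "((\<lambda>s. Y (s1 - s)) has_real_derivative h (s1 - s) * V (s1 - s) powr p * -1) (at s)"
      by (rule DERIV_chain2[OF _ sh]) (use d[OF s] in auto)
    then show "((\<lambda>s. Y (s1 - s)) has_real_derivative -1 * (coef * s powr kappa) * V (s1 - s) powr p) (at s)"
      by (simp add: h_def)
  qed
  moreover have "((\<lambda>s. f (s1 - s)) \<longlongrightarrow> f 0) (at_left s1)" if f: "continuous_on ?J f" for f :: "real \<Rightarrow> real"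
  proof -
    have "(f \<longlongrightarrow> f 0) (at 0 within ?J)" using f s1 by (simp add: continuous_on_def)
    moreover have "filterlim (\<lambda>s. s1 - s) (at 0 within ?J) (at_left s1)"
      unfolding filterlim_at
    proof
      show "((\<lambda>s. s1 - s) \<longlongrightarrow> 0) (at_left s1)"
        using tendsto_diff[OF tendsto_const tendsto_ident_at, of s1 s1] by simp
      show "\<forall>\<^sub>F s in at_left s1. s1 - s \<in> ?J \<and> s1 - s \<noteq> 0"
        by (rule eventually_mono[OF eventually_at_left_real[OF s1]]) auto
    qed
    ultimately show ?thesis by (rule filterlim_compose)
  qed
  ultimately show ?thesis using VY by metis
qed

text \<open>Data at \<open>s = 0\<close> are to be continued in the direction in which both unknowns
  decrease, so the solution is only local in \<open>s\<close>.\<close>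

lemma phase_decreasing_at_0_exists:
  assumes l: "0 < l" and y: "0 < y"
  shows "\<exists>d>0. \<exists>v Y. phase (-1) {0<..<d} v Y \<and> (v \<longlongrightarrow> l) (at_right 0) \<and> (Y \<longlongrightarrow> y) (at_right 0)"
proof -
  have h: "continuous_on {0..1} (\<lambda>t. coef * t powr kappa)"
    by (intro continuous_on_mult continuous_on_const continuous_on_powr')
       (use kappa_pos in \<open>auto intro!: continuous_intros\<close>)
  have h0: "0 \<le> coef * t powr kappa" for t using coef_pos by simp
  obtain d V Y where d: "0 < d" and VY: "continuous_on {0..<d} V" "continuous_on {0..<d} Y" "V 0 = l" "Y 0 = y"
    and D: "\<forall>t. 0 < t \<longrightarrow> t < d \<longrightarrow> 0 < V t \<and> 0 < Y t \<and> (V has_real_derivative - (Y t powr - alpha)) (at t) \<and>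
         (Y has_real_derivative - (coef * t powr kappa * V t powr p)) (at t)"
    using power_system_decreasing_local[OF h h0 l y, of "- alpha" p] by blast
  have "phase (-1) {0<..<d} V Y" unfolding phase_def using D by auto
  moreover have "(f \<longlongrightarrow> f 0) (at_right 0)" if f: "continuous_on {0..<d} f" for f :: "real \<Rightarrow> real"
  proof -
    have "(f \<longlongrightarrow> f 0) (at 0 within {0..<d})" using f d by (simp add: continuous_on_def)
    moreover have "at_right 0 = at 0 within {0..<d}"
      by (rule at_within_nhd[of 0 "{..<d}"]) (use d in auto)
    ultimately show ?thesis by simp
  qed
  ultimately show ?thesis using d VY by metis
qed

section \<open>Uniqueness for the reduced system and its scaling\<close>

lemma phase_isCont:
  assumes "phase e S v Y" "s \<in> S"
  shows "isCont v s" "isCont Y s"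
  using phaseD(3,4)[OF assms] DERIV_isCont by blast+

lemma weight_bound:
  assumes "0 \<le> a" "a < t" "t < b"
  shows "\<bar>coef * t powr kappa\<bar> \<le> coef * b powr kappa"
  using assms coef_pos kappa_pos by (auto intro!: mult_left_mono powr_mono2)

lemma phase_unique_interior:
  assumes ph: "phase e {0<..} v Y" "phase e {0<..} w Z" and S: "0 < S" "v S = w S" "Y S = Z S" and s: "0 < s"
  shows "v s = w s" "Y s = Z s"
proof -
  define a where "a = min s S"
  define b where "b = max s S"
  have ab: "0 < a" "a \<le> b" "s \<in> {a..b}" "S \<in> {a..b}" using S s by (auto simp: a_def b_def)
  have cont: "continuous_on {a..b} v" "continuous_on {a..b} w" "continuous_on {a..b} Y" "continuous_on {a..b} Z"
    using phase_isCont[OF ph(1)] phase_isCont[OF ph(2)] ab by (auto intro!: continuous_at_imp_continuous_on)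
  have "v s = w s \<and> Y s = Z s"
  proof (rule power_system_unique[OF cont, where h="\<lambda>t. coef * t powr kappa" and M="coef * b powr kappa" and e=e and alpha="- alpha" and p=p and c=S and t=s])
    show "\<bar>coef * t powr kappa\<bar> \<le> coef * b powr kappa" if "a < t" "t < b" for t
      using weight_bound[of a t b] ab that by simp
  qed (use S ab phaseD[OF ph(1)] phaseD[OF ph(2)] in auto)
  then show "v s = w s" "Y s = Z s" by auto
qed

text \<open>With both limits positive, the unknowns extended to \<open>s = 0\<close> stay away from
  0 on \<open>{0..s}\<close>, and the Lipschitz argument reaches the endpoint.\<close>

lemma phase_unique_from_0:
  assumes ph: "phase e {0<..<d} v Y" "phase e {0<..<d} w Z"
    and lim: "(v \<longlongrightarrow> l) (at_right 0)" "(w \<longlongrightarrow> l) (at_right 0)" "(Y \<longlongrightarrow> y) (at_right 0)" "(Z \<longlongrightarrow> y) (at_right 0)"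
    and ly: "0 < l" "0 < y" and s: "0 < s" "s < d"
  shows "v s = w s"
proof -
  have cont: "continuous_on {0..s} (\<lambda>t. if t = 0 then l else v t)" "continuous_on {0..s} (\<lambda>t. if t = 0 then l else w t)"
    "continuous_on {0..s} (\<lambda>t. if t = 0 then y else Y t)" "continuous_on {0..s} (\<lambda>t. if t = 0 then y else Z t)"
    using phase_isCont[OF ph(1)] phase_isCont[OF ph(2)] s by (auto intro!: continuous_on_fill_0 lim)
  have "(if s = 0 then l else v s) = (if s = 0 then l else w s) \<and> (if s = 0 then y else Y s) = (if s = 0 then y else Z s)"
  proof (rule power_system_unique[OF cont, where h="\<lambda>t. coef * t powr kappa" and M="coef * s powr kappa" and e=e and alpha="- alpha" and p=p and c=0])
    show "\<bar>coef * t powr kappa\<bar> \<le> coef * s powr kappa" if "0 < t" "t < s" for t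
      using weight_bound[of 0 t s] that by simp
    fix t assume t: "0 < t" "t < s"
    then have td: "t \<in> {0<..<d}" using s by auto
    show "((\<lambda>t. if t = 0 then l else v t) has_real_derivative e * (if t = 0 then y else Y t) powr - alpha) (at t) \<and>
      ((\<lambda>t. if t = 0 then y else Y t) has_real_derivative e * (coef * t powr kappa) * (if t = 0 then l else v t) powr p) (at t)"
      using has_real_derivative_fill_0[OF phaseD(3)[OF ph(1) td] t(1)] has_real_derivative_fill_0[OF phaseD(4)[OF ph(1) td] t(1)] t by simp
    show "((\<lambda>t. if t = 0 then l else w t) has_real_derivative e * (if t = 0 then y else Z t) powr - alpha) (at t) \<and>
      ((\<lambda>t. if t = 0 then y else Z t) has_real_derivative e * (coef * t powr kappa) * (if t = 0 then l else w t) powr p) (at t)"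
      using has_real_derivative_fill_0[OF phaseD(3)[OF ph(2) td] t(1)] has_real_derivative_fill_0[OF phaseD(4)[OF ph(2) td] t(1)] t by simp
  qed (use s ly phaseD[OF ph(1)] phaseD[OF ph(2)] in auto)
  then show ?thesis using s by simp
qed

text \<open>The limit \<open>l = 0\<close>, where \<open>v powr p\<close> may fail to be Lipschitz,
  is covered by the uniqueness part of the power system: \<open>Y\<close> is the unknown bounded
  below by \<open>y\<close>, and \<open>v\<close> the one that may start at 0.\<close>

lemma phase_increasing_unique_from_0:
  assumes ph: "phase 1 {0<..} v Y" "phase 1 {0<..} w Z"
    and lim: "(v \<longlongrightarrow> l) (at_right 0)" "(w \<longlongrightarrow> l) (at_right 0)" "(Y \<longlongrightarrow> y) (at_right 0)" "(Z \<longlongrightarrow> y) (at_right 0)"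
    and ly: "0 \<le> l" "0 < y" and s: "0 < s"
  shows "v s = w s"
proof -
  have low: "y \<le> Y t" if ph: "phase 1 {0<..} v Y" and lim: "(Y \<longlongrightarrow> y) (at_right 0)" and t: "0 < t" for v Y and t :: real
  proof (rule tendsto_upperbound[OF lim])
    show "\<forall>\<^sub>F x in at_right 0. Y x \<le> Y t"
      by (rule eventually_mono[OF eventually_at_right_real[OF t]]) (use phase_mono(2)[OF ph] in auto)
  qed simp
  have cont: "continuous_on {0..} (\<lambda>t. if t = 0 then l else v t)" "continuous_on {0..} (\<lambda>t. if t = 0 then l else w t)"
    "continuous_on {0..} (\<lambda>t. if t = 0 then y else Y t)" "continuous_on {0..} (\<lambda>t. if t = 0 then y else Z t)"
    using phase_isCont[OF ph(1)] phase_isCont[OF ph(2)] by (auto intro!: continuous_on_fill_0 lim)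
  have "(if s = 0 then y else Y s) = (if s = 0 then y else Z s) \<and> (if s = 0 then l else v s) = (if s = 0 then l else w s)"
  proof (rule power_system_increasing(2)[where J="{0..}" and H="\<lambda>t. coef * t powr kappa" and g="\<lambda>_. 1" and P=p and Q="- alpha" and ?x0.0=y and ?a0.0=l and t=s,
        OF _ _ _ _ _ _ _ _ _ _ _ _ cont(3) cont(1) _ _ cont(4) cont(2)])
    show "\<exists>t'\<in>{0..}. t < t'" if "t \<in> {0..}" for t :: real
      using that by (intro bexI[of _ "t + 1"]) auto
    show "continuous_on {0..} (\<lambda>t. coef * t powr kappa)"
      by (intro continuous_on_mult continuous_on_const continuous_on_powr')
         (use kappa_pos in \<open>auto intro!: continuous_intros\<close>)
    fix t :: real assume t: "0 < t"
    show "y \<le> (if t = 0 then y else Y t) \<and> ((\<lambda>t. if t = 0 then y else Y t) has_real_derivative coef * t powr kappa * (if t = 0 then l else v t) powr p) (at t) \<and>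
        ((\<lambda>t. if t = 0 then l else v t) has_real_derivative 1 * (if t = 0 then y else Y t) powr - alpha) (at t)"
      using has_real_derivative_fill_0[OF phaseD(3)[OF ph(1)] t] has_real_derivative_fill_0[OF phaseD(4)[OF ph(1)] t] t low[OF ph(1) lim(3) t] by simp
    show "y \<le> (if t = 0 then y else Z t) \<and> ((\<lambda>t. if t = 0 then y else Z t) has_real_derivative coef * t powr kappa * (if t = 0 then l else w t) powr p) (at t) \<and>
        ((\<lambda>t. if t = 0 then l else w t) has_real_derivative 1 * (if t = 0 then y else Z t) powr - alpha) (at t)"
      using has_real_derivative_fill_0[OF phaseD(3)[OF ph(2)] t] has_real_derivative_fill_0[OF phaseD(4)[OF ph(2)] t] t low[OF ph(2) lim(4) t] by simp
  qed (use s ly coef_pos p_nonneg alpha_pos in auto)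
  then show ?thesis using s by simp
qed

text \<open>
  The exponent for which \<open>k powr scale_exp * v (k * s)\<close> solves the reduced equation together with \<open>v\<close>.
\<close>

definition scale_exp :: real where "scale_exp = (kappa - (q - m)) / (p + q + 1 - m)"

text \<open>A nonzero exponent makes \<open>k powr scale_exp\<close> take every positive value
  exactly once, so a scaling can realise any prescribed limit at the origin.\<close>

lemma scale_exp_pos: "0 < scale_exp"
proof -
  have "kappa - (q - m) = (q - m) / nu" using nu_pos by (simp add: kappa_def field_simps)
  then show ?thesis using nu_pos m_less_q p_nonneg by (simp add: scale_exp_def)
qed

lemma phase_scale:
  assumes ph: "phase e {0<..} v Y" and k: "0 < k"
  shows "phase e {0<..} (\<lambda>s. k powr scale_exp * v (k * s)) (\<lambda>s. k powr - ((scale_exp + 1) / alpha) * Y (k * s))"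
  unfolding phase_def
proof (intro ballI conjI)
  fix s :: real assume "s \<in> {0<..}"
  then have s: "0 < s" and ks: "k * s \<in> {0<..}" using k by auto
  have sh: "((\<lambda>s. k * s) has_real_derivative k) (at s)" by (auto intro!: derivative_eq_intros)
  note D = phaseD[OF ph ks]
  show "0 < k powr scale_exp * v (k * s)" "0 < k powr - ((scale_exp + 1) / alpha) * Y (k * s)" using D k by auto
  have "((\<lambda>s. k powr scale_exp * v (k * s)) has_real_derivative k powr scale_exp * (e * Y (k * s) powr - alpha * k)) (at s)"
    by (rule DERIV_cmult[OF DERIV_chain2[OF D(3) sh]])
  moreover have "k powr scale_exp * (e * Y (k * s) powr - alpha * k) = e * (k powr - ((scale_exp + 1) / alpha) * Y (k * s)) powr - alpha"
  proof -
    have "(k powr - ((scale_exp + 1) / alpha) * Y (k * s)) powr - alpha = k powr (scale_exp + 1) * Y (k * s) powr - alpha"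
      using k D alpha_pos by (simp add: powr_mult powr_powr add.commute)
    also have "k powr (scale_exp + 1) = k powr scale_exp * k" using k by (simp add: powr_add)
    finally show ?thesis by simp
  qed
  ultimately show "((\<lambda>s. k powr scale_exp * v (k * s)) has_real_derivative e * (k powr - ((scale_exp + 1) / alpha) * Y (k * s)) powr - alpha) (at s)" by simp
  have "((\<lambda>s. k powr - ((scale_exp + 1) / alpha) * Y (k * s)) has_real_derivative k powr - ((scale_exp + 1) / alpha) * (e * (coef * (k * s) powr kappa) * v (k * s) powr p * k)) (at s)"
    by (rule DERIV_cmult[OF DERIV_chain2[OF D(4) sh]])
  moreover have "k powr - ((scale_exp + 1) / alpha) * (e * (coef * (k * s) powr kappa) * v (k * s) powr p * k) = e * (coef * s powr kappa) * (k powr scale_exp * v (k * s)) powr p"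
  proof -
    \<comment> \<open>The equation that determines \<open>scale_exp\<close>: the factor of
      \<open>Y\<close> is dictated by the equation for \<open>v\<close>, and the equation for
      \<open>Y\<close> must be respected as well.\<close>
    have ex: "- ((scale_exp + 1) / alpha) + kappa + 1 = scale_exp * p"
    proof -
      have "scale_exp * (p + q + 1 - m) = kappa - (q - m)" using p_nonneg m_less_q by (simp add: scale_exp_def)
      moreover have "(scale_exp + 1) / alpha = (scale_exp + 1) * (q + 1 - m)" by (simp add: alpha_def)
      ultimately show ?thesis by (simp add: algebra_simps)
    qed
    have "k powr - ((scale_exp + 1) / alpha) * k powr kappa * k powr 1 = k powr (scale_exp * p)"
      by (simp only: powr_add[symmetric] ex)
    then have 1: "k powr - ((scale_exp + 1) / alpha) * (k powr kappa * k) = k powr (scale_exp * p)" using k by (simp add: mult.assoc)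
    have 2: "(k * s) powr kappa = k powr kappa * s powr kappa" using k s by (simp add: powr_mult)
    have 3: "(k powr scale_exp * v (k * s)) powr p = k powr (scale_exp * p) * v (k * s) powr p"
      using k D by (simp add: powr_mult powr_powr)
    show ?thesis unfolding 2 3 1[symmetric] by (simp add: mult_ac)
  qed
  ultimately show "((\<lambda>s. k powr - ((scale_exp + 1) / alpha) * Y (k * s)) has_real_derivative e * (coef * s powr kappa) * (k powr scale_exp * v (k * s)) powr p) (at s)" by simp
qed

lemma phase_subset: "phase e S v Y \<Longrightarrow> T \<subseteq> S \<Longrightarrow> phase e T v Y"
  unfolding phase_def by blast

lemma powr_nu_inverse:
  assumes "0 < r"
  shows "(r powr - nu) powr - (1 / nu) = r" "(r powr - (1 / nu)) powr - nu = r"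
  using assms nu_pos by (simp_all add: powr_powr)

lemma powr_nu_less_iff:
  assumes "0 < r" "0 < r'"
  shows "r powr - nu < r' powr - nu \<longleftrightarrow> r' < r"
  using powr_less_mono2_neg[of "- nu" r' r] powr_less_mono2_neg[of "- nu" r r'] assms nu_pos
  by (metis less_asym linorder_neqE_linordered_idom neg_less_0_iff_less)

section \<open>Behaviour of radial solutions\<close>

lemma phase_to_solution:
  assumes ab: "0 \<le> a" "a < b" and e: "e = 1 \<or> e = -1" and ph: "phase e S v Y"
    and S: "\<And>r. r \<in> einterval a b \<Longrightarrow> r powr - nu \<in> S"
  defines "u \<equiv> restrict (\<lambda>r. v (r powr - nu)) (einterval a b)"
  shows "u \<in> solutions N m p q a b"
    and "\<And>r. r \<in> einterval a b \<Longrightarrow> u r = v (r powr - nu)"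
    and "\<And>r. r \<in> einterval a b \<Longrightarrow> deriv u r = - (e * (nu * r powr - (nu + 1) * Y (r powr - nu) powr - alpha))"
proof -
  show u: "u r = v (r powr - nu)" if "r \<in> einterval a b" for r using that by (simp add: u_def)
  have "is_solution N m p q a b u" by (rule phase_imp_solution(1)[OF ab e ph S u])
  moreover have "u \<in> extensional (einterval a b)" by (simp add: u_def)
  ultimately show "u \<in> solutions N m p q a b" unfolding solutions_def by blast
  show "deriv u r = - (e * (nu * r powr - (nu + 1) * Y (r powr - nu) powr - alpha))" if "r \<in> einterval a b" for r
    by (rule phase_imp_solution(2)[OF ab e ph S u that])
qed

text \<open>An interval with left end 0 contains, in the variable \<open>s\<close>, a whole ray, on
  which \<open>e = - 1\<close> is impossible; the sign being the same everywhere, \<open>u\<close>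
  decreases throughout. For finite \<open>b\<close> the ray starts at the image of an arbitrary
  point of the interval.\<close>

lemma solution_near_0:
  assumes sol: "is_solution N m p q 0 b u"
  shows "\<exists>s0\<ge>0. \<exists>Y. phase 1 {s0<..} (\<lambda>s. u (s powr - (1 / nu))) Y \<and> (b = \<infinity> \<longrightarrow> s0 = 0) \<and>
    (\<forall>r\<in>einterval 0 b. deriv u r = - (nu * r powr - (nu + 1) * Y (r powr - nu) powr - alpha) \<and> deriv u r < 0)"
proof -
  have b: "0 < b" using sol by (simp add: is_solution_def)
  let ?S = "{s. 0 < s \<and> s powr - (1 / nu) \<in> einterval 0 b}"
  obtain e Y where e: "e = 1 \<or> e = -1" and ph: "phase e ?S (\<lambda>s. u (s powr - (1 / nu))) Y"
    and d: "\<forall>r\<in>einterval 0 b. deriv u r = - (e * (nu * r powr - (nu + 1) * Y (r powr - nu) powr - alpha))"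
    using solution_imp_phase[OF sol] by blast
  have "\<exists>s0\<ge>0. {s0<..} \<subseteq> ?S \<and> (b = \<infinity> \<longrightarrow> s0 = 0)"
  proof (cases "b = \<infinity>")
    case True
    then show ?thesis by (intro exI[of _ 0]) (auto simp: einterval_iff)
  next
    case False
    obtain r1 where r1: "r1 \<in> einterval 0 b" using einterval_nonempty[OF b] by blast
    then have r1p: "0 < r1" by (simp add: einterval_iff)
    have "s powr - (1 / nu) \<in> einterval 0 b" if s: "r1 powr - nu < s" for s
    proof -
      have s0: "0 < s" using s r1p by (smt (verit) powr_ge_zero)
      then have "s powr - (1 / nu) < r1"
        using powr_nu_less_iff[of r1 "s powr - (1 / nu)"] powr_nu_inverse[of s] s r1p by simp
      moreover have "0 < s powr - (1 / nu)" using s0 by simp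
      ultimately show ?thesis using r1
        by (simp add: einterval_iff) (meson ereal_less_eq(3) le_less_trans less_imp_le)
    qed
    moreover have "0 < s" if "r1 powr - nu < s" for s using that r1p by (smt (verit) powr_ge_zero)
    ultimately show ?thesis using False by (intro exI[of _ "r1 powr - nu"]) auto
  qed
  then obtain s0 where s0: "0 \<le> s0" "{s0<..} \<subseteq> ?S" "b = \<infinity> \<longrightarrow> s0 = 0" by blast
  have ph0: "phase e {s0<..} (\<lambda>s. u (s powr - (1 / nu))) Y" using phase_subset[OF ph s0(2)] .
  have e1: "e = 1" using e ph0 not_phase_decreasing_at_top[OF s0(1)] by blast
  have "deriv u r < 0" if r: "r \<in> einterval 0 b" for r
  proof -
    have rp: "0 < r" using r by (simp add: einterval_iff)
    then have "r powr - nu \<in> ?S" using r powr_nu_inverse[of r] by simp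
    then have "0 < Y (r powr - nu)" using phaseD(2)[OF ph] by blast
    then show ?thesis using d r rp nu_pos e1 by simp
  qed
  then show ?thesis using s0 ph0 d unfolding e1 by (intro exI[of _ s0] conjI exI[of _ Y]) auto
qed

text \<open>Identifies the constant of the theorem with the one produced by the growth of
  \<open>Y\<close> at infinity, and thereby shows that it is positive.\<close>

lemma a_coeff_eq: "nu powr (1 / alpha) * (kappa + 1) / coef = a_coeff N m q"
proof -
  have "nu powr (1 / alpha) = nu powr (q - m) * nu powr 1"
    unfolding inverse_alpha by (simp only: powr_add[symmetric]) (simp add: algebra_simps)
  then have "nu powr (1 / alpha) * (kappa + 1) / coef = (nu powr (q - m) * (nu * (kappa + 1))) / (nu powr (q - m) * ((q + 1 - m) / (m - 1)))"
    using nu_pos by (simp add: coef_def)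
  also have "\<dots> = nu * (kappa + 1) / ((q + 1 - m) / (m - 1))"
    by (rule nonzero_mult_divide_mult_cancel_left) (use nu_pos in simp)
  also have "\<dots> = nu * (kappa + 1) * (m - 1) / (q + 1 - m)" by simp
  also have "nu * (kappa + 1) = (nu + 1) * (q - m) + nu" using nu_kappa by (simp add: algebra_simps)
  also have "((nu + 1) * (q - m) + nu) * (m - 1) = (real N - 1) * q - real N * (m - 1)"
  proof -
    have "((nu + 1) * (q - m) + nu) * (m - 1) = ((nu + 1) * (m - 1)) * (q - m) + ((nu + 1) * (m - 1) - (m - 1))"
      by (simp add: algebra_simps)
    also have "\<dots> = (real N - 1) * q - real N * (m - 1)" unfolding N_eq[symmetric] by (simp add: algebra_simps)
    finally show ?thesis .
  qed
  finally show ?thesis by (simp add: a_coeff_def)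
qed

lemma solution_singular_at_0:
  assumes sol: "is_solution N m p q 0 b u"
  shows "\<exists>u0>0. singular_at_0 N m p q u0 u"
proof -
  have b: "0 < b" using sol by (simp add: is_solution_def)
  obtain s0 Y where s0: "0 \<le> s0" and ph: "phase 1 {s0<..} (\<lambda>s. u (s powr - (1 / nu))) Y"
    and d: "\<And>r. r \<in> einterval 0 b \<Longrightarrow> deriv u r = - (nu * r powr - (nu + 1) * Y (r powr - nu) powr - alpha)"
    using solution_near_0[OF sol] by blast
  obtain u0 where u0: "0 < u0" and lim: "((\<lambda>s. u (s powr - (1 / nu))) \<longlongrightarrow> u0) at_top"
    and limY: "((\<lambda>s. Y s / s powr (kappa + 1)) \<longlongrightarrow> coef * u0 powr p / (kappa + 1)) at_top"
    using phase_at_top[OF ph s0] by blast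
  have top: "filterlim (\<lambda>r. r powr - nu) at_top (at_right 0)" using powr_neg_at_top[OF nu_pos] .
  have ev: "\<forall>\<^sub>F r in at_right 0. r \<in> einterval 0 b \<and> 0 < r \<and> s0 < r powr - nu"
    using eventually_einterval_at_right_0[OF b] eventually_at_right_less[of 0]
      filterlim_at_top_dense[THEN iffD1, OF top, rule_format, of s0]
    by eventually_elim auto
  have L1: "(u \<longlongrightarrow> u0) (at_right 0)"
    by (rule Lim_transform_eventually[OF filterlim_compose[OF lim top]])
       (rule eventually_mono[OF ev], simp add: powr_nu_inverse)
  have ex: "- nu * (kappa + 1) = 1 - (nu + 1) * (q - m + 1)" using nu_kappa by (simp add: algebra_simps)
  have al1: "alpha * (q - m + 1) = 1" using m_less_q by (simp add: alpha_def)
  \<comment> \<open>Since \<open>q - m + 1 = 1 / alpha\<close>, this power of \<open>|u'|\<close>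
    contains \<open>Y\<close> to the power -1, and the remaining powers of \<open>r\<close> are
    those of \<open>s powr (kappa + 1)\<close>.\<close>
  have key: "nu powr (1 / alpha) / (Y (r powr - nu) / (r powr - nu) powr (kappa + 1)) = r * \<bar>deriv u r\<bar> powr (q - m + 1)"
    if r: "r \<in> einterval 0 b \<and> 0 < r \<and> s0 < r powr - nu" for r
  proof -
    have Y: "0 < Y (r powr - nu)" using phaseD(2)[OF ph, of "r powr - nu"] r by simp
    have "\<bar>deriv u r\<bar> = nu * r powr - (nu + 1) * Y (r powr - nu) powr - alpha"
      using d[of r] r nu_pos by (simp add: abs_mult)
    then have "\<bar>deriv u r\<bar> powr (q - m + 1) = nu powr (q - m + 1) * r powr - ((nu + 1) * (q - m + 1)) * Y (r powr - nu) powr - (alpha * (q - m + 1))"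
      using nu_pos Y r by (simp only: powr_mult powr_powr mult_minus_left)
    also have "Y (r powr - nu) powr - (alpha * (q - m + 1)) = 1 / Y (r powr - nu)"
      unfolding al1 using Y by (simp add: powr_minus_divide)
    finally have "r * \<bar>deriv u r\<bar> powr (q - m + 1) = nu powr (q - m + 1) * (r powr 1 * r powr - ((nu + 1) * (q - m + 1))) / Y (r powr - nu)"
      using r by simp
    also have "r powr 1 * r powr - ((nu + 1) * (q - m + 1)) = (r powr - nu) powr (kappa + 1)"
      unfolding powr_powr ex by (simp only: powr_add[symmetric]) simp
    also have "nu powr (q - m + 1) = nu powr (1 / alpha)" unfolding inverse_alpha by (simp add: algebra_simps)
    finally show ?thesis by simp
  qed
  have u0p: "0 < u0 powr p" using u0 by simp
  have c: "0 < a_coeff N m q / u0 powr p"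
    unfolding a_coeff_eq[symmetric] using nu_pos kappa_pos coef_pos u0p by simp
  have "((\<lambda>r. nu powr (1 / alpha) / (Y (r powr - nu) / (r powr - nu) powr (kappa + 1))) \<longlongrightarrow> nu powr (1 / alpha) / (coef * u0 powr p / (kappa + 1))) (at_right 0)"
    using coef_pos u0p kappa_pos by (intro tendsto_divide tendsto_const filterlim_compose[OF limY top]) auto
  also have "nu powr (1 / alpha) / (coef * u0 powr p / (kappa + 1)) = a_coeff N m q / u0 powr p"
    unfolding a_coeff_eq[symmetric] by simp
  finally have L2: "((\<lambda>r. r * \<bar>deriv u r\<bar> powr (q - m + 1)) \<longlongrightarrow> a_coeff N m q / u0 powr p) (at_right 0)"
    by (rule Lim_transform_eventually) (rule eventually_mono[OF ev key])
  \<comment> \<open>Half of the limit is an eventual lower bound for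
    \<open>r * |u'| powr (q - m + 1)\<close>; hence \<open>- u'\<close> is at least
    \<open>(C / r) powr alpha\<close>, which diverges.\<close>
  define C where "C = a_coeff N m q / u0 powr p / 2"
  have C: "0 < C" "C < a_coeff N m q / u0 powr p" using c by (auto simp: C_def)
  have "filterlim (\<lambda>r. C powr alpha * r powr - alpha) at_top (at_right 0)"
    using C by (intro filterlim_tendsto_pos_mult_at_top[OF tendsto_const] powr_neg_at_top alpha_pos) simp
  then have "filterlim (\<lambda>r. - deriv u r) at_top (at_right 0)"
  proof (rule filterlim_at_top_mono)
    show "\<forall>\<^sub>F r in at_right 0. C powr alpha * r powr - alpha \<le> - deriv u r"
      using order_tendstoD(1)[OF L2 C(2)] ev
    proof eventually_elim
      case (elim r)
      have pos: "0 \<le> - deriv u r" using d[of r] elim nu_pos by simp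
      have "C / r \<le> \<bar>deriv u r\<bar> powr (q - m + 1)" using elim by (simp add: field_simps)
      then have "(C / r) powr alpha \<le> (\<bar>deriv u r\<bar> powr (q - m + 1)) powr alpha"
        using C alpha_pos elim by (intro powr_mono2) auto
      also have "\<dots> = - deriv u r" using al1 pos by (simp add: powr_powr mult.commute)
      finally show ?case using C elim by (simp add: powr_divide powr_minus_divide)
    qed
  qed
  then have "filterlim (deriv u) at_bot (at_right 0)" using filterlim_uminus_at_top by force
  with L1 L2 u0 show ?thesis unfolding singular_at_0_def by blast
qed

lemma solution_antimono:
  assumes sol: "is_solution N m p q 0 b u"
  shows "strict_antimono_on (einterval 0 b) u"
proof (rule monotone_onI)
  have neg: "\<And>r. r \<in> einterval 0 b \<Longrightarrow> deriv u r < 0" using solution_near_0[OF sol] by blast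
  fix x y assume xy: "x \<in> einterval 0 b" "y \<in> einterval 0 b" "x < y"
  show "u y < u x"
  proof (rule DERIV_neg_imp_decreasing[OF xy(3)])
    fix z assume "x \<le> z" "z \<le> y"
    then have "z \<in> einterval 0 b" using einterval_convexD[OF xy(1,2)] by blast
    then show "\<exists>d. (u has_real_derivative d) (at z) \<and> d < 0"
      using solution_has_derivative[OF sol] neg by blast
  qed
qed

lemma singular_at_0_of_limit:
  assumes "is_solution N m p q 0 b u" "(u \<longlongrightarrow> u0) (at_right 0)"
  shows "singular_at_0 N m p q u0 u"
proof -
  obtain u1 where "singular_at_0 N m p q u1 u" using solution_singular_at_0[OF assms(1)] by blast
  moreover from this have "u1 = u0"
    using assms(2) tendsto_unique[OF trivial_limit_at_right_real] unfolding singular_at_0_def by blast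
  ultimately show ?thesis by simp
qed

section \<open>Expansion at infinity\<close>

text \<open>The sign, the function \<open>Y\<close> and its limit are kept in the conclusion because
  they are the initial data at \<open>s = 0\<close> from which uniqueness is deduced.\<close>

lemma solution_near_infinity:
  assumes sol: "is_solution N m p q a \<infinity> u"
  shows "\<exists>e Y b l y. (e = 1 \<or> e = -1) \<and> 0 < b \<and> phase e {0<..<b} (\<lambda>s. u (s powr - (1 / nu))) Y \<and> 0 \<le> l \<and> 0 < y \<and>
    ((\<lambda>s. u (s powr - (1 / nu))) \<longlongrightarrow> l) (at_right 0) \<and> (Y \<longlongrightarrow> y) (at_right 0) \<and>
    (u \<longlongrightarrow> l) at_top \<and> ((\<lambda>r. r powr nu * (u r - l)) \<longlongrightarrow> e * y powr - alpha) at_top"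
proof -
  have a: "0 \<le> a" "a < \<infinity>" using sol by (auto simp: is_solution_def)
  let ?v = "\<lambda>s. u (s powr - (1 / nu))"
  obtain e Y where e: "e = 1 \<or> e = -1" and ph: "phase e {s. 0 < s \<and> s powr - (1 / nu) \<in> einterval a \<infinity>} ?v Y"
    using solution_imp_phase[OF sol] by blast
  obtain r1 where r1: "r1 \<in> einterval a \<infinity>" using einterval_nonempty[OF a(2)] by blast
  have r1p: "0 < r1" using einterval_subset_pos[OF a(1) r1] .
  define b where "b = r1 powr - nu"
  have b: "0 < b" using r1p by (simp add: b_def)
  have "{0<..<b} \<subseteq> {s. 0 < s \<and> s powr - (1 / nu) \<in> einterval a \<infinity>}"
  proof safe
    fix s assume s: "s \<in> {0<..<b}"
    then show "0 < s" by simp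
    have "r1 < s powr - (1 / nu)"
      using powr_nu_less_iff[of "s powr - (1 / nu)" r1] powr_nu_inverse[of s] s r1p by (simp add: b_def)
    then show "s powr - (1 / nu) \<in> einterval a \<infinity>"
      using r1 by (simp add: einterval_iff) (meson ereal_less_eq(3) less_imp_le less_le_trans)
  qed
  then have ph: "phase e {0<..<b} ?v Y" by (rule phase_subset[OF ph])
  have "\<exists>l\<ge>0. \<exists>y>0. (?v \<longlongrightarrow> l) (at_right 0) \<and> (Y \<longlongrightarrow> y) (at_right 0) \<and>
     ((\<lambda>s. (?v s - l) / s) \<longlongrightarrow> e * y powr - alpha) (at_right 0)"
    using e
  proof
    assume "e = 1"
    then show ?thesis using phase_increasing_at_0[of b ?v Y] ph b by force
  next
    assume "e = -1"
    then show ?thesis using phase_decreasing_at_0[of b ?v Y] ph b by force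
  qed
  then obtain l y where ly: "0 \<le> l" "0 < y" and lim: "(?v \<longlongrightarrow> l) (at_right 0)" "(Y \<longlongrightarrow> y) (at_right 0)"
     "((\<lambda>s. (?v s - l) / s) \<longlongrightarrow> e * y powr - alpha) (at_right 0)" by blast
  have right: "filterlim (\<lambda>r. r powr - nu) (at_right 0) at_top" using powr_neg_at_right_0[OF nu_pos] .
  have ev: "\<forall>\<^sub>F r::real in at_top. 0 < r" by (rule eventually_gt_at_top)
  have "(u \<longlongrightarrow> l) at_top"
    by (rule Lim_transform_eventually[OF filterlim_compose[OF lim(1) right]])
       (rule eventually_mono[OF ev], simp add: powr_nu_inverse)
  moreover have "((\<lambda>r. r powr nu * (u r - l)) \<longlongrightarrow> e * y powr - alpha) at_top"
    by (rule Lim_transform_eventually[OF filterlim_compose[OF lim(3) right]])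
       (rule eventually_mono[OF ev], simp only: powr_nu_inverse(1), simp add: powr_minus_divide)
  ultimately show ?thesis using e b ph ly lim by blast
qed

lemma decay_at_infinity:
  assumes "is_solution N m p q a \<infinity> u"
  shows "\<exists>l\<ge>0. (u \<longlongrightarrow> l) at_top \<and> (\<exists>k>0. ((\<lambda>r. r powr nu * \<bar>u r - l\<bar>) \<longlongrightarrow> k) at_top)"
proof -
  obtain e l and y :: real where e: "e = 1 \<or> e = -1" and ly: "0 \<le> l" "0 < y" and l: "(u \<longlongrightarrow> l) at_top"
    and c: "((\<lambda>r. r powr nu * (u r - l)) \<longlongrightarrow> e * y powr - alpha) at_top"
    using solution_near_infinity[OF assms] by blast
  have "((\<lambda>r. \<bar>r powr nu * (u r - l)\<bar>) \<longlongrightarrow> \<bar>e * y powr - alpha\<bar>) at_top" by (rule tendsto_rabs[OF c])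
  moreover have "0 < \<bar>e * y powr - alpha\<bar>" using e ly by auto
  ultimately show ?thesis using ly l by (intro exI[of _ l]) (auto simp: abs_mult)
qed

lemma local_solution_at_infinity_exists:
  assumes l: "0 < l" and c: "c \<noteq> 0"
  shows "\<exists>R u. is_solution N m p q (ereal R) \<infinity> u \<and> ((\<lambda>r. r powr nu * (u r - l)) \<longlongrightarrow> c) at_top"
proof -
  \<comment> \<open>\<open>e\<close> and \<open>y\<close> solve
    \<open>e * y powr - alpha = c\<close>: the sign of \<open>c\<close> decides the monotonicity and
    its modulus the initial value of \<open>Y\<close>.\<close>
  define e where "e = sgn c"
  have e: "e = 1 \<or> e = -1" using c by (auto simp: e_def sgn_real_def)
  define y where "y = \<bar>c\<bar> powr - (1 / alpha)"
  have y: "0 < y" using c by (simp add: y_def)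
  have yc: "e * y powr - alpha = c"
  proof -
    have "y powr - alpha = \<bar>c\<bar>" using alpha_pos c by (simp add: y_def powr_powr)
    then show ?thesis by (simp add: e_def mult_sgn_abs)
  qed
  have "\<exists>d>0. \<exists>v Y. phase e {0<..<d} v Y \<and> (v \<longlongrightarrow> l) (at_right 0) \<and> (Y \<longlongrightarrow> y) (at_right 0)"
    using e
  proof
    assume e1: "e = 1"
    obtain v Y where "phase 1 {0<..} v Y" "(v \<longlongrightarrow> l) (at_right 0)" "(Y \<longlongrightarrow> y) (at_right 0)"
      using phase_increasing_exists[of 0 y l] y l by auto
    moreover from this(1) have "phase 1 {0<..<1} v Y" by (rule phase_subset) auto
    ultimately show ?thesis unfolding e1 by (intro exI[of _ 1]) auto
  next
    assume "e = -1"
    then show ?thesis using phase_decreasing_at_0_exists[OF l y] by simp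
  qed
  then obtain d v Y where d: "0 < d" and ph: "phase e {0<..<d} v Y"
    and lim: "(v \<longlongrightarrow> l) (at_right 0)" "(Y \<longlongrightarrow> y) (at_right 0)" by blast
  define R where "R = d powr - (1 / nu)"
  have R: "0 < R" using d by (simp add: R_def)
  have "is_solution N m p q (ereal R) \<infinity> (\<lambda>r. v (r powr - nu))"
  proof (rule phase_imp_solution(1)[OF _ _ e ph])
    fix r assume "r \<in> einterval (ereal R) \<infinity>"
    then have "R < r" by (simp add: einterval_iff)
    moreover from this have "0 < r" using R by linarith
    ultimately show "r powr - nu \<in> {0<..<d}"
      using powr_nu_less_iff[of r R] powr_nu_inverse(2)[OF d] R by (simp add: R_def)
  qed (use R in auto)
  moreover have "((\<lambda>r. r powr nu * (v (r powr - nu) - l)) \<longlongrightarrow> c) at_top"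
    by (rule Lim_transform_eventually[OF filterlim_compose[OF phase_slope_at_0[OF ph d lim y, unfolded yc] powr_neg_at_right_0[OF nu_pos]]])
       (rule eventually_mono[OF eventually_gt_at_top[of 0]], simp add: powr_minus_divide)
  ultimately show ?thesis by blast
qed

lemma local_solution_at_infinity_unique:
  assumes l: "0 < l"
    and u: "is_solution N m p q a \<infinity> u" "((\<lambda>r. r powr nu * (u r - l)) \<longlongrightarrow> c) at_top"
    and w: "is_solution N m p q a' \<infinity> w" "((\<lambda>r. r powr nu * (w r - l)) \<longlongrightarrow> c) at_top"
  shows "\<forall>\<^sub>F r in at_top. u r = w r"
proof -
  have data: "\<exists>e Y b y. (e = 1 \<or> e = -1) \<and> 0 < b \<and> 0 < y \<and> phase e {0<..<b} (\<lambda>s. u (s powr - (1 / nu))) Y \<and>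
    ((\<lambda>s. u (s powr - (1 / nu))) \<longlongrightarrow> l) (at_right 0) \<and> (Y \<longlongrightarrow> y) (at_right 0) \<and> c = e * y powr - alpha"
    if u: "is_solution N m p q a \<infinity> u" "((\<lambda>r. r powr nu * (u r - l)) \<longlongrightarrow> c) at_top" for u a
  proof -
    obtain e Y b l' y where *: "e = 1 \<or> e = -1" "0 < b" "phase e {0<..<b} (\<lambda>s. u (s powr - (1 / nu))) Y" "0 < y"
      "((\<lambda>s. u (s powr - (1 / nu))) \<longlongrightarrow> l') (at_right 0)" "(Y \<longlongrightarrow> y) (at_right 0)"
      and l': "(u \<longlongrightarrow> l') at_top" and c': "((\<lambda>r. r powr nu * (u r - l')) \<longlongrightarrow> e * y powr - alpha) at_top"
      using solution_near_infinity[OF u(1)] by blast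
    \<comment> \<open>The prescribed expansion already forces \<open>u\<close> to converge to
      \<open>l\<close>, so the limit supplied by the general expansion is the given one.\<close>
    have "((\<lambda>r. r powr - nu) \<longlongrightarrow> 0) at_top" using powr_neg_at_right_0[OF nu_pos] by (simp add: filterlim_at)
    from tendsto_mult[OF this u(2)] have "((\<lambda>r. r powr - nu * (r powr nu * (u r - l))) \<longlongrightarrow> 0) at_top" by simp
    then have "((\<lambda>r. u r - l) \<longlongrightarrow> 0) at_top"
      by (rule Lim_transform_eventually)
         (rule eventually_mono[OF eventually_gt_at_top[of 0]], simp add: powr_minus_divide)
    then have "(u \<longlongrightarrow> l) at_top" by (simp add: LIM_zero_iff)
    then have "l' = l" using l' tendsto_unique[OF trivial_limit_at_top_linorder] by blast
    moreover from this have "c = e * y powr - alpha" using c' u(2) tendsto_unique[OF trivial_limit_at_top_linorder] by blast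
    ultimately show ?thesis using * by blast
  qed
  obtain e Y b y where e: "e = 1 \<or> e = -1" and b: "0 < b" and y: "0 < y" and ph: "phase e {0<..<b} (\<lambda>s. u (s powr - (1 / nu))) Y"
    and lim: "((\<lambda>s. u (s powr - (1 / nu))) \<longlongrightarrow> l) (at_right 0)" "(Y \<longlongrightarrow> y) (at_right 0)" and c: "c = e * y powr - alpha"
    using data[OF u] by blast
  obtain e' Y' b' y' where e': "e' = 1 \<or> e' = -1" and b': "0 < b'" and y': "0 < y'" and ph': "phase e' {0<..<b'} (\<lambda>s. w (s powr - (1 / nu))) Y'"
    and lim': "((\<lambda>s. w (s powr - (1 / nu))) \<longlongrightarrow> l) (at_right 0)" "(Y' \<longlongrightarrow> y') (at_right 0)" and c': "c = e' * y' powr - alpha"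
    using data[OF w] by blast
  have pp: "0 < y powr - alpha" "0 < y' powr - alpha" using y y' by auto
  have cc: "e * y powr - alpha = e' * y' powr - alpha" using c c' by simp
  \<comment> \<open>The sign of \<open>c\<close> determines \<open>e\<close> and its modulus
    determines \<open>y\<close>, so both solutions have the same data at
    \<open>s = 0\<close>.\<close>
  have ee: "e' = e" and eq: "y' powr - alpha = y powr - alpha"
    using e e' cc pp by (elim disjE; simp only: mult_1 mult_minus_left; linarith)+
  have "(y' powr - alpha) powr - (1 / alpha) = (y powr - alpha) powr - (1 / alpha)" by (simp only: eq)
  then have yy: "y' = y" using y y' alpha_pos by (simp add: powr_powr)
  define d where "d = min b b'"
  have d: "0 < d" using b b' by (simp add: d_def)
  have sub: "{0<..<d} \<subseteq> {0<..<b}" "{0<..<d} \<subseteq> {0<..<b'}" by (auto simp: d_def)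
  note phd = phase_subset[OF ph sub(1)] phase_subset[OF ph'[unfolded ee] sub(2)]
  have same: "u (s powr - (1 / nu)) = w (s powr - (1 / nu))" if "0 < s" "s < d" for s
    using phase_unique_from_0[OF phd lim(1) lim'(1) lim(2) lim'(2)[unfolded yy] l y that] .
  have "\<forall>\<^sub>F r in at_top. r powr - nu < d"
    using powr_neg_at_right_0[OF nu_pos] order_tendstoD(2)[of "\<lambda>r. r powr - nu" 0 at_top d] d by (simp add: filterlim_at)
  then show ?thesis
    using eventually_gt_at_top[of 0]
  proof eventually_elim
    case (elim r)
    then show ?case using same[of "r powr - nu"] powr_nu_inverse(1)[of r] by simp
  qed
qed

section \<open>Global solutions with prescribed limit at the origin\<close>

text \<open>Agreement of the first components on an open ray suffices: comparing their derivatives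
  at one point recovers the values of \<open>Y\<close> and \<open>Z\<close> there, and then
  uniqueness of the Cauchy problem applies.\<close>

lemma phase_unique_from_infinity:
  assumes ph: "phase e {0<..} v Y" "phase e {0<..} w Z" and e: "e \<noteq> 0"
    and S: "0 < S" "\<And>s. S < s \<Longrightarrow> v s = w s" and s: "0 < s"
  shows "v s = w s" "Y s = Z s"
proof -
  define T where "T = S + 1"
  have T: "0 < T" "S < T" using S by (auto simp: T_def)
  have dZ: "(v has_real_derivative e * Z T powr - alpha) (at T)"
    by (rule has_field_derivative_transform_within_open[OF phaseD(3)[OF ph(2)], of T "{S<..}"]) (use T S in auto)
  have "T \<in> {0<..}" using T by simp
  then have "e * Y T powr - alpha = e * Z T powr - alpha"
    using DERIV_unique[OF phaseD(3)[OF ph(1)] dZ] by blast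
  then have "(Y T powr - alpha) powr - (1 / alpha) = (Z T powr - alpha) powr - (1 / alpha)" using e by simp
  then have "Y T = Z T" using phaseD(2)[OF ph(1), of T] phaseD(2)[OF ph(2), of T] T alpha_pos by (simp add: powr_powr)
  then show "v s = w s" "Y s = Z s"
    using phase_unique_interior[OF ph T(1) S(2)[OF T(2)] _ s] by auto
qed

lemma global_phase_solution:
  assumes ph: "phase 1 {0<..} v Y" and lim: "(v \<longlongrightarrow> u0) at_top"
  defines "u \<equiv> restrict (\<lambda>r. v (r powr - nu)) (einterval 0 \<infinity>)"
  shows "u \<in> solutions N m p q 0 \<infinity>" "(u \<longlongrightarrow> u0) (at_right 0)" "\<And>r. 0 < r \<Longrightarrow> u r = v (r powr - nu)"
proof -
  show "u \<in> solutions N m p q 0 \<infinity>"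
    unfolding u_def by (rule phase_to_solution(1)[OF _ _ _ ph]) (auto simp: einterval_0_inf)
  show u: "u r = v (r powr - nu)" if "0 < r" for r using that by (simp add: u_def einterval_0_inf)
  show "(u \<longlongrightarrow> u0) (at_right 0)"
    by (rule Lim_transform_eventually[OF filterlim_compose[OF lim powr_neg_at_top[OF nu_pos]]])
       (rule eventually_mono[OF eventually_at_right_less], simp add: u)
qed

text \<open>Start from \<open>s = 0\<close> with data \<open>(v0, y0)\<close>, read off the limit at
  infinity, and rescale it to \<open>u0\<close>. The rescaled data are recorded so that solutions
  obtained from different data can be told apart.\<close>

lemma phase_from_0_with_limit:
  assumes v0: "0 \<le> v0" and y0: "0 < y0" and u0: "0 < u0"
  shows "\<exists>k>0. \<exists>v Y. phase 1 {0<..} v Y \<and> (v \<longlongrightarrow> k powr scale_exp * v0) (at_right 0) \<and>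
    (Y \<longlongrightarrow> k powr - ((scale_exp + 1) / alpha) * y0) (at_right 0) \<and> (v \<longlongrightarrow> u0) at_top"
proof -
  obtain v Y where ph: "phase 1 {0<..} v Y" and lim: "(v \<longlongrightarrow> v0) (at_right 0)" "(Y \<longlongrightarrow> y0) (at_right 0)"
    using phase_increasing_exists[of 0 y0 v0] v0 y0 by auto
  obtain L where L: "0 < L" "(v \<longlongrightarrow> L) at_top" using phase_at_top[OF ph] by auto
  define k where "k = (u0 / L) powr (1 / scale_exp)"
  have k: "0 < k" using u0 L by (simp add: k_def)
  have ksc: "k powr scale_exp * L = u0" using u0 L scale_exp_pos by (simp add: k_def powr_powr)
  show ?thesis
    using phase_scale[OF ph k] tendsto_scale_at_right_0[OF lim(1) k] tendsto_scale_at_right_0[OF lim(2) k]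
      tendsto_scale_at_top[OF L(2) k, of "k powr scale_exp", unfolded ksc] k by blast
qed

text \<open>The parameter \<open>y\<close> is the value of \<open>Y\<close> at \<open>s = 0\<close>
  paired with \<open>v = 1\<close>, before rescaling. If two members agree near
  \<open>r = 0\<close>, they agree everywhere; then the limits of \<open>v\<close> at
  \<open>s = 0\<close> give equal scaling factors, and those of \<open>Y\<close> equal
  parameters.\<close>

lemma global_family:
  assumes u0: "0 < u0"
  shows "\<exists>f :: real \<Rightarrow> real \<Rightarrow> real. \<forall>y>0. f y \<in> solutions N m p q 0 \<infinity> \<and> (f y \<longlongrightarrow> u0) (at_right 0) \<and>
    (\<forall>z>0. y \<noteq> z \<longrightarrow> \<not> (\<forall>\<^sub>F r in at_right 0. f y r = f z r))"
proof -
  have "\<forall>y. \<exists>k v Y. 0 < y \<longrightarrow> 0 < k \<and> phase 1 {0<..} v Y \<and> (v \<longlongrightarrow> k powr scale_exp * 1) (at_right 0) \<and>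
    (Y \<longlongrightarrow> k powr - ((scale_exp + 1) / alpha) * y) (at_right 0) \<and> (v \<longlongrightarrow> u0) at_top"
  proof
    fix y
    show "\<exists>k v Y. 0 < y \<longrightarrow> 0 < k \<and> phase 1 {0<..} v Y \<and> (v \<longlongrightarrow> k powr scale_exp * 1) (at_right 0) \<and>
      (Y \<longlongrightarrow> k powr - ((scale_exp + 1) / alpha) * y) (at_right 0) \<and> (v \<longlongrightarrow> u0) at_top"
    proof (cases "0 < y")
      case True
      then show ?thesis using phase_from_0_with_limit[of 1 y u0] u0 by auto
    qed auto
  qed
  then obtain k v Y where *: "\<And>y. 0 < y \<Longrightarrow> 0 < k y \<and> phase 1 {0<..} (v y) (Y y) \<and> (v y \<longlongrightarrow> k y powr scale_exp * 1) (at_right 0) \<and>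
    (Y y \<longlongrightarrow> k y powr - ((scale_exp + 1) / alpha) * y) (at_right 0) \<and> (v y \<longlongrightarrow> u0) at_top" by metis
  define f where "f y = restrict (\<lambda>r. v y (r powr - nu)) (einterval 0 \<infinity>)" for y
  have f: "f y \<in> solutions N m p q 0 \<infinity>" "(f y \<longlongrightarrow> u0) (at_right 0)" "\<And>r. 0 < r \<Longrightarrow> f y r = v y (r powr - nu)" if "0 < y" for y
    using global_phase_solution[of "v y" "Y y" u0] *[OF that] unfolding f_def by blast+
  have inj: "y = z" if y: "0 < y" and z: "0 < z" and ev: "\<forall>\<^sub>F r in at_right 0. f y r = f z r" for y z
  proof -
    obtain r1 where r1: "0 < r1" "\<And>r. 0 < r \<Longrightarrow> r < r1 \<Longrightarrow> f y r = f z r"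
      using ev by (auto simp: eventually_at_right_field)
    have "v y s = v z s" if s: "r1 powr - nu < s" for s
    proof -
      have s0: "0 < s" using s r1 by (smt (verit) powr_ge_zero)
      then have "s powr - (1 / nu) < r1"
        using powr_nu_less_iff[of r1 "s powr - (1 / nu)"] powr_nu_inverse[of s] s r1 by simp
      then show ?thesis using r1(2)[of "s powr - (1 / nu)"] f(3)[OF y, of "s powr - (1 / nu)"] f(3)[OF z, of "s powr - (1 / nu)"]
          powr_nu_inverse[OF s0] s0 by simp
    qed
    then have eq: "v y s = v z s" "Y y s = Y z s" if "0 < s" for s
      using phase_unique_from_infinity[of 1 "v y" "Y y" "v z" "Y z" "r1 powr - nu" s] *[OF y] *[OF z] r1 that by auto
    have pos: "\<forall>\<^sub>F s::real in at_right 0. 0 < s" by (rule eventually_at_right_less)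
    have "(v z \<longlongrightarrow> k y powr scale_exp * 1) (at_right 0)"
      by (rule Lim_transform_eventually[of "v y"]) (use *[OF y] eventually_mono[OF pos eq(1)] in auto)
    then have "k y powr scale_exp * 1 = k z powr scale_exp * 1" using *[OF z] tendsto_unique[OF trivial_limit_at_right_real] by blast
    then have "(k y powr scale_exp) powr (1 / scale_exp) = (k z powr scale_exp) powr (1 / scale_exp)" by simp
    then have kk: "k y = k z" using *[OF y] *[OF z] scale_exp_pos by (simp add: powr_powr)
    have "(Y z \<longlongrightarrow> k y powr - ((scale_exp + 1) / alpha) * y) (at_right 0)"
      by (rule Lim_transform_eventually[of "Y y"]) (use *[OF y] eventually_mono[OF pos eq(2)] in auto)
    then have "k y powr - ((scale_exp + 1) / alpha) * y = k z powr - ((scale_exp + 1) / alpha) * z"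
      using *[OF z] tendsto_unique[OF trivial_limit_at_right_real] by blast
    then show "y = z" using kk *[OF z] by simp
  qed
  show ?thesis
  proof (intro exI[of _ f] allI impI conjI)
    fix y z :: real
    assume "0 < y" "0 < z" "y \<noteq> z"
    then show "\<not> (\<forall>\<^sub>F r in at_right 0. f y r = f z r)" using inj by blast
  qed (use f(1,2) in auto)
qed

text \<open>Scaling preserves the value \<open>v = 0\<close> at \<open>s = 0\<close> and moves the
  positive value of \<open>Y\<close> to any other. All solutions vanishing at infinity are therefore
  rescalings of \<open>v1\<close>, and \<open>u0\<close> selects the factor.\<close>

lemma global_unique:
  assumes u0: "0 < u0"
  shows "\<exists>!u. u \<in> solutions N m p q 0 \<infinity> \<and> (u \<longlongrightarrow> u0) (at_right 0) \<and> (u \<longlongrightarrow> 0) at_top"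
proof -
  obtain v1 Y1 where ph1: "phase 1 {0<..} v1 Y1" and lim1: "(v1 \<longlongrightarrow> 0) (at_right 0)" "(Y1 \<longlongrightarrow> 1) (at_right 0)"
    using phase_increasing_exists[of 0 1 0] by auto
  obtain L where L: "0 < L" "(v1 \<longlongrightarrow> L) at_top" using phase_at_top[OF ph1] by auto
  define k0 where "k0 = (u0 / L) powr (1 / scale_exp)"
  have k0: "0 < k0" using u0 L by (simp add: k0_def)
  have ksc: "k0 powr scale_exp * L = u0" using u0 L scale_exp_pos by (simp add: k0_def powr_powr)
  let ?v = "\<lambda>s. k0 powr scale_exp * v1 (k0 * s)"
  let ?u = "restrict (\<lambda>r. ?v (r powr - nu)) (einterval 0 \<infinity>)"
  have top: "(?v \<longlongrightarrow> u0) at_top" using tendsto_scale_at_top[OF L(2) k0, of "k0 powr scale_exp"] ksc by simp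
  have zero: "(?v \<longlongrightarrow> 0) (at_right 0)" using tendsto_scale_at_right_0[OF lim1(1) k0, of "k0 powr scale_exp"] by simp
  note sol = global_phase_solution[OF phase_scale[OF ph1 k0] top]
  have "(?u \<longlongrightarrow> 0) at_top"
    by (rule Lim_transform_eventually[OF filterlim_compose[OF zero powr_neg_at_right_0[OF nu_pos]]])
       (rule eventually_mono[OF eventually_gt_at_top[of 0]], simp add: einterval_0_inf)
  moreover have "u = ?u" if u: "u \<in> solutions N m p q 0 \<infinity>" "(u \<longlongrightarrow> u0) (at_right 0)" "(u \<longlongrightarrow> 0) at_top" for u
  proof -
    have us: "is_solution N m p q 0 \<infinity> u" and ext: "u \<in> extensional (einterval 0 \<infinity>)"
      using u(1) by (auto simp: solutions_def)
    let ?w = "\<lambda>s. u (s powr - (1 / nu))"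
    obtain Y where ph: "phase 1 {0<..} ?w Y" using solution_near_0[OF us] by auto
    have w0: "(?w \<longlongrightarrow> 0) (at_right 0)"
      using filterlim_compose[OF u(3) powr_neg_at_top, of "1 / nu"] nu_pos by simp
    have wtop: "(?w \<longlongrightarrow> u0) at_top"
      using filterlim_compose[OF u(2) powr_neg_at_right_0, of "1 / nu"] nu_pos by simp
    have "phase 1 {0<..<1} ?w Y" by (rule phase_subset[OF ph]) auto
    then obtain y where y: "0 < y" "(Y \<longlongrightarrow> y) (at_right 0)" using phase_increasing_at_0[of 1 ?w Y] by auto
    \<comment> \<open>The factor for which the rescaled \<open>Y1\<close> has limit \<open>y\<close>
      at 0, so that \<open>u\<close> and the rescaled \<open>v1\<close> have the same data
      there.\<close>
    define k where "k = y powr - (alpha / (scale_exp + 1))"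
    have k: "0 < k" using y by (simp add: k_def)
    have ky: "k powr - ((scale_exp + 1) / alpha) * 1 = y" using y alpha_pos scale_exp_pos by (simp add: k_def powr_powr)
    have eq: "?w s = k powr scale_exp * v1 (k * s)" if "0 < s" for s
    proof (rule phase_increasing_unique_from_0[OF ph phase_scale[OF ph1 k] w0 _ y(2) _ order_refl y(1) that])
      show "((\<lambda>s. k powr scale_exp * v1 (k * s)) \<longlongrightarrow> 0) (at_right 0)"
        using tendsto_scale_at_right_0[OF lim1(1) k, of "k powr scale_exp"] by simp
      show "((\<lambda>s. k powr - ((scale_exp + 1) / alpha) * Y1 (k * s)) \<longlongrightarrow> y) (at_right 0)"
        using tendsto_scale_at_right_0[OF lim1(2) k, of "k powr - ((scale_exp + 1) / alpha)"] unfolding ky .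
    qed
    have "(?w \<longlongrightarrow> k powr scale_exp * L) at_top"
      by (rule Lim_transform_eventually[OF tendsto_scale_at_top[OF L(2) k]])
         (rule eventually_mono[OF eventually_gt_at_top[of 0]], simp add: eq)
    then have "k powr scale_exp * L = u0" using wtop tendsto_unique[OF trivial_limit_at_top_linorder] by blast
    then have "k powr scale_exp = u0 / L" using L by (simp add: field_simps)
    then have "(k powr scale_exp) powr (1 / scale_exp) = k0" by (simp add: k0_def)
    then have kk: "k = k0" using k scale_exp_pos by (simp add: powr_powr)
    show "u = ?u"
    proof (rule extensionalityI[OF ext])
      fix r assume "r \<in> einterval 0 \<infinity>"
      then have r: "0 < r" by (simp add: einterval_0_inf)
      then show "u r = ?u r" using eq[of "r powr - nu"] powr_nu_inverse(1)[OF r] kk by (simp add: einterval_0_inf)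
    qed simp
  qed
  ultimately show ?thesis using sol(1,2) by blast
qed

section \<open>Solutions that end or start at a finite radius\<close>

lemma weight_blow_up:
  assumes Y: "(Y \<longlongrightarrow> 0) G" "\<forall>\<^sub>F s in G. 0 < Y s" and s: "filterlim (\<lambda>r. r powr - nu) G F"
    and id: "((\<lambda>r. r) \<longlongrightarrow> \<rho>) F" and \<rho>: "0 < \<rho>"
  shows "filterlim (\<lambda>r. nu * r powr - (nu + 1) * Y (r powr - nu) powr - alpha) at_top F"
proof -
  have "filterlim Y (at_right 0) G" unfolding filterlim_at using Y by (auto elim!: eventually_mono)
  then have "filterlim (\<lambda>s. Y s powr - alpha) at_top G" by (rule filterlim_compose[OF powr_neg_at_top[OF alpha_pos]])
  then have A: "filterlim (\<lambda>r. Y (r powr - nu) powr - alpha) at_top F" by (rule filterlim_compose[OF _ s])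
  have L: "((\<lambda>r. nu * r powr - (nu + 1)) \<longlongrightarrow> nu * \<rho> powr - (nu + 1)) F"
    using id \<rho> by (intro tendsto_intros) auto
  have P: "0 < nu * \<rho> powr - (nu + 1)" using nu_pos \<rho> by simp
  show ?thesis by (rule filterlim_tendsto_pos_mult_at_top[OF L P A])
qed

text \<open>Radii below \<open>\<rho>\<close> correspond to \<open>s\<close> above
  \<open>\<rho> powr - nu\<close>, where the increasing flow is global. Data with
  \<open>v0 = 0\<close> make \<open>u\<close> vanish at \<open>\<rho>\<close>, and data with
  \<open>y0 = 0\<close> make its slope infinite.\<close>

lemma solution_up_to:
  fixes \<rho> y0 v0 :: real
  assumes \<rho>: "0 < \<rho>" and init: "0 < y0 \<and> 0 \<le> v0 \<or> y0 = 0 \<and> 0 < v0"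
  shows "\<exists>u\<in>solutions N m p q 0 (ereal \<rho>). (u \<longlongrightarrow> v0) (at_left \<rho>) \<and>
    (y0 = 0 \<longrightarrow> filterlim (deriv u) at_bot (at_left \<rho>))"
proof -
  have "0 < \<rho> powr - nu" using \<rho> by simp
  then obtain v Y where ph: "phase 1 {\<rho> powr - nu<..} v Y"
    and lim: "(v \<longlongrightarrow> v0) (at_right (\<rho> powr - nu))" "(Y \<longlongrightarrow> y0) (at_right (\<rho> powr - nu))"
    using phase_increasing_exists[of "\<rho> powr - nu" y0 v0] init by auto
  let ?I = "einterval 0 (ereal \<rho>)"
  let ?u = "restrict (\<lambda>r. v (r powr - nu)) ?I"
  have I: "?I = {0<..<\<rho>}" by (auto simp: einterval_iff)
  have S: "r powr - nu \<in> {\<rho> powr - nu<..}" if "r \<in> ?I" for r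
    using that powr_nu_less_iff[of \<rho> r] \<rho> unfolding I by simp
  have a: "0 \<le> (0::ereal)" "0 < ereal \<rho>" "(1::real) = 1 \<or> (1::real) = -1" using \<rho> by auto
  note sol = phase_to_solution[OF a ph S]
  have ev: "\<forall>\<^sub>F r in at_left \<rho>. r \<in> ?I" unfolding I by (rule eventually_at_left_real[OF \<rho>])
  have left: "filterlim (\<lambda>r. r powr - nu) (at_right (\<rho> powr - nu)) (at_left \<rho>)" using powr_neg_at_left[OF nu_pos \<rho>] .
  have "(?u \<longlongrightarrow> v0) (at_left \<rho>)"
    by (rule Lim_transform_eventually[OF filterlim_compose[OF lim(1) left]]) (rule eventually_mono[OF ev], simp)
  moreover have "filterlim (deriv ?u) at_bot (at_left \<rho>)" if y0: "y0 = 0"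
  proof -
    have "filterlim (\<lambda>r. nu * r powr - (nu + 1) * Y (r powr - nu) powr - alpha) at_top (at_left \<rho>)"
    proof (rule weight_blow_up[OF lim(2)[unfolded y0] _ left _ \<rho>])
      show "\<forall>\<^sub>F s in at_right (\<rho> powr - nu). 0 < Y s"
        by (rule eventually_mono[OF eventually_at_right_less]) (use phaseD(2)[OF ph] in auto)
    qed (rule tendsto_ident_at)
    then have A: "filterlim (\<lambda>r. - (nu * r powr - (nu + 1) * Y (r powr - nu) powr - alpha)) at_bot (at_left \<rho>)"
      by (simp only: filterlim_uminus_at_top)
    have B: "\<forall>\<^sub>F r in at_left \<rho>. - (nu * r powr - (nu + 1) * Y (r powr - nu) powr - alpha) = deriv ?u r"
      by (rule eventually_mono[OF ev]) (use sol(3) in simp)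
    show ?thesis using A filterlim_cong[OF refl refl B] by blast
  qed
  ultimately show ?thesis using sol(1) by blast
qed

text \<open>Radii above \<open>\<rho>\<close> correspond to the bounded interval between 0 and
  \<open>\<rho> powr - nu\<close>, which the reversed flow covers entirely.\<close>

lemma solution_from:
  fixes \<rho> y0 v0 :: real
  assumes \<rho>: "0 < \<rho>" and init: "0 < y0 \<and> 0 \<le> v0 \<or> y0 = 0 \<and> 0 < v0"
  shows "\<exists>u\<in>solutions N m p q (ereal \<rho>) \<infinity>. (u \<longlongrightarrow> v0) (at_right \<rho>) \<and>
    (y0 = 0 \<longrightarrow> filterlim (deriv u) at_top (at_right \<rho>))"
proof -
  have s1: "0 < \<rho> powr - nu" using \<rho> by simp
  obtain v Y where ph: "phase (-1) {0<..<\<rho> powr - nu} v Y"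
    and lim: "(v \<longlongrightarrow> v0) (at_left (\<rho> powr - nu))" "(Y \<longlongrightarrow> y0) (at_left (\<rho> powr - nu))"
    using phase_decreasing_exists[OF s1 init] by blast
  let ?I = "einterval (ereal \<rho>) \<infinity>"
  let ?u = "restrict (\<lambda>r. v (r powr - nu)) ?I"
  have I: "?I = {\<rho><..}" by (auto simp: einterval_iff)
  have S: "r powr - nu \<in> {0<..<\<rho> powr - nu}" if "r \<in> ?I" for r
    using that powr_nu_less_iff[of r \<rho>] \<rho> unfolding I by simp
  have a: "0 \<le> ereal \<rho>" "ereal \<rho> < \<infinity>" "(-1::real) = 1 \<or> (-1::real) = -1" using \<rho> by auto
  note sol = phase_to_solution[OF a ph S]
  have ev: "\<forall>\<^sub>F r in at_right \<rho>. r \<in> ?I" unfolding I by (simp add: eventually_at_right_less)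
  have right: "filterlim (\<lambda>r. r powr - nu) (at_left (\<rho> powr - nu)) (at_right \<rho>)" using powr_neg_at_right[OF nu_pos \<rho>] .
  have "(?u \<longlongrightarrow> v0) (at_right \<rho>)"
    by (rule Lim_transform_eventually[OF filterlim_compose[OF lim(1) right]]) (rule eventually_mono[OF ev], simp)
  moreover have "filterlim (deriv ?u) at_top (at_right \<rho>)" if y0: "y0 = 0"
  proof -
    have A: "filterlim (\<lambda>r. nu * r powr - (nu + 1) * Y (r powr - nu) powr - alpha) at_top (at_right \<rho>)"
    proof (rule weight_blow_up[OF lim(2)[unfolded y0] _ right _ \<rho>])
      show "\<forall>\<^sub>F s in at_left (\<rho> powr - nu). 0 < Y s"
        by (rule eventually_mono[OF eventually_at_left_real[OF s1]]) (use phaseD(2)[OF ph] in auto)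
    qed (rule tendsto_ident_at)
    have B: "\<forall>\<^sub>F r in at_right \<rho>. nu * r powr - (nu + 1) * Y (r powr - nu) powr - alpha = deriv ?u r"
      by (rule eventually_mono[OF ev]) (use sol(3) in simp)
    show ?thesis using A filterlim_cong[OF refl refl B] by blast
  qed
  ultimately show ?thesis using sol(1) by blast
qed

end

theorem theorem1p4:
  fixes N :: nat and m p q :: real
  assumes "N \<ge> 1" and "1 < m" and "m < real N" and "q > m" and "p \<ge> 0"
  shows
    "(\<forall>b u. is_solution N m p q 0 b u \<longrightarrow>
        Bfun u (at_right 0) \<and> strict_antimono_on (einterval 0 b) u \<and>
        (\<exists>u0>0. singular_at_0 N m p q u0 u))
     \<and> (\<forall>u0>0. \<exists>S :: (real \<Rightarrow> real) set. infinite S \<and>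
        (\<forall>u\<in>S. \<exists>b. is_solution N m p q 0 b u \<and> strict_antimono_on (einterval 0 b) u \<and>
                   singular_at_0 N m p q u0 u) \<and>
        pairwise (\<lambda>u v. \<not> (\<forall>\<^sub>F r in at_right 0. u r = v r)) S)
     \<and> (\<forall>a u. is_solution N m p q a \<infinity> u \<longrightarrow>
        (\<exists>l\<ge>0. (u \<longlongrightarrow> l) at_top \<and>
          (\<exists>k>0. ((\<lambda>r. r powr ((real N - m) / (m - 1)) * \<bar>u r - l\<bar>) \<longlongrightarrow> k) at_top)))
     \<and> (\<forall>l>0. \<forall>c. c \<noteq> 0 \<longrightarrow>
        (\<exists>R u. is_solution N m p q (ereal R) \<infinity> u \<and>
          ((\<lambda>r. r powr ((real N - m) / (m - 1)) * (u r - l)) \<longlongrightarrow> c) at_top) \<and>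
        (\<forall>R R' u v.
          is_solution N m p q (ereal R) \<infinity> u \<and>
          ((\<lambda>r. r powr ((real N - m) / (m - 1)) * (u r - l)) \<longlongrightarrow> c) at_top \<and>
          is_solution N m p q (ereal R') \<infinity> v \<and>
          ((\<lambda>r. r powr ((real N - m) / (m - 1)) * (v r - l)) \<longlongrightarrow> c) at_top \<longrightarrow>
          (\<forall>\<^sub>F r in at_top. u r = v r)))
     \<and> (\<forall>u0>0.
        infinite {u \<in> solutions N m p q 0 \<infinity>.
          strict_antimono_on (einterval 0 \<infinity>) u \<and> (u \<longlongrightarrow> u0) (at_right 0)} \<and>
        (\<exists>!u. u \<in> solutions N m p q 0 \<infinity> \<and>
          (u \<longlongrightarrow> u0) (at_right 0) \<and> (u \<longlongrightarrow> 0) at_top))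
     \<and> infinite {(\<rho>, u). 0 < \<rho> \<and> u \<in> solutions N m p q 0 (ereal \<rho>) \<and> (u \<longlongrightarrow> 0) (at_left \<rho>)}
     \<and> infinite {(\<rho>, u). 0 < \<rho> \<and> u \<in> solutions N m p q 0 (ereal \<rho>) \<and>
          filterlim (deriv u) at_bot (at_left \<rho>)}
     \<and> infinite {(\<rho>, u). 0 < \<rho> \<and> u \<in> solutions N m p q (ereal \<rho>) \<infinity> \<and> (u \<longlongrightarrow> 0) (at_right \<rho>)}
     \<and> infinite {(\<rho>, u). 0 < \<rho> \<and> u \<in> solutions N m p q (ereal \<rho>) \<infinity> \<and>
          filterlim (deriv u) at_top (at_right \<rho>)}"
proof -
  interpret radial_parameters N m p q by unfold_locales (use assms in auto)
  \<comment> \<open>One family serves two claims: its members are defined on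
    \<open>(0, \<infinity>)\<close>, and they differ as germs at 0, so they also count as distinct
    local solutions.\<close>
  have family: "\<exists>S. infinite S \<and> S \<subseteq> {u \<in> solutions N m p q 0 \<infinity>. (u \<longlongrightarrow> u0) (at_right 0)} \<and>
      pairwise (\<lambda>u v. \<not> (\<forall>\<^sub>F r in at_right 0. u r = v r)) S" if u0: "0 < u0" for u0
  proof -
    obtain f :: "real \<Rightarrow> real \<Rightarrow> real" where f: "\<forall>y>0. f y \<in> solutions N m p q 0 \<infinity> \<and> (f y \<longlongrightarrow> u0) (at_right 0) \<and>
      (\<forall>z>0. y \<noteq> z \<longrightarrow> \<not> (\<forall>\<^sub>F r in at_right 0. f y r = f z r))" using global_family[OF u0] by blast
    have "inj_on f {0<..}"
    proof (rule inj_onI)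
      fix y z :: real assume yz: "y \<in> {0<..}" "z \<in> {0<..}" "f y = f z"
      then have "\<forall>\<^sub>F r in at_right 0. f y r = f z r" by simp
      with yz(1,2) show "y = z" using f by (metis greaterThan_iff)
    qed
    then have "infinite (f ` {0<..})" using finite_imageD infinite_Ioi by blast
    moreover have "pairwise (\<lambda>u v. \<not> (\<forall>\<^sub>F r in at_right 0. u r = v r)) (f ` {0<..})"
      using f by (auto simp: pairwise_def)
    ultimately show ?thesis using f by (intro exI[of _ "f ` {0<..}"]) auto
  qed
  have sol_of: "is_solution N m p q a b u" if "u \<in> solutions N m p q a b" for a b u
    using that by (simp add: solutions_def)
  show ?thesis
    unfolding nu_def[symmetric]
  proof (intro conjI allI impI)
    fix b u assume sol: "is_solution N m p q 0 b u"
    show "\<exists>u0>0. singular_at_0 N m p q u0 u" by (rule solution_singular_at_0[OF sol])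
    then show "Bfun u (at_right 0)" unfolding singular_at_0_def using tendsto_imp_Bfun by blast
    show "strict_antimono_on (einterval 0 b) u" by (rule solution_antimono[OF sol])
  next
    fix u0 :: real assume "0 < u0"
    then obtain S where S: "infinite S" "S \<subseteq> {u \<in> solutions N m p q 0 \<infinity>. (u \<longlongrightarrow> u0) (at_right 0)}"
      "pairwise (\<lambda>u v. \<not> (\<forall>\<^sub>F r in at_right 0. u r = v r)) S" using family by blast
    have "\<exists>b. is_solution N m p q 0 b u \<and> strict_antimono_on (einterval 0 b) u \<and> singular_at_0 N m p q u0 u" if "u \<in> S" for u
      using S(2) that sol_of solution_antimono singular_at_0_of_limit by blast
    with S show "\<exists>S :: (real \<Rightarrow> real) set. infinite S \<and>
        (\<forall>u\<in>S. \<exists>b. is_solution N m p q 0 b u \<and> strict_antimono_on (einterval 0 b) u \<and>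
                   singular_at_0 N m p q u0 u) \<and>
        pairwise (\<lambda>u v. \<not> (\<forall>\<^sub>F r in at_right 0. u r = v r)) S" by blast
  next
    fix a u assume "is_solution N m p q a \<infinity> u"
    then show "\<exists>l\<ge>0. (u \<longlongrightarrow> l) at_top \<and> (\<exists>k>0. ((\<lambda>r. r powr nu * \<bar>u r - l\<bar>) \<longlongrightarrow> k) at_top)"
      by (rule decay_at_infinity)
  next
    fix l c :: real assume "0 < l" "c \<noteq> 0"
    then show "\<exists>R u. is_solution N m p q (ereal R) \<infinity> u \<and> ((\<lambda>r. r powr nu * (u r - l)) \<longlongrightarrow> c) at_top"
      by (rule local_solution_at_infinity_exists)
  next
    fix l c :: real and R R' u v
    assume l: "0 < l" and *: "is_solution N m p q (ereal R) \<infinity> u \<and> ((\<lambda>r. r powr nu * (u r - l)) \<longlongrightarrow> c) at_top \<and>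
          is_solution N m p q (ereal R') \<infinity> v \<and> ((\<lambda>r. r powr nu * (v r - l)) \<longlongrightarrow> c) at_top"
    show "\<forall>\<^sub>F r in at_top. u r = v r"
      by (rule local_solution_at_infinity_unique[OF l]) (use * in blast)+
  next
    fix u0 :: real assume u0: "0 < u0"
    obtain S where S: "infinite S" "S \<subseteq> {u \<in> solutions N m p q 0 \<infinity>. (u \<longlongrightarrow> u0) (at_right 0)}"
      using family[OF u0] by blast
    then have "S \<subseteq> {u \<in> solutions N m p q 0 \<infinity>. strict_antimono_on (einterval 0 \<infinity>) u \<and> (u \<longlongrightarrow> u0) (at_right 0)}"
      using sol_of solution_antimono by blast
    with S(1) show "infinite {u \<in> solutions N m p q 0 \<infinity>. strict_antimono_on (einterval 0 \<infinity>) u \<and> (u \<longlongrightarrow> u0) (at_right 0)}"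
      using finite_subset by blast
    show "\<exists>!u. u \<in> solutions N m p q 0 \<infinity> \<and> (u \<longlongrightarrow> u0) (at_right 0) \<and> (u \<longlongrightarrow> 0) at_top"
      by (rule global_unique[OF u0])
  next
    \<comment> \<open>The data \<open>(v, Y)\<close> at the endpoint are \<open>(0, 1)\<close> for
      solutions vanishing there and \<open>(1, 0)\<close> for those with infinite slope.\<close>
    show "infinite {(\<rho>, u). 0 < \<rho> \<and> u \<in> solutions N m p q 0 (ereal \<rho>) \<and> (u \<longlongrightarrow> 0) (at_left \<rho>)}"
      by (rule infinite_pairs) (use solution_up_to[of _ 1 0] in auto)
    show "infinite {(\<rho>, u). 0 < \<rho> \<and> u \<in> solutions N m p q 0 (ereal \<rho>) \<and> filterlim (deriv u) at_bot (at_left \<rho>)}"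
      by (rule infinite_pairs) (use solution_up_to[of _ 0 1] in auto)
    show "infinite {(\<rho>, u). 0 < \<rho> \<and> u \<in> solutions N m p q (ereal \<rho>) \<infinity> \<and> (u \<longlongrightarrow> 0) (at_right \<rho>)}"
      by (rule infinite_pairs) (use solution_from[of _ 1 0] in auto)
    show "infinite {(\<rho>, u). 0 < \<rho> \<and> u \<in> solutions N m p q (ereal \<rho>) \<infinity> \<and> filterlim (deriv u) at_top (at_right \<rho>)}"
      by (rule infinite_pairs) (use solution_from[of _ 0 1] in auto)
  qed
qed

end
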